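(* Fix $C\geq1$, $D\geq0$. Let $\mathfrak{A}$ be a unital AF algebra such that $(\mathfrak{A},\mathsf{L})$ is a $(C,D)$-quasi-Leibniz quantum compact metric space. Let $(\mathfrak{A}_n)_{n\in\mathbb{N}}$ be a non-decreasing sequence of unital finite dimensional C*-subalgebras of $\mathfrak{A}$ (containing $1_{\mathfrak{A}}$) such that $\mathfrak{A}=\overline{\cup_{n\in\mathbb{N}}\mathfrak{A}_n}^{\|\cdot\|_{\mathfrak{A}}}$ and $\mathrm{dom}(\mathsf{L})\supseteq\mathfrak{sa}(\cup_{n\in\mathbb{N}}\mathfrak{A}_n)$. Define a seminorm on $\mathfrak{sa}(\mathfrak{A})$ by $\mathsf{L}_f(a)=\mathsf{L}(a)$ if $a\in\mathfrak{sa}(\cup_{n\in\mathbb{N}}\mathfrak{A}_n)$ and $\mathsf{L}_f(a)=\infty$ otherwise. Let $L_{f,1}=\overline{\{a\in\mathfrak{sa}(\mathfrak{A}):\mathsf{L}_f(a)\leq1\}}^{\|\cdot\|_{\mathfrak{A}}}$, and let $\overline{\mathsf{L}}$ be the Minkowski functional of $L_{f,1}$ on $\mathfrak{sa}(\mathfrak{A})$, i.e. $\overline{\mathsf{L}}(a)=\inf\{r>0:\frac1r a\in L_{f,1}\}$ for all $a\in\mathfrak{sa}(\mathfrak{A})$ (with $\inf\emptyset=\infty$). Then: $$\overline{\mathsf{L}}(a)=\mathsf{L}_f(a)=\mathsf{L}(a)<\infty\quad\text{for all }a\in\mathfrak{sa}(\cup_{n\in\mathbb{N}}\mathfrak{A}_n),$$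 $$\{a\in\mathfrak{sa}(\mathfrak{A}):\overline{\mathsf{L}}(a)\leq1\}=\overline{\{a\in\mathfrak{sa}(\cup_{n\in\mathbb{N}}\mathfrak{A}_n):\overline{\mathsf{L}}(a)\leq1\}}^{\|\cdot\|_{\mathfrak{A}}}=\overline{\{a\in\mathfrak{sa}(\cup_{n\in\mathbb{N}}\mathfrak{A}_n):\mathsf{L}(a)\leq1\}}^{\|\cdot\|_{\mathfrak{A}}},$$ and $(\mathfrak{A},\overline{\mathsf{L}})$ and $(\mathfrak{A}_n,\overline{\mathsf{L}})=(\mathfrak{A}_n,\mathsf{L})$ (seminorms restricted to $\mathfrak{sa}(\mathfrak{A}_n)$) are $(C,D)$-quasi-Leibniz quantum compact metric spaces for all $n\in\mathbb{N}$, such that $$\lim_{n\to\infty}\mathsf{\Lambda}_{C,D}\left((\mathfrak{A}_n,\overline{\mathsf{L}}),(\mathfrak{A},\overline{\mathsf{L}})\right)=0,$$ where $\mathsf{\Lambda}_{C,D}$ is the quantum Gromov-Hausdorff propinquity.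
   Context: **Quantum compact metric spaces.** For a unital C*-algebra $\mathfrak{A}$: $1_{\mathfrak{A}}$ is its unit, $\mathfrak{sa}(\mathfrak{A})$ its self-adjoint part, $\mathscr{S}(\mathfrak{A})$ its state space; $\mathfrak{sa}(\cup_n\mathfrak{A}_n)$ denotes the self-adjoint elements of $\cup_n\mathfrak{A}_n$. For $C\geq1$, $D\geq0$, a $(C,D)$-quasi-Leibniz quantum compact metric space $(\mathfrak{A},\mathsf{L})$ is a unital C*-algebra $\mathfrak{A}$ with a seminorm $\mathsf{L}:\mathfrak{sa}(\mathfrak{A})\to[0,\infty]$ such that $\mathrm{dom}(\mathsf{L})=\{a\in\mathfrak{sa}(\mathfrak{A}):\mathsf{L}(a)<\infty\}$ is a dense unital Jordan-Lie subalgebra of $\mathfrak{sa}(\mathfrak{A})$ and: (i) $\{a:\mathsf{L}(a)=0\}=\mathbb{R}1_{\mathfrak{A}}$; (ii) for all $a,b\in\mathrm{dom}(\mathsf{L})$, $\max\{\mathsf{L}(\frac{ab+ba}{2}),\mathsf{L}(\frac{ab-ba}{2i})\}\leq C(\|a\|\mathsf{L}(b)+\|b\|\mathsf{L}(a))+D\mathsf{L}(a)\mathsf{L}(b)$; (iii) the metric $\mathsf{mk}_{\mathsf{L}}(\varphi,\psi)=\sup\{|\varphi(a)-\psi(a)|:a\in\mathrm{dom}(\mathsf{L}),\mathsf{L}(a)\leq1\}$ metrizes the weak* topology of $\mathscr{S}(\mathfrak{A})$; (iv) $\mathsf{L}$ is lower semi-continuous for $\|\cdot\|_{\mathfrak{A}}$.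 **Quantum propinquity.** A bridge $\gamma=(\mathfrak{D},\pi_{\mathfrak{A}},\pi_{\mathfrak{B}},\omega)$ from $\mathfrak{A}$ to $\mathfrak{B}$ consists of a unital C*-algebra $\mathfrak{D}$, unital *-monomorphisms $\pi_{\mathfrak{A}}:\mathfrak{A}\to\mathfrak{D}$, $\pi_{\mathfrak{B}}:\mathfrak{B}\to\mathfrak{D}$ and $\omega\in\mathfrak{D}$ such that $\mathscr{S}_1(\mathfrak{D}|\omega)=\{\varphi\in\mathscr{S}(\mathfrak{D}):\varphi(1-\omega^*\omega)=\varphi(1-\omega\omega^* )=0\}\neq\emptyset$. Its height is the maximum of the Hausdorff distances, for $\mathsf{mk}_{\mathsf{L}_{\mathfrak{A}}}$ and $\mathsf{mk}_{\mathsf{L}_{\mathfrak{B}}}$ respectively, between $\mathscr{S}(\mathfrak{A})$ and $\{\varphi\circ\pi_{\mathfrak{A}}:\varphi\in\mathscr{S}_1(\mathfrak{D}|\omega)\}$, and between $\mathscr{S}(\mathfrak{B})$ and $\{\varphi\circ\pi_{\mathfrak{B}}:\varphi\in\mathscr{S}_1(\mathfrak{D}|\omega)\}$. Its reach is the Hausdorff distance between $\{a\in\mathfrak{sa}(\mathfrak{A}):\mathsf{L}_{\mathfrak{A}}(a)\leq1\}$ and $\{b\in\mathfrak{sa}(\mathfrak{B}):\mathsf{L}_{\mathfrak{B}}(b)\leq1\}$, where the distance from $a$ to $b$ is $\|\pi_{\mathfrak{A}}(a)\omega-\omega\pi_{\mathfrak{B}}(b)\|_{\mathfrak{D}}$.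 Its length is the maximum of height and reach. The quantum propinquity $\mathsf{\Lambda}_{C,D}$ is the largest $[0,\infty)$-valued function on pairs of $(C,D)$-quasi-Leibniz quantum compact metric spaces that is symmetric, satisfies the triangle inequality, and is at most the length of $\gamma$ for every bridge $\gamma$ between the two spaces (equivalently, the infimum, over finite chains of such spaces joined by bridges, of the sum of the lengths of the bridges). It is zero exactly when there is a *-isomorphism $\pi:\mathfrak{A}\to\mathfrak{B}$ with $\mathsf{L}_{\mathfrak{B}}\circ\pi=\mathsf{L}_{\mathfrak{A}}$. *)

theory Defs
  imports "HOL-Analysis.Analysis" "HOL-Algebra.Module"
begin

section \<open>Unital C*-algebras\<close>

definition complex_ring :: "complex ring" where
  "complex_ring = \<lparr>carrier = UNIV, mult = (*), one = 1, zero = 0, add = (+)\<rparr>"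

record 'a cstar = "(complex, 'a) module" +
  adj :: "'a \<Rightarrow> 'a"
  cnorm :: "'a \<Rightarrow> real"

text \<open>The value outside the carrier is immaterial; it is fixed so that the global axioms
  (nonnegativity and symmetry on the whole type) of \<^locale>\<open>Metric_space\<close> hold.\<close>

definition norm_dist :: "'a cstar \<Rightarrow> 'a \<Rightarrow> 'a \<Rightarrow> real" where
  "norm_dist A x y =
     (if x \<in> carrier A \<and> y \<in> carrier A then cnorm A (x \<ominus>\<^bsub>A\<^esub> y) else 0)"

definition norm_topology :: "'a cstar \<Rightarrow> 'a topology" where
  "norm_topology A = Metric_space.mtopology (carrier A) (norm_dist A)"

text \<open>The zero algebra is excluded, as usual for unital C*-algebras: it has no states.\<close>

locale unital_cstar_algebra = ring A + module complex_ring A for A :: "'a cstar" (structure) +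
  assumes one_not_zero: "\<one> \<noteq> \<zero>"
    and smult_mult_left: "\<lbrakk>x \<in> carrier A; y \<in> carrier A\<rbrakk> \<Longrightarrow> (c \<odot> x) \<otimes> y = c \<odot> (x \<otimes> y)"
    and smult_mult_right: "\<lbrakk>x \<in> carrier A; y \<in> carrier A\<rbrakk> \<Longrightarrow> x \<otimes> (c \<odot> y) = c \<odot> (x \<otimes> y)"
    and adj_closed: "x \<in> carrier A \<Longrightarrow> adj A x \<in> carrier A"
    and adj_adj: "x \<in> carrier A \<Longrightarrow> adj A (adj A x) = x"
    and adj_add: "\<lbrakk>x \<in> carrier A; y \<in> carrier A\<rbrakk> \<Longrightarrow> adj A (x \<oplus> y) = adj A x \<oplus> adj A y"
    and adj_smult: "x \<in> carrier A \<Longrightarrow> adj A (c \<odot> x) = cnj c \<odot> adj A x"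
    and adj_mult: "\<lbrakk>x \<in> carrier A; y \<in> carrier A\<rbrakk> \<Longrightarrow> adj A (x \<otimes> y) = adj A y \<otimes> adj A x"
    and cnorm_nonneg: "x \<in> carrier A \<Longrightarrow> 0 \<le> cnorm A x"
    and cnorm_eq_zero: "x \<in> carrier A \<Longrightarrow> cnorm A x = 0 \<longleftrightarrow> x = \<zero>"
    and cnorm_triangle:
      "\<lbrakk>x \<in> carrier A; y \<in> carrier A\<rbrakk> \<Longrightarrow> cnorm A (x \<oplus> y) \<le> cnorm A x + cnorm A y"
    and cnorm_smult: "x \<in> carrier A \<Longrightarrow> cnorm A (c \<odot> x) = cmod c * cnorm A x"
    and cnorm_mult:
      "\<lbrakk>x \<in> carrier A; y \<in> carrier A\<rbrakk> \<Longrightarrow> cnorm A (x \<otimes> y) \<le> cnorm A x * cnorm A y"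
    and cstar_identity: "x \<in> carrier A \<Longrightarrow> cnorm A (adj A x \<otimes> x) = (cnorm A x)\<^sup>2"
    and complete: "Metric_space.mcomplete (carrier A) (norm_dist A)"

definition self_adjoint :: "'a cstar \<Rightarrow> 'a set" where
  "self_adjoint A = {a \<in> carrier A. adj A a = a}"

text \<open>A C*-subalgebra \<open>S\<close> is a set; as an algebra in its own right it is
  \<open>A\<lparr>carrier := S\<rparr>\<close>. Membership of the unit is not part of the definition.\<close>

definition cstar_subalgebra :: "'a set \<Rightarrow> 'a cstar \<Rightarrow> bool" where
  "cstar_subalgebra S A \<longleftrightarrow>
     submodule S complex_ring A \<and>
     (\<forall>x\<in>S. \<forall>y\<in>S. x \<otimes>\<^bsub>A\<^esub> y \<in> S) \<and>
     (\<forall>x\<in>S. adj A x \<in> S) \<and>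
     closedin (norm_topology A) S"

definition finite_dimensional :: "'a set \<Rightarrow> 'a cstar \<Rightarrow> bool" where
  "finite_dimensional S A \<longleftrightarrow>
     (\<exists>B. finite B \<and> B \<subseteq> S \<and>
        S = {\<Oplus>\<^bsub>A\<^esub>b\<in>B. c b \<odot>\<^bsub>A\<^esub> b | c :: 'a \<Rightarrow> complex. True})"

definition unital_AF_algebra :: "'a cstar \<Rightarrow> bool" where
  "unital_AF_algebra A \<longleftrightarrow>
     unital_cstar_algebra A \<and>
     (\<exists>F :: nat \<Rightarrow> 'a set.
        (\<forall>n. cstar_subalgebra (F n) A \<and> finite_dimensional (F n) A) \<and> mono F \<and>
        norm_topology A closure_of (\<Union>n. F n) = carrier A)"

section \<open>States\<close>

text \<open>States are positive linear functionals taking the value 1 at the unit. They are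
  represented by functions that are \<^const>\<open>extensional\<close> on the carrier, so that equality of
  states is equality of functions.\<close>

definition states :: "'a cstar \<Rightarrow> ('a \<Rightarrow> complex) set" where
  "states A = {\<phi> \<in> extensional (carrier A).
     (\<forall>x\<in>carrier A. \<forall>y\<in>carrier A. \<phi> (x \<oplus>\<^bsub>A\<^esub> y) = \<phi> x + \<phi> y) \<and>
     (\<forall>c. \<forall>x\<in>carrier A. \<phi> (c \<odot>\<^bsub>A\<^esub> x) = c * \<phi> x) \<and>
     (\<forall>x\<in>carrier A. \<phi> (adj A x \<otimes>\<^bsub>A\<^esub> x) \<in> \<real>\<^sub>\<ge>\<^sub>0) \<and>
     \<phi> \<one>\<^bsub>A\<^esub> = 1}"

text \<open>The weak* topology is that of pointwise convergence on the algebra.\<close>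

definition weak_star_topology :: "'a cstar \<Rightarrow> ('a \<Rightarrow> complex) topology" where
  "weak_star_topology A =
     subtopology (product_topology (\<lambda>_. euclidean) (carrier A)) (states A)"

section \<open>Quasi-Leibniz quantum compact metric spaces\<close>

definition jordan_prod :: "'a cstar \<Rightarrow> 'a \<Rightarrow> 'a \<Rightarrow> 'a" where
  "jordan_prod A a b = (1 / 2) \<odot>\<^bsub>A\<^esub> (a \<otimes>\<^bsub>A\<^esub> b \<oplus>\<^bsub>A\<^esub> b \<otimes>\<^bsub>A\<^esub> a)"

definition lie_prod :: "'a cstar \<Rightarrow> 'a \<Rightarrow> 'a \<Rightarrow> 'a" where
  "lie_prod A a b = (1 / (2 * \<i>)) \<odot>\<^bsub>A\<^esub> (a \<otimes>\<^bsub>A\<^esub> b \<ominus>\<^bsub>A\<^esub> b \<otimes>\<^bsub>A\<^esub> a)"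

definition unital_jordan_lie_subalgebra :: "'a set \<Rightarrow> 'a cstar \<Rightarrow> bool" where
  "unital_jordan_lie_subalgebra J A \<longleftrightarrow>
     J \<subseteq> self_adjoint A \<and> \<one>\<^bsub>A\<^esub> \<in> J \<and>
     (\<forall>a\<in>J. \<forall>b\<in>J. a \<oplus>\<^bsub>A\<^esub> b \<in> J) \<and>
     (\<forall>r :: real. \<forall>a\<in>J. complex_of_real r \<odot>\<^bsub>A\<^esub> a \<in> J) \<and>
     (\<forall>a\<in>J. \<forall>b\<in>J. jordan_prod A a b \<in> J \<and> lie_prod A a b \<in> J)"

text \<open>A seminorm on the self-adjoint part with values in \<open>[0,\<infinity>]\<close> is a function into
  \<^typ>\<open>ennreal\<close> (so \<open>0 * \<infinity> = 0\<close>) whose values off the self-adjoint part are irrelevant.\<close>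

definition seminorm_sa :: "'a cstar \<Rightarrow> ('a \<Rightarrow> ennreal) \<Rightarrow> bool" where
  "seminorm_sa A L \<longleftrightarrow>
     (\<forall>a\<in>self_adjoint A. \<forall>b\<in>self_adjoint A. L (a \<oplus>\<^bsub>A\<^esub> b) \<le> L a + L b) \<and>
     (\<forall>r :: real. \<forall>a\<in>self_adjoint A.
        L (complex_of_real r \<odot>\<^bsub>A\<^esub> a) = ennreal \<bar>r\<bar> * L a)"

definition fin_dom :: "'a cstar \<Rightarrow> ('a \<Rightarrow> ennreal) \<Rightarrow> 'a set" where
  "fin_dom A L = {a \<in> self_adjoint A. L a < \<infinity>}"

definition mk_dist :: "'a cstar \<Rightarrow> ('a \<Rightarrow> ennreal) \<Rightarrow> ('a \<Rightarrow> complex) \<Rightarrow> ('a \<Rightarrow> complex) \<Rightarrow> ennreal" where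
  "mk_dist A L \<phi> \<psi> = (SUP a\<in>{a \<in> fin_dom A L. L a \<le> 1}. ennreal (cmod (\<phi> a - \<psi> a)))"

definition mk_metrizes_weak_star :: "'a cstar \<Rightarrow> ('a \<Rightarrow> ennreal) \<Rightarrow> bool" where
  "mk_metrizes_weak_star A L \<longleftrightarrow>
     (\<forall>\<phi>\<in>states A. \<forall>\<psi>\<in>states A. mk_dist A L \<phi> \<psi> < \<infinity>) \<and>
     Metric_space (states A) (\<lambda>\<phi> \<psi>. enn2real (mk_dist A L \<phi> \<psi>)) \<and>
     Metric_space.mtopology (states A) (\<lambda>\<phi> \<psi>. enn2real (mk_dist A L \<phi> \<psi>))
       = weak_star_topology A"

type_synonym 'a seminormed_cstar = "'a cstar \<times> ('a \<Rightarrow> ennreal)"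

definition quasi_Leibniz_qcms :: "real \<Rightarrow> real \<Rightarrow> 'a seminormed_cstar \<Rightarrow> bool" where
  "quasi_Leibniz_qcms C D = (\<lambda>(A, L).
     unital_cstar_algebra A \<and>
     seminorm_sa A L \<and>
     unital_jordan_lie_subalgebra (fin_dom A L) A \<and>
     norm_topology A closure_of (fin_dom A L) = self_adjoint A \<and>
     {a \<in> self_adjoint A. L a = 0} = {complex_of_real r \<odot>\<^bsub>A\<^esub> \<one>\<^bsub>A\<^esub> | r. True} \<and>
     (\<forall>a\<in>fin_dom A L. \<forall>b\<in>fin_dom A L.
        max (L (jordan_prod A a b)) (L (lie_prod A a b))
          \<le> ennreal C * (ennreal (cnorm A a) * L b + ennreal (cnorm A b) * L a)
             + ennreal D * L a * L b) \<and>
     mk_metrizes_weak_star A L \<and>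
     (\<forall>r. closedin (subtopology (norm_topology A) (self_adjoint A))
            {a \<in> self_adjoint A. L a \<le> r}))"

section \<open>The quantum propinquity\<close>

text \<open>The two sets may live in different spaces; \<open>d\<close> only measures across them.\<close>

definition hausdorff :: "('x \<Rightarrow> 'y \<Rightarrow> ennreal) \<Rightarrow> 'x set \<Rightarrow> 'y set \<Rightarrow> ennreal" where
  "hausdorff d X Y = max (SUP x\<in>X. INF y\<in>Y. d x y) (SUP y\<in>Y. INF x\<in>X. d x y)"

definition unital_star_mono :: "'a cstar \<Rightarrow> 'b cstar \<Rightarrow> ('a \<Rightarrow> 'b) \<Rightarrow> bool" where
  "unital_star_mono A B \<pi> \<longleftrightarrow>
     \<pi> \<in> ring_hom A B \<and>
     (\<forall>c. \<forall>x\<in>carrier A. \<pi> (c \<odot>\<^bsub>A\<^esub> x) = c \<odot>\<^bsub>B\<^esub> \<pi> x) \<and>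
     (\<forall>x\<in>carrier A. \<pi> (adj A x) = adj B (\<pi> x)) \<and>
     inj_on \<pi> (carrier A)"

text \<open>Quantification over all C*-algebras (the codomains of bridges) and over all
  intermediate spaces is rendered by quantification over all structures whose carrier is a
  subset of one type of cardinality continuum. Up to isomorphism this loses nothing: a
  quantum compact metric space is separable, since its state space is weak* metrizable, and
  the codomain of a bridge may be replaced, without changing its length, by the separable
  C*-subalgebra generated by the two images and the pivot, because states extend from unital
  C*-subalgebras.\<close>

type_synonym univ = "nat \<Rightarrow> real"

record ('a, 'b) bridge =
  bridge_alg :: "univ cstar"
  left_emb :: "'a \<Rightarrow> univ"
  right_emb :: "'b \<Rightarrow> univ"
  pivot :: univ

definition level_states :: "'a cstar \<Rightarrow> 'a \<Rightarrow> ('a \<Rightarrow> complex) set" where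
  "level_states A w = {\<phi> \<in> states A.
     \<phi> (\<one>\<^bsub>A\<^esub> \<ominus>\<^bsub>A\<^esub> adj A w \<otimes>\<^bsub>A\<^esub> w) = 0 \<and> \<phi> (\<one>\<^bsub>A\<^esub> \<ominus>\<^bsub>A\<^esub> w \<otimes>\<^bsub>A\<^esub> adj A w) = 0}"

definition is_bridge :: "'a cstar \<Rightarrow> 'b cstar \<Rightarrow> ('a, 'b) bridge \<Rightarrow> bool" where
  "is_bridge A B \<gamma> \<longleftrightarrow>
     unital_cstar_algebra (bridge_alg \<gamma>) \<and>
     unital_star_mono A (bridge_alg \<gamma>) (left_emb \<gamma>) \<and>
     unital_star_mono B (bridge_alg \<gamma>) (right_emb \<gamma>) \<and>
     pivot \<gamma> \<in> carrier (bridge_alg \<gamma>) \<and>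
     level_states (bridge_alg \<gamma>) (pivot \<gamma>) \<noteq> {}"

definition bridge_height ::
    "'a seminormed_cstar \<Rightarrow> 'b seminormed_cstar \<Rightarrow> ('a, 'b) bridge \<Rightarrow> ennreal" where
  "bridge_height = (\<lambda>(A, L) (B, M) \<gamma>.
     let S1 = level_states (bridge_alg \<gamma>) (pivot \<gamma>) in
     max (hausdorff (mk_dist A L) (states A) ((\<lambda>\<phi>. compose (carrier A) \<phi> (left_emb \<gamma>)) ` S1))
         (hausdorff (mk_dist B M) (states B) ((\<lambda>\<phi>. compose (carrier B) \<phi> (right_emb \<gamma>)) ` S1)))"

definition bridge_reach ::
    "'a seminormed_cstar \<Rightarrow> 'b seminormed_cstar \<Rightarrow> ('a, 'b) bridge \<Rightarrow> ennreal" where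
  "bridge_reach = (\<lambda>(A, L) (B, M) \<gamma>.
     let E = bridge_alg \<gamma>; w = pivot \<gamma> in
     hausdorff
       (\<lambda>a b. ennreal (cnorm E (left_emb \<gamma> a \<otimes>\<^bsub>E\<^esub> w \<ominus>\<^bsub>E\<^esub> w \<otimes>\<^bsub>E\<^esub> right_emb \<gamma> b)))
       {a \<in> self_adjoint A. L a \<le> 1} {b \<in> self_adjoint B. M b \<le> 1})"

definition bridge_length ::
    "'a seminormed_cstar \<Rightarrow> 'b seminormed_cstar \<Rightarrow> ('a, 'b) bridge \<Rightarrow> ennreal" where
  "bridge_length X Y \<gamma> = max (bridge_height X Y \<gamma>) (bridge_reach X Y \<gamma>)"

text \<open>\<open>trek C D X Y r\<close>: some finite chain of bridges through \<open>(C,D)\<close>-quasi-Leibniz spaces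
  leads from \<open>X\<close> to the space \<open>Y\<close> over \<^typ>\<open>univ\<close> with total length \<open>r\<close>. The last bridge of a
  chain is added in the definition of the propinquity, since its target may be over another
  type.\<close>

inductive trek :: "real \<Rightarrow> real \<Rightarrow> 'a seminormed_cstar \<Rightarrow> univ seminormed_cstar \<Rightarrow> ennreal \<Rightarrow> bool"
  for C D :: real and X :: "'a seminormed_cstar" where
  first: "\<lbrakk>quasi_Leibniz_qcms C D Y; is_bridge (fst X) (fst Y) \<gamma>\<rbrakk>
    \<Longrightarrow> trek C D X Y (bridge_length X Y \<gamma>)"
| step: "\<lbrakk>trek C D X Y r; quasi_Leibniz_qcms C D Z; is_bridge (fst Y) (fst Z) \<gamma>\<rbrakk>
    \<Longrightarrow> trek C D X Z (r + bridge_length Y Z \<gamma>)"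

definition propinquity ::
    "real \<Rightarrow> real \<Rightarrow> 'a seminormed_cstar \<Rightarrow> 'b seminormed_cstar \<Rightarrow> ennreal" where
  "propinquity C D X Y = Inf
     ({bridge_length X Y \<gamma> | \<gamma>. is_bridge (fst X) (fst Y) \<gamma>} \<union>
      {r + bridge_length Z Y \<gamma> | r Z \<gamma>. trek C D X Z r \<and> is_bridge (fst Z) (fst Y) \<gamma>})"

section \<open>Minkowski functionals\<close>

definition minkowski :: "'a cstar \<Rightarrow> 'a set \<Rightarrow> 'a \<Rightarrow> ennreal" where
  "minkowski A K a =
     Inf {ennreal r | r. 0 < r \<and> complex_of_real (1 / r) \<odot>\<^bsub>A\<^esub> a \<in> K}"

end

theory Submission
  imports Defs
begin

text \<open>
  The inclusion of \<open>A\<^sub>n\<close> into \<open>A\<close>, with the unit as pivot, is a bridge of height 0, because states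
  extend from unital subalgebras; hence the propinquity is bounded by its reach. The reach tends
  to 0 by an Arzela-Ascoli argument. The state space is weak* compact and metrized by \<open>L\<close>, so it
  has finite nets, and a self-adjoint element is controlled in norm by its values on states.
  Therefore the ball \<open>L \<le> 1\<close> is totally bounded in norm modulo scalars, and so is its intersection
  with the union of the \<open>A\<^sub>n\<close>, which is dense in the unit ball of the new seminorm: a finite net of
  this intersection lies in a single \<open>A\<^sub>n\<close>. The same nets show that every seminorm dominating \<open>L\<close>
  on a subalgebra metrizes the weak* topology of its states.

  States are obtained from the Hahn-Banach theorem once elements \<open>x\<^sup>* x\<close> are known to be positive
  in the sense that \<open>\<parallel>t - x\<^sup>* x\<parallel> \<le> t\<close> for some \<open>t\<close>. This notion of positivity avoids spectra.
\<close>

section \<open>Positivity in a C*-algebra on a type\<close>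

text \<open>The given algebra is a record with a carrier, whereas limits and linear functionals are
  at hand on types. The bounded product of all C*-algebras over one carrier type bridges the gap: it
  is an instance of the class below, every algebra is a coordinate of it and embeds isometrically,
  and square roots and Hahn-Banach functionals are found there and read off. As the class has real
  scalars only, \<open>imag\<close>, a central skew-adjoint square root of -1, stands in for the
  imaginary unit.

  Sharp constants are never sought: a state that norms an element up to the factor 3 is enough for
  total boundedness.

  The two seminorms are linked by lower semicontinuity of \<open>L\<close>. It gives
  \<open>L \<le> Lbar\<close> on the self-adjoint part, with equality on the core, so the new unit
  ball lies inside the old one.

  A bridge must have its algebra over the type \<open>univ\<close>. The given algebra is copied
  there along an injection, which exists because the finite dimensional subalgebras make it
  separable.\<close>

class cstar_algebra = real_normed_algebra_1 + banach +
  fixes star :: "'a \<Rightarrow> 'a"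
    and imag :: 'a
  assumes star_star [simp]: "star (star x) = x"
    and star_add: "star (x + y) = star x + star y"
    and star_scaleR: "star (r *\<^sub>R x) = r *\<^sub>R star x"
    and star_mult: "star (x * y) = star y * star x"
    and star_imag: "star imag = - imag"
    and imag_squared: "imag * imag = - 1"
    and imag_commute: "imag * x = x * imag"
    and cstar_norm: "norm (star x * x) = (norm x)\<^sup>2"

section \<open>Elementary identities of the involution\<close>

lemma star_minus: "star (- x) = - star x"
  using star_scaleR[of "-1" x] by simp

lemma star_diff: "star (x - y) = star x - star y"
  using star_add[of x "- y"] star_minus[of y] by simp

lemma star_zero [simp]: "star 0 = 0"
  using star_scaleR[of 0 0] by simp

lemma star_one [simp]: "star 1 = 1"
  by (metis star_mult star_star mult_1_left mult_1_right)

lemma star_of_real [simp]: "star (of_real r) = of_real r"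
  by (simp add: of_real_def star_scaleR)

lemma norm_star [simp]: "norm (star x) = norm x"
proof -
  have le: "norm y \<le> norm (star y)" for y
  proof (cases "norm y = 0")
    case False
    have "(norm y)\<^sup>2 \<le> norm (star y) * norm y"
      by (metis cstar_norm norm_mult_ineq)
    with False show ?thesis
      by (simp add: power2_eq_square)
  qed simp
  show ?thesis
    using le[of x] le[of "star x"] by simp
qed

lemma bounded_linear_star: "bounded_linear star"
  by (rule bounded_linear_intro[where K = 1]) (simp_all add: star_add star_scaleR)

lemma norm_square_sa:
  assumes "star a = a"
  shows "norm (a * a) = (norm a)\<^sup>2"
  using cstar_norm[of a] assms by simp

lemma imag_mult_square: "imag * x * (imag * x) = - (x * x)"
proof -
  have "imag * x * (imag * x) = (imag * imag) * (x * x)"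
    by (metis imag_commute mult.assoc)
  then show ?thesis
    by (simp add: imag_squared)
qed

text \<open>With \<open>z = h + imag * k\<close>, commutation cancels the cross terms of
  \<open>star z * z\<close> and leaves the sum of squares, while \<open>h\<close> is the real part
  of \<open>z\<close>, so that \<open>norm h \<le> norm z\<close>. This replaces monotonicity of the
  norm on positive elements.\<close>

lemma norm_le_of_commuting_squares:
  assumes "star h = h" "star k = k" "h * k = k * h"
  shows "(norm h)\<^sup>2 \<le> norm (h * h + k * k)"
proof -
  define z where "z = h + imag * k"
  have sz: "star z = h - imag * k"
    by (simp add: z_def star_add star_mult star_imag assms imag_commute)
  note imag_mult_square[of k]
  moreover have "h * (imag * k) = imag * (k * h)"
    by (metis assms(3) imag_commute mult.assoc)
  ultimately have "star z * z = h * h + k * k"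
    unfolding sz unfolding z_def by (simp add: algebra_simps)
  then have n: "norm (h * h + k * k) = (norm z)\<^sup>2"
    by (metis cstar_norm)
  have "2 *\<^sub>R h = z + star z"
    unfolding sz unfolding z_def by (simp add: scaleR_2)
  then have "2 * norm h \<le> norm z + norm (star z)"
    by (metis abs_numeral norm_scaleR norm_triangle_ineq)
  then have "norm h \<le> norm z"
    by simp
  then show ?thesis
    unfolding n by (simp add: power_mono)
qed

text \<open>A fixed point of \<open>y = (b + y * y) / 2\<close> satisfies
  \<open>(1 - y) * (1 - y) = 1 - b\<close>, and the iteration from 0 produces the series of
  \<open>1 - sqrt (1 - b)\<close>. All iterates are polynomials in \<open>b\<close>, hence
  self-adjoint and commuting with whatever commutes with \<open>b\<close>; both properties survive
  the limit.\<close>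

lemma sqrt_one_minus:
  assumes sb: "star b = b" and nb: "norm b \<le> 1"
  obtains y where "star y = y" "norm y \<le> 1" "(1 - y) * (1 - y) = 1 - b"
    "\<And>x. x * b = b * x \<Longrightarrow> x * y = y * x"
proof -
  define y where "y = rec_nat 0 (\<lambda>_ y. (1/2) *\<^sub>R (b + y * y))"
  define s where "s = rec_nat 0 (\<lambda>_ s. (1 + s * s) / 2 :: real)"
  have y0: "y 0 = 0" and yS: "y (Suc n) = (1/2) *\<^sub>R (b + y n * y n)" for n
    by (simp_all add: y_def)
  have s0: "s 0 = 0" and sS: "s (Suc n) = (1 + s n * s n) / 2" for n
    by (simp_all add: s_def)
  have s01: "0 \<le> s n \<and> s n \<le> 1" for n
    by (induction n) (auto simp: s0 sS mult_le_one)
  have ys: "norm (y n) \<le> s n" for n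
  proof (induction n)
    case (Suc n)
    have "norm (y (Suc n)) \<le> (norm b + norm (y n * y n)) / 2"
      unfolding yS using norm_triangle_ineq[of b "y n * y n"] by simp
    also have "norm (y n * y n) \<le> s n * s n"
      by (rule order_trans[OF norm_mult_ineq]) (intro mult_mono Suc s01 norm_ge_zero; simp add: s01)
    finally show ?case
      using nb by (simp add: sS)
  qed (simp add: y0 s0)
  \<comment> \<open>The scalar sequence for \<open>b = 1\<close> majorizes the increments.\<close>
  have step: "norm (y (Suc n) - y n) \<le> s (Suc n) - s n" for n
  proof (induction n)
    case 0
    then show ?case using nb by (simp add: y0 yS s0 sS)
  next
    case (Suc n)
    let ?d = "y (Suc n) - y n"
    \<comment> \<open>The splitting u u - v v = u (u - v) + (u - v) v does not require the iterates
      to commute.\<close>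
    have "y (Suc (Suc n)) - y (Suc n) = (1/2) *\<^sub>R (y (Suc n) * ?d + ?d * y n)"
    proof -
      have "y (Suc (Suc n)) - y (Suc n)
          = (1/2) *\<^sub>R (b + y (Suc n) * y (Suc n)) - (1/2) *\<^sub>R (b + y n * y n)"
        by (simp only: yS)
      also have "\<dots> = (1/2) *\<^sub>R (y (Suc n) * y (Suc n) - y n * y n)"
        by (simp flip: scaleR_right_diff_distrib)
      also have "y (Suc n) * y (Suc n) - y n * y n = y (Suc n) * ?d + ?d * y n"
        by (simp add: algebra_simps)
      finally show ?thesis .
    qed
    then have "norm (y (Suc (Suc n)) - y (Suc n)) \<le> (norm (y (Suc n) * ?d) + norm (?d * y n)) / 2"
      using norm_triangle_ineq[of "y (Suc n) * ?d" "?d * y n"] by simp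
    also have "\<dots> \<le> (s (Suc n) * (s (Suc n) - s n) + (s (Suc n) - s n) * s n) / 2"
      by (intro divide_right_mono add_mono order_trans[OF norm_mult_ineq] mult_mono ys Suc)
        (use s01 order_trans[OF norm_ge_zero Suc] in auto)
    also have "\<dots> = s (Suc (Suc n)) - s (Suc n)"
    proof -
      have "s (Suc (Suc n)) - s (Suc n)
          = (1 + s (Suc n) * s (Suc n)) / 2 - (1 + s n * s n) / 2"
        by (simp only: sS)
      then show ?thesis
        by (simp add: field_simps)
    qed
    finally show ?case .
  qed
  have inc: "norm (y (n + k) - y n) \<le> s (n + k) - s n" for n k
  proof (induction k)
    case (Suc k)
    have "norm (y (n + Suc k) - y n) \<le> norm (y (Suc (n + k)) - y (n + k)) + norm (y (n + k) - y n)"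
      using norm_triangle_ineq[of "y (Suc (n + k)) - y (n + k)" "y (n + k) - y n"] by simp
    also have "\<dots> \<le> s (n + Suc k) - s n"
      using step[of "n + k"] Suc by simp
    finally show ?case .
  qed simp
  have "incseq s"
    by (rule incseq_SucI) (metis diff_ge_0_iff_ge norm_ge_zero order_trans step)
  then have "convergent s"
    by (rule incseq_convergent[where B = 1]) (use s01 in \<open>auto simp: convergent_def\<close>)
  then have "Cauchy s"
    by (rule convergent_Cauchy)
  have "Cauchy y"
  proof (rule CauchyI')
    fix e :: real assume "0 < e"
    with \<open>Cauchy s\<close> obtain M where M: "\<And>m n. m \<ge> M \<Longrightarrow> n \<ge> M \<Longrightarrow> norm (s m - s n) < e"
      by (meson CauchyD)
    have "dist (y m) (y n) < e" if "m \<ge> M" "n > m" for m n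
      using inc[of m "n - m"] M[of n m] that by (simp add: dist_norm norm_minus_commute)
    then show "\<exists>M. \<forall>m\<ge>M. \<forall>n>m. dist (y m) (y n) < e"
      by blast
  qed
  then obtain Y where Y: "y \<longlonglongrightarrow> Y"
    using Cauchy_convergent convergent_def by blast
  have "(\<lambda>n. y (Suc n)) \<longlonglongrightarrow> (1/2) *\<^sub>R (b + Y * Y)"
    unfolding yS by (intro tendsto_intros Y)
  then have YY: "Y = (1/2) *\<^sub>R (b + Y * Y)"
    using LIMSEQ_unique LIMSEQ_Suc[OF Y] by blast
  have "2 *\<^sub>R Y = b + Y * Y"
    by (subst YY) simp
  then have "(1 - Y) * (1 - Y) = 1 - b"
    by (simp add: algebra_simps scaleR_2)
  moreover have "norm Y \<le> 1"
    by (rule LIMSEQ_le_const2[OF tendsto_norm[OF Y]]) (use ys s01 order_trans in blast)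
  moreover have "star Y = Y"
  proof -
    have "star (y n) = y n" for n
      by (induction n) (simp_all add: y0 yS star_scaleR star_add star_mult sb)
    then have "y \<longlonglongrightarrow> star Y"
      using bounded_linear.tendsto[OF bounded_linear_star Y] by simp
    then show ?thesis
      using LIMSEQ_unique Y by blast
  qed
  moreover have "x * Y = Y * x" if x: "x * b = b * x" for x
  proof -
    have "x * y n = y n * x" for n
    proof (induction n)
      case (Suc n)
      have "x * (y n * y n) = y n * y n * x"
        by (metis Suc mult.assoc)
      then show ?case
        by (simp add: yS x distrib_left distrib_right)
    qed (simp add: y0)
    moreover have "(\<lambda>n. x * y n) \<longlonglongrightarrow> x * Y" "(\<lambda>n. y n * x) \<longlonglongrightarrow> Y * x"
      by (intro tendsto_intros Y)+
    ultimately show ?thesis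
      using LIMSEQ_unique by simp
  qed
  ultimately show thesis
    using that by blast
qed

text \<open>For a self-adjoint element the norm condition says that the spectrum lies in [0, 2 t].
  Leaving \<open>t\<close> existential makes these elements a convex cone by the triangle inequality
  alone.\<close>

definition pos :: "'a::cstar_algebra \<Rightarrow> bool" where
  "pos a \<longleftrightarrow> star a = a \<and> (\<exists>t. norm (of_real t - a) \<le> t)"

text \<open>The parameter may be enlarged; this serves to make it strictly positive before dividing
  by it.\<close>

lemma norm_shift_mono:
  fixes a :: "'a::real_normed_algebra_1"
  assumes "norm (of_real t - a) \<le> t" "t \<le> t'"
  shows "norm (of_real t' - a) \<le> t'"
proof -
  have "of_real t' - a = of_real (t' - t) + (of_real t - a)"
    by simp
  then have "norm (of_real t' - a) \<le> norm (of_real (t' - t) :: 'a) + norm (of_real t - a)"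
    by (metis norm_triangle_ineq)
  with assms show ?thesis
    by (simp del: of_real_diff)
qed

lemma pos_add:
  assumes "pos a" "pos b"
  shows "pos (a + b)"
proof -
  obtain s t where st: "norm (of_real s - a) \<le> s" "norm (of_real t - b) \<le> t"
    using assms by (auto simp: pos_def)
  have "norm (of_real (s + t) - (a + b)) \<le> s + t"
    using norm_triangle_ineq[of "of_real s - a" "of_real t - b"] st by (simp add: algebra_simps)
  then show ?thesis
    using assms unfolding pos_def star_add by metis
qed

lemma pos_scaleR:
  assumes "pos a" "0 \<le> r"
  shows "pos (r *\<^sub>R a)"
proof -
  obtain t where t: "norm (of_real t - a) \<le> t"
    using assms by (auto simp: pos_def)
  have "of_real (r * t) - r *\<^sub>R a = r *\<^sub>R (of_real t - a)"
    by (simp add: of_real_def scaleR_diff_right)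
  then have "norm (of_real (r * t) - r *\<^sub>R a) \<le> r * t"
    using t assms(2) by (simp add: mult_left_mono)
  then show ?thesis
    using assms unfolding pos_def star_scaleR by metis
qed

text \<open>Rescaling turns \<open>b = 1 - a / t\<close> into an element of norm at most 1, so
  \<open>a = t (1 - b)\<close> has the root \<open>sqrt t (1 - y)\<close>. The bound
  \<open>norm y \<le> 1\<close> says that this root is positive with parameter
  \<open>sqrt t\<close>.\<close>

lemma pos_sqrt:
  assumes "pos a"
  obtains k where "pos k" "k * k = a" "\<And>x. x * a = a * x \<Longrightarrow> x * k = k * x"
proof -
  have sa: "star a = a"
    using assms by (simp add: pos_def)
  obtain t0 where "norm (of_real t0 - a) \<le> t0"
    using assms by (auto simp: pos_def)
  then obtain t where t: "norm (of_real t - a) \<le> t" "0 < t"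
    using norm_shift_mono[of t0 a "max t0 1"] by (auto simp: less_max_iff_disj)
  define b where "b = 1 - (1 / t) *\<^sub>R a"
  have b: "b = (1 / t) *\<^sub>R (of_real t - a)"
    using t by (simp add: b_def of_real_def scaleR_diff_right)
  have "star b = b"
    by (simp add: b_def star_diff star_scaleR sa)
  moreover have "norm b \<le> 1"
    using t by (simp add: b divide_simps)
  ultimately obtain y where y: "star y = y" "norm y \<le> 1" "(1 - y) * (1 - y) = 1 - b"
    "\<And>x. x * b = b * x \<Longrightarrow> x * y = y * x"
    using sqrt_one_minus by blast
  define k where "k = sqrt t *\<^sub>R (1 - y)"
  have "of_real (sqrt t) - k = sqrt t *\<^sub>R y"
    by (simp add: k_def of_real_def scaleR_diff_right)
  then have "norm (of_real (sqrt t) - k) \<le> sqrt t"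
    using y t by (simp add: mult_left_le)
  then have "pos k"
    using y by (auto simp: pos_def k_def star_scaleR star_diff)
  moreover have "k * k = a"
    using t y(3) by (simp add: k_def b_def)
  moreover have "x * k = k * x" if "x * a = a * x" for x
  proof -
    have "x * y = y * x"
      by (rule y(4)) (simp add: b_def that algebra_simps)
    then show ?thesis
      by (simp add: k_def algebra_simps)
  qed
  ultimately show thesis
    using that by blast
qed

text \<open>After normalization to \<open>g\<close>, the elements \<open>1 - y\<close> and
  \<open>g\<close> commute and their squares add up to 1. Hence \<open>norm (1 - y) \<le> 1\<close>,
  and squaring bounds the norm of \<open>1 - g * g\<close> by 1, which is positivity with parameter
  1.\<close>

lemma pos_square:
  assumes "star h = h"
  shows "pos (h * h)"
proof (cases "h = 0")
  case True
  then show ?thesis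
    by (auto simp: pos_def intro: exI[of _ 0])
next
  case False
  define g where "g = (1 / norm h) *\<^sub>R h"
  have g: "star g = g" "norm g = 1"
    using False assms by (simp_all add: g_def star_scaleR)
  have "star (g * g) = g * g" "norm (g * g) \<le> 1"
    using g norm_mult_ineq[of g g] by (simp_all add: star_mult)
  then obtain y where y: "star y = y" "(1 - y) * (1 - y) = 1 - g * g"
    "\<And>x. x * (g * g) = (g * g) * x \<Longrightarrow> x * y = y * x"
    using sqrt_one_minus by blast
  have "g * y = y * g"
    by (rule y(3)) (simp add: mult.assoc)
  then have "(norm (1 - y))\<^sup>2 \<le> norm ((1 - y) * (1 - y) + g * g)"
    using g y by (intro norm_le_of_commuting_squares) (simp_all add: star_diff algebra_simps)
  then have "(norm (1 - y))\<^sup>2 \<le> 1"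
    by (simp add: y(2))
  then have "norm (1 - g * g) \<le> 1"
    using norm_mult_ineq[of "1 - y" "1 - y"] y(2) by (simp add: power2_eq_square)
  then have "pos (g * g)"
    using g by (auto simp: pos_def star_mult intro: exI[of _ 1])
  moreover have "h * h = (norm h)\<^sup>2 *\<^sub>R (g * g)"
    using False by (simp add: g_def power2_eq_square)
  ultimately show ?thesis
    by (simp add: pos_scaleR)
qed

text \<open>The roots \<open>k\<close> and \<open>e\<close> of the two positive elements commute and
  their squares add up to \<open>2 * t\<close>. So \<open>of_real t - a\<close> has norm at most
  twice \<open>\<bar>t\<bar>\<close>, and the triangle inequality adds the third multiple. The sharp
  factor would be 1.\<close>

lemma norm_le_of_order_bound:
  assumes "pos (of_real t - a)" "pos (of_real t + a)"
  shows "norm a \<le> 3 * \<bar>t\<bar>"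
proof -
  obtain k where k: "pos k" "k * k = of_real t - a"
    "\<And>x. x * (of_real t - a) = (of_real t - a) * x \<Longrightarrow> x * k = k * x"
    using pos_sqrt assms by blast
  obtain e where e: "pos e" "e * e = of_real t + a"
    "\<And>x. x * (of_real t + a) = (of_real t + a) * x \<Longrightarrow> x * e = e * x"
    using pos_sqrt assms by blast
  have ta: "of_real t * a = a * of_real t"
    by (simp add: of_real_def)
  have "(of_real t - a) * e = e * (of_real t - a)"
    by (rule e(3)) (simp add: algebra_simps ta)
  then have "e * k = k * e"
    by (intro k(3)) simp
  then have "(norm k)\<^sup>2 \<le> norm (k * k + e * e)"
    using k(1) e(1) by (intro norm_le_of_commuting_squares) (auto simp: pos_def)
  also have "k * k + e * e = of_real (2 * t)"
    by (simp add: k e flip: of_real_add)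
  finally have "(norm k)\<^sup>2 \<le> 2 * \<bar>t\<bar>"
    by (simp only: norm_of_real abs_mult abs_numeral)
  then have "norm (of_real t - a) \<le> 2 * \<bar>t\<bar>"
    using norm_mult_ineq[of k k] k(2) by (simp add: power2_eq_square)
  then show ?thesis
    using norm_triangle_ineq4[of "of_real t" "of_real t - a"] by simp
qed

text \<open>Repeated squaring with the C*-identity. Exact multiplicativity along the exponents
  \<open>2 ^ k\<close> takes the place of the spectral radius formula.\<close>

lemma norm_power_two_power_sa:
  assumes "star a = a"
  shows "norm (a ^ 2 ^ k) = norm a ^ 2 ^ k"
proof (induction k)
  case (Suc k)
  have "star (a ^ n) = a ^ n" for n
    by (induction n) (simp_all add: star_mult assms power_commutes)
  then have "norm (a ^ 2 ^ k * a ^ 2 ^ k) = (norm (a ^ 2 ^ k))\<^sup>2"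
    by (rule norm_square_sa)
  moreover have "a ^ 2 ^ Suc k = a ^ 2 ^ k * a ^ 2 ^ k"
    by (simp add: mult_2 flip: power_add)
  ultimately show ?case
    by (simp add: Suc mult.commute flip: power_mult)
qed simp

text \<open>Powers of \<open>t + y y\<^sup>*\<close> and \<open>t + y\<^sup>* y\<close> differ by a factor growing only linearly in the
  exponent, so both elements have the same spectral radius up to \<open>t\<close>.\<close>

lemma pos_minus_swap:
  assumes "pos (- (star y * y))"
  shows "pos (- (y * star y))"
proof -
  obtain t0 where "norm (of_real t0 + star y * y) \<le> t0"
    using assms by (auto simp: pos_def)
  then obtain t where t: "norm (of_real t + star y * y) \<le> t" "0 < t"
    using norm_shift_mono[of t0 "- (star y * y)" "max t0 1"] by (auto simp: less_max_iff_disj)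
  let ?w = "of_real t + y * star y"
  \<comment> \<open>The term \<open>y * g * star y\<close> collects everything but the scalar part
    of the power. One more factor \<open>?w\<close> turns \<open>g\<close> into
    \<open>t ^ n + g * (t + star y * y)\<close>, whose last factor has norm at most
    \<open>t\<close>; hence the linear growth.\<close>
  have ex: "\<exists>g. ?w ^ n = of_real (t ^ n) + y * g * star y \<and> t * norm g \<le> n * t ^ n" for n
  proof (induction n)
    case 0
    then show ?case by (intro exI[of _ 0]) simp
  next
    case (Suc n)
    then obtain g where g: "?w ^ n = of_real (t ^ n) + y * g * star y" "t * norm g \<le> n * t ^ n"
      by blast
    let ?g = "of_real (t ^ n) + g * (of_real t + star y * y)"
    have "?w ^ Suc n = ?w ^ n * ?w"
      by (simp only: power_Suc2)
    also have "\<dots> = of_real (t ^ Suc n) + y * ?g * star y"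
      unfolding g(1) by (simp add: of_real_def algebra_simps)
    finally have "?w ^ Suc n = of_real (t ^ Suc n) + y * ?g * star y" .
    moreover have "norm ?g \<le> t ^ n + norm g * t"
    proof -
      have "norm ?g \<le> norm (of_real (t ^ n) :: 'a) + norm (g * (of_real t + star y * y))"
        by (rule norm_triangle_ineq)
      also have "norm (g * (of_real t + star y * y)) \<le> norm g * t"
        by (rule order_trans[OF norm_mult_ineq]) (simp add: t(1) mult_left_mono)
      finally show ?thesis
        using t by (simp del: of_real_power)
    qed
    then have "t * norm ?g \<le> t * (t ^ n + n * t ^ n)"
      using t g(2) by (intro mult_left_mono) (auto simp: mult.commute)
    ultimately show ?case
      by (intro exI[of _ ?g]) (simp add: algebra_simps)
  qed
  define c where "c = (norm y)\<^sup>2 / t"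
  have bound: "norm (?w ^ n) \<le> t ^ n * (1 + c * n)" for n
  proof -
    obtain g where g: "?w ^ n = of_real (t ^ n) + y * g * star y" "t * norm g \<le> n * t ^ n"
      using ex by blast
    have "norm (y * g * star y) \<le> norm y * norm g * norm y"
      using norm_mult_ineq[of "y * g" "star y"] norm_mult_ineq[of y g]
        mult_right_mono[of _ _ "norm y"] norm_star[of y] by (metis norm_ge_zero order_trans)
    also have "\<dots> = c * (t * norm g)"
      using t by (simp add: c_def power2_eq_square)
    also have "\<dots> \<le> c * (n * t ^ n)"
      using t by (intro mult_left_mono g) (simp add: c_def)
    finally have "norm (y * g * star y) \<le> c * (n * t ^ n)" .
    moreover have "norm (of_real (t ^ n) :: 'a) = t ^ n"
      unfolding norm_of_real using t by simp
    ultimately show ?thesis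
      unfolding g(1) using norm_triangle_ineq[of "of_real (t ^ n)" "y * g * star y"]
      by (simp add: algebra_simps)
  qed
  have sw: "star ?w = ?w"
    by (simp add: star_add star_mult)
  \<comment> \<open>Otherwise the ratio \<open>r = norm ?w / t\<close> exceeds 1, and along the
    exponents \<open>2 ^ k\<close> its powers would be bounded by a linear function of the
    exponent.\<close>
  have "norm ?w \<le> t"
  proof (rule ccontr)
    assume "\<not> norm ?w \<le> t"
    define r where "r = norm ?w / t"
    have r: "r > 1"
      using t \<open>\<not> norm ?w \<le> t\<close> by (simp add: r_def)
    have "(\<lambda>n. inverse (r ^ n) + c * (real n / r ^ n)) \<longlonglongrightarrow> 0 + c * 0"
      using r by (intro tendsto_intros LIMSEQ_inverse_realpow_zero lim_n_over_pown) auto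
    then have lim: "(\<lambda>n. (1 + c * real n) / r ^ n) \<longlonglongrightarrow> 0"
      by (simp add: add_divide_distrib distrib_right divide_inverse mult.assoc)
    have "strict_mono (\<lambda>k. 2 ^ k :: nat)"
      by (simp add: strict_mono_def)
    from LIMSEQ_subseq_LIMSEQ[OF lim this]
    have "(\<lambda>k. (1 + c * real (2 ^ k)) / r ^ 2 ^ k) \<longlonglongrightarrow> 0"
      by (simp add: o_def)
    moreover have "1 \<le> (1 + c * real (2 ^ k)) / r ^ 2 ^ k" for k
    proof -
      have "norm ?w ^ 2 ^ k \<le> t ^ 2 ^ k * (1 + c * real (2 ^ k))"
        using bound[of "2 ^ k"] by (simp only: norm_power_two_power_sa[OF sw])
      then have "r ^ 2 ^ k \<le> 1 + c * real (2 ^ k)"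
        using t by (simp add: r_def power_divide divide_simps mult.commute)
      then show ?thesis
        using r by (simp add: divide_simps)
    qed
    ultimately have "(1::real) \<le> 0"
      by (intro LIMSEQ_le_const) blast+
    then show False by simp
  qed
  then show ?thesis
    using sw by (auto simp: pos_def star_minus star_mult intro!: exI[of _ t])
qed

text \<open>For \<open>y = h + imag * k\<close> with self-adjoint \<open>h\<close> and
  \<open>k\<close>, the cross terms cancel between the two orders of multiplication, and twice the
  sum of the squares of \<open>h\<close> and \<open>k\<close> remains.\<close>

lemma pos_star_mult_plus_mult_star: "pos (star y * y + y * star y)"
proof -
  define h where "h = (1/2) *\<^sub>R (y + star y)"
  define k where "k = (1/2) *\<^sub>R (imag * (star y - y))"
  have "star h = h"
    by (simp add: h_def star_scaleR star_add add.commute)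
  have "star k = k"
    by (simp add: k_def star_scaleR star_diff star_mult star_imag algebra_simps imag_commute[of "star y"] imag_commute[of y])
  have "2 *\<^sub>R (h * h + k * k) = (1/2) *\<^sub>R ((y + star y) * (y + star y) - (star y - y) * (star y - y))"
    unfolding h_def k_def mult_scaleR_left mult_scaleR_right imag_mult_square
    by (simp add: scaleR_diff_right)
  also have "(y + star y) * (y + star y) - (star y - y) * (star y - y)
      = 2 *\<^sub>R (star y * y + y * star y)"
    by (simp add: algebra_simps scaleR_2)
  finally have "star y * y + y * star y = 2 *\<^sub>R (h * h + k * k)"
    by simp
  moreover have "pos (2 *\<^sub>R (h * h + k * k))"
    by (intro pos_scaleR pos_add pos_square) (simp_all add: \<open>star h = h\<close> \<open>star k = k\<close>)
  ultimately show ?thesis by simp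
qed

lemma sa_nilpotent_zero:
  assumes "star a = a" "a * a = 0"
  shows "a = 0"
  using norm_square_sa[OF assms(1)] assms(2) by simp

text \<open>With \<open>c = \<bar>a\<bar>\<close> and \<open>n = c - a\<close> twice the negative part of \<open>a = x\<^sup>* x\<close>, the element
  \<open>y = x n\<close> satisfies \<open>y\<^sup>* y = - n\<^sup>3 / 2\<close>, which is both positive and negative.\<close>

theorem pos_star_mult: "pos (star x * x)"
proof -
  define a where "a = star x * x"
  have sa: "star a = a"
    by (simp add: a_def star_mult)
  obtain c where c: "pos c" "c * c = a * a" "\<And>z. z * (a * a) = a * a * z \<Longrightarrow> z * c = c * z"
    using pos_sqrt[OF pos_square[OF sa]] by blast
  have ac: "a * c = c * a"
    by (rule c(3)) (simp add: mult.assoc)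
  obtain k where k: "pos k" "k * k = c" "\<And>z. z * c = c * z \<Longrightarrow> z * k = k * z"
    by (rule pos_sqrt[OF c(1)]) (rule that)
  have sc: "star c = c" and sk: "star k = k"
    using c(1) k(1) by (auto simp: pos_def)
  define n where "n = c - a"
  have sn: "star n = n"
    by (simp add: n_def star_diff sc sa)
  have nk: "n * k = k * n"
    by (rule k(3)) (simp add: n_def ac algebra_simps)
  \<comment> \<open>Because \<open>c * c = a * a\<close> and \<open>a\<close> commutes with
    \<open>c\<close>, on multiples of \<open>n\<close> the element \<open>a\<close> acts as
    \<open>- c\<close>.\<close>
  have nn: "n * n = 2 *\<^sub>R (n * c)" "n * a = - (n * c)"
    using c(2) by (simp_all add: n_def algebra_simps ac scaleR_2)
  define y where "y = x * n"
  have nkk: "n * c * n = (k * n) * (k * n)"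
    by (metis k(2) mult.assoc nk)
  have yy: "star y * y = - ((k * n) * (k * n))"
  proof -
    have "star y * y = n * a * n"
      by (simp add: y_def a_def star_mult sn mult.assoc)
    also have "\<dots> = - (n * c * n)"
      by (simp add: nn)
    finally show ?thesis
      by (simp add: nkk)
  qed
  have skn: "star (k * n) = k * n"
    by (simp add: star_mult sk sn nk)
  have p1: "pos (- (star y * y))"
    using pos_square[OF skn] by (simp add: yy)
  \<comment> \<open>The swap makes \<open>- (y * star y)\<close> positive; added to the symmetric
    sum it leaves \<open>star y * y\<close>. Together with \<open>p1\<close>, the order bound at 0
    then forces this element to vanish.\<close>
  have "pos (star y * y + y * star y + - (y * star y))"
    by (intro pos_add pos_star_mult_plus_mult_star pos_minus_swap p1)
  then have "pos (star y * y)"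
    by simp
  with p1 have "norm (star y * y) \<le> 3 * \<bar>0\<bar>"
    by (intro norm_le_of_order_bound) simp_all
  then have "(k * n) * (k * n) = 0"
    by (simp add: yy)
  then have "k * n = 0"
    using sa_nilpotent_zero skn by blast
  \<comment> \<open>Now \<open>c = k * k\<close> annihilates \<open>n\<close>, and
    \<open>n * n\<close> is a multiple of \<open>n * c\<close>. So \<open>n\<close> vanishes and
    \<open>a\<close> equals the positive element \<open>c\<close>.\<close>
  then have "n * n = 0"
    by (metis k(2) mult.assoc mult_zero_left mult_zero_right nk nn(1) scaleR_zero_right)
  then have "n = 0"
    using sa_nilpotent_zero sn by blast
  then show ?thesis
    using c(1) by (simp add: n_def a_def)
qed

section \<open>C*-algebras with carrier\<close>

lemma complex_ring_simps [simp]: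
  "carrier complex_ring = UNIV" "x \<otimes>\<^bsub>complex_ring\<^esub> y = x * y" "\<one>\<^bsub>complex_ring\<^esub> = 1"
  "\<zero>\<^bsub>complex_ring\<^esub> = 0" "x \<oplus>\<^bsub>complex_ring\<^esub> y = x + y"
  by (simp_all add: complex_ring_def)

lemma cring_complex_ring: "cring complex_ring"
proof -
  have "\<exists>y. y + x = 0 \<and> x + y = 0" for x :: complex
    by (rule exI[of _ "- x"]) simp
  then show ?thesis
    by (unfold_locales) (auto simp: Units_def algebra_simps)
qed

context unital_cstar_algebra
begin

(* The ring facts inherited from the locale under these names are about the scalars. *)

lemma ring_A: "ring A"
  using unital_cstar_algebra_axioms by (rule unital_cstar_algebra.axioms)

lemma abelian_group_A: "abelian_group A"
  using ring_A by (rule ring.is_abelian_group)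

lemmas a_assoc = ring.ring_simprules(7)[OF ring_A]
  and a_comm = ring.ring_simprules(10)[OF ring_A]
  and m_assoc = ring.ring_simprules(11)[OF ring_A]
  and l_distr = ring.ring_simprules(13)[OF ring_A]
  and minus_eq = ring.ring_simprules(14)[OF ring_A]
  and r_neg = ring.ring_simprules(16)[OF ring_A]
  and l_neg = ring.ring_simprules(9)[OF ring_A]
  and r_neg1 = ring.ring_simprules(18)[OF ring_A]
  and a_lcomm = ring.ring_simprules(22)[OF ring_A]
  and r_distr = ring.ring_simprules(23)[OF ring_A]
  and a_closed = ring.ring_simprules(1)[OF ring_A]
  and zero_closed = ring.ring_simprules(2)[OF ring_A]
  and a_inv_closed = ring.ring_simprules(3)[OF ring_A]
  and minus_closed = ring.ring_simprules(4)[OF ring_A]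
  and m_closed = ring.ring_simprules(5)[OF ring_A]
  and one_closed = ring.ring_simprules(6)[OF ring_A]
  and l_zero = ring.ring_simprules(8)[OF ring_A]
  and r_zero = ring.ring_simprules(15)[OF ring_A]
  and l_one = ring.ring_simprules(12)[OF ring_A]
  and r_one = monoid.r_one[OF ring.is_monoid[OF ring_A]]
  and minus_equality = abelian_group.minus_equality[OF abelian_group_A]

lemma smult_in [simp, intro]: "x \<in> carrier A \<Longrightarrow> c \<odot> x \<in> carrier A"
  using smult_closed by simp

lemma smult_add_left: "x \<in> carrier A \<Longrightarrow> (c + d) \<odot> x = c \<odot> x \<oplus> d \<odot> x"
  using smult_l_distr[of c d x] by simp

lemma smult_add_right: "x \<in> carrier A \<Longrightarrow> y \<in> carrier A \<Longrightarrow> c \<odot> (x \<oplus> y) = c \<odot> x \<oplus> c \<odot> y"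
  using smult_r_distr[of c x y] by simp

lemma smult_smult: "x \<in> carrier A \<Longrightarrow> c \<odot> (d \<odot> x) = (c * d) \<odot> x"
  using smult_assoc1[of c d x] by simp

lemma smult_1 [simp]: "x \<in> carrier A \<Longrightarrow> 1 \<odot> x = x"
  using smult_one[of x] by simp

lemma smult_0 [simp]: "x \<in> carrier A \<Longrightarrow> 0 \<odot> x = \<zero>"
  using smult_l_null[of x] by simp

lemma smult_zero [simp]: "c \<odot> \<zero> = \<zero>"
  using smult_r_null[of c] by simp

lemma minus_eq_smult: "x \<in> carrier A \<Longrightarrow> y \<in> carrier A \<Longrightarrow> x \<ominus> y = x \<oplus> (- 1) \<odot> y"
proof -
  assume *: "x \<in> carrier A" "y \<in> carrier A"
  have "(- 1) \<odot> y \<oplus> y = (- 1 + 1) \<odot> y"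
    using * by (simp only: smult_add_left smult_1)
  also have "\<dots> = \<zero>"
    using * by simp
  finally have "(- 1) \<odot> y = \<ominus> y"
    using * by (intro minus_equality[symmetric]) auto
  then show ?thesis
    using * by (simp add: minus_eq)
qed

lemma adj_closed' [simp, intro]: "x \<in> carrier A \<Longrightarrow> adj A x \<in> carrier A"
  by (rule adj_closed)

lemma adj_zero [simp]: "adj A \<zero> = \<zero>"
  using adj_smult[of \<zero> 0] by simp

lemma adj_one [simp]: "adj A \<one> = \<one>"
  by (metis adj_adj adj_closed adj_mult l_one one_closed r_one)

lemma adj_minus: "x \<in> carrier A \<Longrightarrow> y \<in> carrier A \<Longrightarrow> adj A (x \<ominus> y) = adj A x \<ominus> adj A y"
  by (simp add: minus_eq_smult adj_add adj_smult)

lemma cnorm_zero [simp]: "cnorm A \<zero> = 0"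
  by (simp add: cnorm_eq_zero)

lemma cnorm_one [simp]: "cnorm A \<one> = 1"
proof -
  have "cnorm A \<one> = (cnorm A \<one>)\<^sup>2"
    using cstar_identity[of \<one>] by simp
  moreover have "cnorm A \<one> \<noteq> 0"
    using one_not_zero by (simp add: cnorm_eq_zero)
  ultimately show ?thesis
    by (simp add: power2_eq_square)
qed

lemma cnorm_minus_commute:
  assumes "x \<in> carrier A" "y \<in> carrier A"
  shows "cnorm A (x \<ominus> y) = cnorm A (y \<ominus> x)"
proof -
  have "(- 1) \<odot> (y \<ominus> x) = (- 1) \<odot> y \<oplus> x"
    using assms by (simp add: minus_eq_smult smult_add_right smult_smult)
  also have "\<dots> = x \<ominus> y"
    using assms by (metis a_comm minus_eq_smult smult_in)
  finally have "x \<ominus> y = (- 1) \<odot> (y \<ominus> x)"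
    by simp
  then show ?thesis
    using assms by (simp add: cnorm_smult)
qed

lemma minus_add_cancel:
  assumes "x \<in> carrier A" "y \<in> carrier A" "z \<in> carrier A"
  shows "(x \<ominus> y) \<oplus> (y \<ominus> z) = x \<ominus> z"
  using assms by (simp add: minus_eq a_assoc r_neg1)

lemma minus_add_self: "x \<in> carrier A \<Longrightarrow> y \<in> carrier A \<Longrightarrow> (x \<ominus> y) \<oplus> y = x"
  by (simp add: minus_eq a_assoc l_neg)

lemma minus_eq_zero_iff: "x \<in> carrier A \<Longrightarrow> y \<in> carrier A \<Longrightarrow> x \<ominus> y = \<zero> \<longleftrightarrow> x = y"
  by (metis minus_add_self minus_eq r_neg l_zero)

lemma cnorm_triangle_minus:
  assumes "x \<in> carrier A" "y \<in> carrier A" "z \<in> carrier A"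
  shows "cnorm A (x \<ominus> z) \<le> cnorm A (x \<ominus> y) + cnorm A (y \<ominus> z)"
  using cnorm_triangle[of "x \<ominus> y" "y \<ominus> z"] assms by (simp add: minus_add_cancel)

lemma cnorm_le_add_minus:
  assumes "x \<in> carrier A" "y \<in> carrier A"
  shows "cnorm A x \<le> cnorm A y + cnorm A (x \<ominus> y)"
  using cnorm_triangle[of "x \<ominus> y" y] assms by (simp add: minus_eq a_assoc l_neg)

lemma Metric_space_norm_dist: "Metric_space (carrier A) (norm_dist A)"
proof
  show "0 \<le> norm_dist A x y" for x y
    by (simp add: norm_dist_def cnorm_nonneg)
  show "norm_dist A x y = norm_dist A y x" for x y
    by (simp add: norm_dist_def cnorm_minus_commute)
  show "norm_dist A x y = 0 \<longleftrightarrow> x = y" if "x \<in> carrier A" "y \<in> carrier A" for x y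
    using that by (simp add: norm_dist_def cnorm_eq_zero minus_eq_zero_iff)
  show "norm_dist A x z \<le> norm_dist A x y + norm_dist A y z"
    if "x \<in> carrier A" "y \<in> carrier A" "z \<in> carrier A" for x y z
    using that by (simp add: norm_dist_def cnorm_triangle_minus)
qed

sublocale norm: Metric_space "carrier A" "norm_dist A"
  by (rule Metric_space_norm_dist)

lemma cauchy_limit:
  assumes "\<And>n. x n \<in> carrier A"
    and "\<And>e. 0 < e \<Longrightarrow> \<exists>N. \<forall>m\<ge>N. \<forall>n\<ge>N. cnorm A (x m \<ominus> x n) < e"
  obtains l where "l \<in> carrier A" "(\<lambda>n. cnorm A (x n \<ominus> l)) \<longlonglongrightarrow> 0"
proof -
  have "norm.MCauchy x"
    using assms by (auto simp: norm.MCauchy_def norm_dist_def)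
  with complete obtain l where "limitin norm.mtopology x l sequentially"
    by (auto simp: norm.mcomplete_def)
  then have "l \<in> carrier A" "(\<lambda>n. norm_dist A (x n) l) \<longlonglongrightarrow> 0"
    by (auto simp: norm.limitin_metric_dist_null)
  with that assms show thesis
    by (simp add: norm_dist_def)
qed

end

text \<open>The bounded product of all unital C*-algebras with carrier in a given type is a C*-algebra
  on a whole type, having each of these algebras as a quotient. It serves to transfer theorems
  about type class algebras to algebras with carrier. The additional factor \<open>\<complex>\<close> makes the
  product nontrivial.\<close>

typedef 'a cstar_product =
  "{(f :: 'a cstar \<Rightarrow> 'a, z :: complex). (\<forall>A. \<not> unital_cstar_algebra A \<longrightarrow> f A = undefined) \<and>
     (\<exists>K. \<forall>A. unital_cstar_algebra A \<longrightarrow> f A \<in> carrier A \<and> cnorm A (f A) \<le> K)}"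
proof -
  have "unital_cstar_algebra A \<Longrightarrow> \<zero>\<^bsub>A\<^esub> \<in> carrier A \<and> cnorm A \<zero>\<^bsub>A\<^esub> \<le> 0" for A :: "'a cstar"
    by (metis order_refl ring.ring_simprules(2) unital_cstar_algebra.axioms(1) unital_cstar_algebra.cnorm_zero)
  then show ?thesis
    by (intro exI[of _ "(\<lambda>A. if unital_cstar_algebra A then \<zero>\<^bsub>A\<^esub> else undefined, 0)"]) auto
qed

section \<open>Coordinates and supremum norm of the product\<close>

definition coord :: "'a cstar \<Rightarrow> 'a cstar_product \<Rightarrow> 'a" where
  "coord A X = fst (Rep_cstar_product X) A"

definition scal :: "'a cstar_product \<Rightarrow> complex" where
  "scal X = snd (Rep_cstar_product X)"

definition mk_prod :: "('a cstar \<Rightarrow> 'a) \<Rightarrow> complex \<Rightarrow> 'a cstar_product" where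
  "mk_prod f z = Abs_cstar_product (\<lambda>A. if unital_cstar_algebra A then f A else undefined, z)"

lemma coord_mk_prod:
  assumes "\<And>A. unital_cstar_algebra A \<Longrightarrow> f A \<in> carrier A"
    and "\<And>A. unital_cstar_algebra A \<Longrightarrow> cnorm A (f A) \<le> K"
  shows "unital_cstar_algebra A \<Longrightarrow> coord A (mk_prod f z) = f A" "scal (mk_prod f z) = z"
  using assms unfolding coord_def scal_def mk_prod_def
  by (subst Abs_cstar_product_inverse; force)+

lemma coord_in_carrier: "unital_cstar_algebra A \<Longrightarrow> coord A X \<in> carrier A"
  using Rep_cstar_product[of X] by (auto simp: coord_def)

lemma cstar_product_eqI:
  assumes "\<And>A. unital_cstar_algebra A \<Longrightarrow> coord A X = coord A Y" "scal X = scal Y"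
  shows "X = Y"
proof -
  have "fst (Rep_cstar_product X) A = fst (Rep_cstar_product Y) A" for A
    using assms(1)[of A] Rep_cstar_product[of X] Rep_cstar_product[of Y]
    by (cases "unital_cstar_algebra A") (auto simp: coord_def)
  then have "Rep_cstar_product X = Rep_cstar_product Y"
    using assms(2) by (auto simp: scal_def prod_eq_iff)
  then show ?thesis
    by (simp add: Rep_cstar_product_inject)
qed

text \<open>The scalar coordinate keeps the set nonempty even if no record over the type is a
  C*-algebra, so the supremum is always meaningful.\<close>

definition coord_norms :: "'a cstar_product \<Rightarrow> real set" where
  "coord_norms X = insert (cmod (scal X)) {cnorm A (coord A X) | A. unital_cstar_algebra A}"

definition prod_norm :: "'a cstar_product \<Rightarrow> real" where
  "prod_norm X = Sup (coord_norms X)"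

lemma bdd_above_coord_norms: "bdd_above (coord_norms X)"
proof -
  obtain K where "\<forall>A. unital_cstar_algebra A \<longrightarrow> cnorm A (coord A X) \<le> K"
    using Rep_cstar_product[of X] by (auto simp: coord_def case_prod_unfold)
  then show ?thesis
    unfolding coord_norms_def by (auto intro!: bdd_aboveI[of _ K])
qed

instantiation cstar_product :: (type) "{minus, uminus, zero, one, plus, times, scaleR}"
begin

definition "0 = mk_prod (\<lambda>A. \<zero>\<^bsub>A\<^esub>) 0"
definition "1 = mk_prod (\<lambda>A. \<one>\<^bsub>A\<^esub>) 1"
definition "X + Y = mk_prod (\<lambda>A. coord A X \<oplus>\<^bsub>A\<^esub> coord A Y) (scal X + scal Y)"
definition "X * Y = mk_prod (\<lambda>A. coord A X \<otimes>\<^bsub>A\<^esub> coord A Y) (scal X * scal Y)"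
definition "r *\<^sub>R X = mk_prod (\<lambda>A. complex_of_real r \<odot>\<^bsub>A\<^esub> coord A X) (r *\<^sub>R scal X)"
definition "- X = (- 1) *\<^sub>R (X :: 'a cstar_product)"
definition "X - Y = X + - (Y :: 'a cstar_product)"

instance ..

end

lemma cnorm_coord_le_prod_norm: "unital_cstar_algebra A \<Longrightarrow> cnorm A (coord A X) \<le> prod_norm X"
  unfolding prod_norm_def
  by (rule cSup_upper[OF _ bdd_above_coord_norms]) (auto simp: coord_norms_def)

lemma cmod_scal_le_prod_norm: "cmod (scal X) \<le> prod_norm X"
  unfolding prod_norm_def
  by (rule cSup_upper[OF _ bdd_above_coord_norms]) (auto simp: coord_norms_def)

lemma prod_norm_leI:
  assumes "cmod (scal X) \<le> K" "\<And>A. unital_cstar_algebra A \<Longrightarrow> cnorm A (coord A X) \<le> K"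
  shows "prod_norm X \<le> K"
  unfolding prod_norm_def
  by (rule cSup_least) (use assms in \<open>auto simp: coord_norms_def\<close>)

lemma prod_norm_nonneg: "0 \<le> prod_norm (X :: 'a cstar_product)"
  using cmod_scal_le_prod_norm[of X] norm_ge_zero order_trans by blast

named_theorems coord_simps

lemma coord_zero [coord_simps]:
  "unital_cstar_algebra (A :: 'a cstar) \<Longrightarrow> coord A 0 = \<zero>\<^bsub>A\<^esub>" "scal (0 :: 'a cstar_product) = 0"
proof -
  have *: "\<zero>\<^bsub>A\<^esub> \<in> carrier A" "cnorm A \<zero>\<^bsub>A\<^esub> \<le> 0" if "unital_cstar_algebra A" for A :: "'a cstar"
  proof -
    interpret unital_cstar_algebra A by fact
    show "\<zero>\<^bsub>A\<^esub> \<in> carrier A" "cnorm A \<zero>\<^bsub>A\<^esub> \<le> 0" by simp_all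
  qed
  show "unital_cstar_algebra A \<Longrightarrow> coord A 0 = \<zero>\<^bsub>A\<^esub>" "scal (0 :: 'a cstar_product) = 0"
    unfolding zero_cstar_product_def by (rule coord_mk_prod[OF *]; assumption)+
qed

lemma coord_one [coord_simps]:
  "unital_cstar_algebra (A :: 'a cstar) \<Longrightarrow> coord A 1 = \<one>\<^bsub>A\<^esub>" "scal (1 :: 'a cstar_product) = 1"
proof -
  have *: "\<one>\<^bsub>A\<^esub> \<in> carrier A" "cnorm A \<one>\<^bsub>A\<^esub> \<le> 1" if "unital_cstar_algebra A" for A :: "'a cstar"
  proof -
    interpret unital_cstar_algebra A by fact
    show "\<one>\<^bsub>A\<^esub> \<in> carrier A" "cnorm A \<one>\<^bsub>A\<^esub> \<le> 1" by simp_all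
  qed
  show "unital_cstar_algebra A \<Longrightarrow> coord A 1 = \<one>\<^bsub>A\<^esub>" "scal (1 :: 'a cstar_product) = 1"
    unfolding one_cstar_product_def by (rule coord_mk_prod[OF *]; assumption)+
qed

lemma coord_add [coord_simps]:
  "unital_cstar_algebra A \<Longrightarrow> coord A (X + Y) = coord A X \<oplus>\<^bsub>A\<^esub> coord A Y"
  "scal (X + Y) = scal X + scal Y"
proof -
  have *: "coord A X \<oplus>\<^bsub>A\<^esub> coord A Y \<in> carrier A" "cnorm A (coord A X \<oplus>\<^bsub>A\<^esub> coord A Y) \<le> prod_norm X + prod_norm Y"
    if "unital_cstar_algebra A" for A
  proof -
    interpret unital_cstar_algebra A by fact
    note [simp] = coord_in_carrier[OF that]
    show "coord A X \<oplus>\<^bsub>A\<^esub> coord A Y \<in> carrier A" "cnorm A (coord A X \<oplus>\<^bsub>A\<^esub> coord A Y) \<le> prod_norm X + prod_norm Y"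
      using cnorm_triangle[of "coord A X" "coord A Y"] cnorm_coord_le_prod_norm[OF that, of X] cnorm_coord_le_prod_norm[OF that, of Y]
      by simp_all
  qed
  show "unital_cstar_algebra A \<Longrightarrow> coord A (X + Y) = coord A X \<oplus>\<^bsub>A\<^esub> coord A Y"
    "scal (X + Y) = scal X + scal Y"
    unfolding plus_cstar_product_def by (rule coord_mk_prod[OF *]; assumption)+
qed

lemma coord_mult [coord_simps]:
  "unital_cstar_algebra A \<Longrightarrow> coord A (X * Y) = coord A X \<otimes>\<^bsub>A\<^esub> coord A Y"
  "scal (X * Y) = scal X * scal Y"
proof -
  have *: "coord A X \<otimes>\<^bsub>A\<^esub> coord A Y \<in> carrier A" "cnorm A (coord A X \<otimes>\<^bsub>A\<^esub> coord A Y) \<le> prod_norm X * prod_norm Y"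
    if "unital_cstar_algebra A" for A
  proof -
    interpret unital_cstar_algebra A by fact
    note [simp] = coord_in_carrier[OF that]
    show "coord A X \<otimes>\<^bsub>A\<^esub> coord A Y \<in> carrier A" by simp
    show "cnorm A (coord A X \<otimes>\<^bsub>A\<^esub> coord A Y) \<le> prod_norm X * prod_norm Y"
      by (rule order_trans[OF cnorm_mult])
        (auto intro!: mult_mono cnorm_coord_le_prod_norm that cnorm_nonneg prod_norm_nonneg)
  qed
  show "unital_cstar_algebra A \<Longrightarrow> coord A (X * Y) = coord A X \<otimes>\<^bsub>A\<^esub> coord A Y"
    "scal (X * Y) = scal X * scal Y"
    unfolding times_cstar_product_def by (rule coord_mk_prod[OF *]; assumption)+
qed

lemma coord_scaleR [coord_simps]:
  "unital_cstar_algebra A \<Longrightarrow> coord A (r *\<^sub>R X) = complex_of_real r \<odot>\<^bsub>A\<^esub> coord A X"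
  "scal (r *\<^sub>R X) = r *\<^sub>R scal X"
proof -
  have *: "complex_of_real r \<odot>\<^bsub>A\<^esub> coord A X \<in> carrier A"
    "cnorm A (complex_of_real r \<odot>\<^bsub>A\<^esub> coord A X) \<le> \<bar>r\<bar> * prod_norm X"
    if "unital_cstar_algebra A" for A
  proof -
    interpret unital_cstar_algebra A by fact
    note [simp] = coord_in_carrier[OF that]
    show "complex_of_real r \<odot>\<^bsub>A\<^esub> coord A X \<in> carrier A"
      "cnorm A (complex_of_real r \<odot>\<^bsub>A\<^esub> coord A X) \<le> \<bar>r\<bar> * prod_norm X"
      using cnorm_coord_le_prod_norm[OF that, of X] by (simp_all add: cnorm_smult mult_left_mono)
  qed
  show "unital_cstar_algebra A \<Longrightarrow> coord A (r *\<^sub>R X) = complex_of_real r \<odot>\<^bsub>A\<^esub> coord A X"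
    "scal (r *\<^sub>R X) = r *\<^sub>R scal X"
    unfolding scaleR_cstar_product_def by (rule coord_mk_prod[OF *]; assumption)+
qed

lemma coord_diff [coord_simps]:
  "unital_cstar_algebra A \<Longrightarrow> coord A (X - Y) = coord A X \<ominus>\<^bsub>A\<^esub> coord A Y"
  "scal (X - Y) = scal X - scal Y"
  unfolding minus_cstar_product_def uminus_cstar_product_def
  by (simp_all add: coord_simps coord_in_carrier unital_cstar_algebra.minus_eq_smult)

context unital_cstar_algebra
begin

lemma coord_in [simp]: "coord A X \<in> carrier A"
  by (rule coord_in_carrier) unfold_locales

lemmas coord_ops = coord_simps(1)[OF unital_cstar_algebra_axioms] coord_one(1)[OF unital_cstar_algebra_axioms]
  coord_add(1)[OF unital_cstar_algebra_axioms] coord_mult(1)[OF unital_cstar_algebra_axioms]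
  coord_scaleR(1)[OF unital_cstar_algebra_axioms] coord_diff(1)[OF unital_cstar_algebra_axioms]

text \<open>The algebra axioms hold in each coordinate by the laws of \<open>A\<close>. As equations
  between coordinates they can be fed directly to \<open>cstar_product_eqI\<close>.\<close>

lemma coord_algebra:
  "coord A (X + Y + Z) = coord A (X + (Y + Z))" "coord A (X + Y) = coord A (Y + X)"
  "coord A (0 + X) = coord A X" "coord A (- X + X) = coord A 0"
  "coord A (X * Y * Z) = coord A (X * (Y * Z))" "coord A ((X + Y) * Z) = coord A (X * Z + Y * Z)"
  "coord A (X * (Y + Z)) = coord A (X * Y + X * Z)" "coord A (1 * X) = coord A X" "coord A (X * 1) = coord A X"
  "coord A (r *\<^sub>R (X + Y)) = coord A (r *\<^sub>R X + r *\<^sub>R Y)"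
  "coord A ((r + s) *\<^sub>R X) = coord A (r *\<^sub>R X + s *\<^sub>R X)"
  "coord A (r *\<^sub>R s *\<^sub>R X) = coord A ((r * s) *\<^sub>R X)" "coord A (1 *\<^sub>R X) = coord A X"
  "coord A (r *\<^sub>R X * Y) = coord A (r *\<^sub>R (X * Y))" "coord A (X * r *\<^sub>R Y) = coord A (r *\<^sub>R (X * Y))"
  using smult_add_left[of "coord A X" "-1" 1]
  by (simp_all add: uminus_cstar_product_def coord_ops a_assoc m_assoc l_distr r_distr
      smult_add_left smult_add_right smult_smult smult_mult_left smult_mult_right a_comm a_lcomm)

end

lemma coord_uminus [coord_simps]:
  "unital_cstar_algebra A \<Longrightarrow> coord A (- X) = (- 1) \<odot>\<^bsub>A\<^esub> coord A X" "scal (- X) = - scal X"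
  by (simp_all add: uminus_cstar_product_def coord_simps)

section \<open>The product as a Banach algebra with involution\<close>

instantiation cstar_product :: (type) real_normed_algebra_1
begin

definition "norm X = prod_norm X"
definition "dist X Y = norm (X - Y :: 'a cstar_product)"
definition "sgn X = inverse (norm X) *\<^sub>R (X :: 'a cstar_product)"
definition "uniformity = (INF e\<in>{0 <..}. principal {(x :: 'a cstar_product, y). dist x y < e})"
definition "open U \<longleftrightarrow> (\<forall>x\<in>U. eventually (\<lambda>(x' :: 'a cstar_product, y). x' = x \<longrightarrow> y \<in> U) uniformity)"

instance
proof
  fix X Y Z :: "'a cstar_product" and r s :: real
  note laws = unital_cstar_algebra.coord_algebra
  show "X + Y + Z = X + (Y + Z)" "X + Y = Y + X" "0 + X = X" "- X + X = 0"
    "X * Y * Z = X * (Y * Z)" "(X + Y) * Z = X * Z + Y * Z" "X * (Y + Z) = X * Y + X * Z"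
    "1 * X = X" "X * 1 = X" "r *\<^sub>R (X + Y) = r *\<^sub>R X + r *\<^sub>R Y"
    "(r + s) *\<^sub>R X = r *\<^sub>R X + s *\<^sub>R X" "r *\<^sub>R s *\<^sub>R X = (r * s) *\<^sub>R X"
    "1 *\<^sub>R X = X" "r *\<^sub>R X * Y = r *\<^sub>R (X * Y)" "X * r *\<^sub>R Y = r *\<^sub>R (X * Y)"
    by (rule cstar_product_eqI; (erule laws)?; simp add: coord_simps algebra_simps)+
  show "X - Y = X + - Y"
    by (simp add: minus_cstar_product_def)
  show "(0 :: 'a cstar_product) \<noteq> 1"
    by (metis coord_one(2) coord_zero(2) zero_neq_one)
  show "dist X Y = norm (X - Y)"
    by (simp add: dist_cstar_product_def)
  show "sgn X = inverse (norm X) *\<^sub>R X"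
    by (simp add: sgn_cstar_product_def)
  show "uniformity = (INF e\<in>{0 <..}. principal {(x :: 'a cstar_product, y). dist x y < e})"
    by (simp add: uniformity_cstar_product_def)
  show "open U \<longleftrightarrow> (\<forall>x\<in>U. \<forall>\<^sub>F (x', y) in uniformity. x' = x \<longrightarrow> y \<in> U)" for U :: "'a cstar_product set"
    by (simp add: open_cstar_product_def)
  show "norm X = 0 \<longleftrightarrow> X = 0"
    unfolding norm_cstar_product_def
  proof
    assume X: "prod_norm X = 0"
    show "X = 0"
    proof (rule cstar_product_eqI)
      fix A :: "'a cstar" assume A: "unital_cstar_algebra A"
      then interpret unital_cstar_algebra A .
      have "cnorm A (coord A X) = 0"
        using cnorm_coord_le_prod_norm[OF A, of X] X cnorm_nonneg[of "coord A X"] by simp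
      then show "coord A X = coord A 0"
        by (simp add: coord_ops cnorm_eq_zero)
    qed (use cmod_scal_le_prod_norm[of X] X in \<open>simp add: coord_simps\<close>)
  next
    assume X: "X = 0"
    have "prod_norm X \<le> 0"
      unfolding X by (rule prod_norm_leI)
        (simp_all add: coord_simps unital_cstar_algebra.cnorm_zero)
    then show "prod_norm X = 0"
      using prod_norm_nonneg[of X] by simp
  qed
  show "norm (X + Y) \<le> norm X + norm Y"
    unfolding norm_cstar_product_def
  proof (rule prod_norm_leI)
    show "cmod (scal (X + Y)) \<le> prod_norm X + prod_norm Y"
      using norm_triangle_ineq[of "scal X" "scal Y"] cmod_scal_le_prod_norm[of X] cmod_scal_le_prod_norm[of Y]
      by (simp add: coord_simps)
    fix A :: "'a cstar" assume A: "unital_cstar_algebra A"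
    then interpret unital_cstar_algebra A .
    show "cnorm A (coord A (X + Y)) \<le> prod_norm X + prod_norm Y"
      using cnorm_triangle[of "coord A X" "coord A Y"] cnorm_coord_le_prod_norm[OF A, of X] cnorm_coord_le_prod_norm[OF A, of Y]
      by (simp add: coord_ops)
  qed
  show "norm (X * Y) \<le> norm X * norm Y"
    unfolding norm_cstar_product_def
  proof (rule prod_norm_leI)
    show "cmod (scal (X * Y)) \<le> prod_norm X * prod_norm Y"
      using mult_mono[OF cmod_scal_le_prod_norm[of X] cmod_scal_le_prod_norm[of Y]]
      by (simp add: coord_simps norm_mult prod_norm_nonneg)
    fix A :: "'a cstar" assume A: "unital_cstar_algebra A"
    then interpret unital_cstar_algebra A .
    show "cnorm A (coord A (X * Y)) \<le> prod_norm X * prod_norm Y"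
      using cnorm_mult[of "coord A X" "coord A Y"]
        mult_mono[OF cnorm_coord_le_prod_norm[OF A, of X] cnorm_coord_le_prod_norm[OF A, of Y]]
      by (simp add: coord_ops prod_norm_nonneg cnorm_nonneg)
  qed
  show "norm (1 :: 'a cstar_product) = 1"
    unfolding norm_cstar_product_def
  proof (rule antisym)
    show "prod_norm (1 :: 'a cstar_product) \<le> 1"
      by (rule prod_norm_leI) (simp_all add: coord_simps unital_cstar_algebra.cnorm_one)
    show "1 \<le> prod_norm (1 :: 'a cstar_product)"
      using cmod_scal_le_prod_norm[of 1] by (simp add: coord_simps)
  qed
  \<comment> \<open>Only this inequality is checked on coordinates; the reverse one results from
    applying it with \<open>1 / r\<close> to \<open>r *\<^sub>R X\<close>.\<close>
  have le: "prod_norm (t *\<^sub>R U) \<le> \<bar>t\<bar> * prod_norm U" for t and U :: "'a cstar_product"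
  proof (rule prod_norm_leI)
    show "cmod (scal (t *\<^sub>R U)) \<le> \<bar>t\<bar> * prod_norm U"
      using cmod_scal_le_prod_norm[of U] by (simp add: coord_simps mult_left_mono)
    fix A :: "'a cstar" assume A: "unital_cstar_algebra A"
    then interpret unital_cstar_algebra A .
    show "cnorm A (coord A (t *\<^sub>R U)) \<le> \<bar>t\<bar> * prod_norm U"
      using cnorm_coord_le_prod_norm[OF A, of U] by (simp add: coord_ops cnorm_smult mult_left_mono)
  qed
  show "norm (r *\<^sub>R X) = \<bar>r\<bar> * norm X"
    unfolding norm_cstar_product_def
  proof (cases "r = 0")
    case True
    with le[of r X] prod_norm_nonneg[of "r *\<^sub>R X"] show "prod_norm (r *\<^sub>R X) = \<bar>r\<bar> * prod_norm X" by simp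
  next
    case False
    have "(1 / r) *\<^sub>R r *\<^sub>R X = X"
      using False by (intro cstar_product_eqI) (simp_all add: laws, simp add: coord_simps)
    then have "prod_norm X \<le> \<bar>1 / r\<bar> * prod_norm (r *\<^sub>R X)"
      using le[of "1 / r" "r *\<^sub>R X"] by simp
    with False le[of r X] show "prod_norm (r *\<^sub>R X) = \<bar>r\<bar> * prod_norm X"
      by (simp add: field_simps)
  qed
qed

end

lemmas cnorm_coord_le = cnorm_coord_le_prod_norm[folded norm_cstar_product_def]
lemmas cmod_scal_le = cmod_scal_le_prod_norm[folded norm_cstar_product_def]
lemmas cstar_product_norm_leI = prod_norm_leI[folded norm_cstar_product_def]

text \<open>The limit is formed coordinatewise by completeness of every factor. Cauchy estimates are
  uniform over the factors, so the family of limits is bounded and the convergence takes place in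
  the supremum norm.\<close>

instance cstar_product :: (type) banach
proof
  fix X :: "nat \<Rightarrow> 'a cstar_product"
  assume C: "Cauchy X"
  have ex: "\<exists>l. l \<in> carrier A \<and> (\<lambda>n. cnorm A (coord A (X n) \<ominus>\<^bsub>A\<^esub> l)) \<longlonglongrightarrow> 0"
    if A: "unital_cstar_algebra A" for A
  proof -
    interpret unital_cstar_algebra A by fact
    have "\<exists>N. \<forall>m\<ge>N. \<forall>n\<ge>N. cnorm A (coord A (X m) \<ominus>\<^bsub>A\<^esub> coord A (X n)) < e" if "0 < e" for e
      using CauchyD[OF C that] cnorm_coord_le[OF A, of "X m - X n" for m n]
      by (metis coord_diff(1)[OF A] order_le_less_trans)
    then obtain l where "l \<in> carrier A" "(\<lambda>n. cnorm A (coord A (X n) \<ominus>\<^bsub>A\<^esub> l)) \<longlonglongrightarrow> 0"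
      by (rule cauchy_limit[of "\<lambda>n. coord A (X n)", rotated]) (simp_all add: that)
    then show ?thesis
      by blast
  qed
  then obtain g where g: "\<And>A. unital_cstar_algebra A \<Longrightarrow>
      g A \<in> carrier A \<and> (\<lambda>n. cnorm A (coord A (X n) \<ominus>\<^bsub>A\<^esub> g A)) \<longlonglongrightarrow> 0"
    by metis
  have "Cauchy (\<lambda>n. scal (X n))"
  proof (rule CauchyI)
    fix e :: real assume "0 < e"
    then obtain N where N: "\<forall>m\<ge>N. \<forall>n\<ge>N. norm (X m - X n) < e"
      using CauchyD[OF C] by blast
    have "norm (scal (X m) - scal (X n)) \<le> norm (X m - X n)" for m n
      using cmod_scal_le[of "X m - X n"] by (simp add: coord_simps)
    with N show "\<exists>N. \<forall>m\<ge>N. \<forall>n\<ge>N. norm (scal (X m) - scal (X n)) < e"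
      using order_le_less_trans by blast
  qed
  then obtain z where z: "(\<lambda>n. scal (X n)) \<longlonglongrightarrow> z"
    using Cauchy_convergent convergent_def by blast
  \<comment> \<open>The bound passes to the limit in the second argument. It is a bound for the norm
    of the product, hence the same for all factors.\<close>
  have limit_le: "cnorm A (coord A U \<ominus>\<^bsub>A\<^esub> g A) \<le> e"
    if A: "unital_cstar_algebra A" and N: "\<And>n. n \<ge> N \<Longrightarrow> norm (U - X n) \<le> e" for A U N e
  proof -
    interpret unital_cstar_algebra A by fact
    have gA: "g A \<in> carrier A"
      using g[OF A] by simp
    have "cnorm A (coord A U \<ominus>\<^bsub>A\<^esub> g A) \<le> e + cnorm A (coord A (X n) \<ominus>\<^bsub>A\<^esub> g A)" if "n \<ge> N" for n
      using cnorm_triangle_minus[of "coord A U" "coord A (X n)" "g A"] gA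
        cnorm_coord_le[OF A, of "U - X n"] N[OF that] by (simp add: coord_ops)
    moreover have "(\<lambda>n. e + cnorm A (coord A (X n) \<ominus>\<^bsub>A\<^esub> g A)) \<longlonglongrightarrow> e + 0"
      using g[OF A] by (intro tendsto_intros) auto
    ultimately have "cnorm A (coord A U \<ominus>\<^bsub>A\<^esub> g A) \<le> e + 0"
      by (intro LIMSEQ_le_const) auto
    then show ?thesis by simp
  qed
  obtain K where K: "\<And>n. norm (X n) \<le> K"
    using cauchy_imp_bounded[OF C] by (auto simp: bounded_iff)
  \<comment> \<open>The choice \<open>U = 0\<close> bounds all coordinate limits by one constant, so
    \<open>mk_prod g z\<close> is a genuine element of the product.\<close>
  have gK: "cnorm A (g A) \<le> K" if A: "unital_cstar_algebra A" for A
  proof -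
    interpret unital_cstar_algebra A by fact
    have "cnorm A (coord A 0 \<ominus>\<^bsub>A\<^esub> g A) \<le> K"
      by (rule limit_le[OF A, of 0]) (simp add: K)
    moreover have "cnorm A (\<zero>\<^bsub>A\<^esub> \<ominus>\<^bsub>A\<^esub> g A) = cnorm A (g A)"
      using g[OF A] by (simp add: minus_eq_smult cnorm_smult)
    ultimately show ?thesis
      by (simp add: coord_ops)
  qed
  define G where "G = mk_prod g z"
  have G: "coord A G = g A" "scal G = z" if "unital_cstar_algebra A" for A
    using coord_mk_prod[of g K] g gK that by (auto simp: G_def)
  have sG: "scal G = z"
    unfolding G_def by (rule coord_mk_prod(2)[of g K]) (use g gK in auto)
  have "X \<longlonglongrightarrow> G"
  proof (rule LIMSEQ_I)
    fix e :: real assume "0 < e"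
    then obtain N where N: "\<forall>m\<ge>N. \<forall>n\<ge>N. norm (X m - X n) < e / 2"
      using CauchyD[OF C, of "e / 2"] by auto
    have "norm (X n - G) \<le> e / 2" if "n \<ge> N" for n
    proof (rule cstar_product_norm_leI)
      have "(\<lambda>m. norm (scal (X n) - scal (X m))) \<longlonglongrightarrow> norm (scal (X n) - z)"
        by (intro tendsto_intros z)
      moreover have "norm (scal (X n) - scal (X m)) \<le> e / 2" if "m \<ge> N" for m
        using N \<open>n \<ge> N\<close> that cmod_scal_le[of "X n - X m"]
        by (fastforce simp: coord_simps)
      ultimately have "norm (scal (X n) - z) \<le> e / 2"
        by (intro LIMSEQ_le_const2) auto
      then show "cmod (scal (X n - G)) \<le> e / 2"
        by (simp add: coord_simps sG)
      fix A :: "'a cstar" assume A: "unital_cstar_algebra A"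
      show "cnorm A (coord A (X n - G)) \<le> e / 2"
        using limit_le[OF A, of N "X n" "e / 2"] N that by (auto simp: coord_simps A G less_imp_le)
    qed
    then show "\<exists>no. \<forall>n\<ge>no. norm (X n - G) < e"
      using \<open>0 < e\<close> by (intro exI[of _ N]) (fastforce intro: order_le_less_trans)
  qed
  then show "convergent X"
    by (rule convergentI)
qed

context unital_cstar_algebra
begin

lemma cnorm_adj: "x \<in> carrier A \<Longrightarrow> cnorm A (adj A x) = cnorm A x"
proof -
  have le: "cnorm A y \<le> cnorm A (adj A y)" if y: "y \<in> carrier A" for y
  proof (cases "cnorm A y = 0")
    case True
    then show ?thesis
      using y by (simp add: cnorm_nonneg)
  next
    case False
    have "(cnorm A y)\<^sup>2 \<le> cnorm A (adj A y) * cnorm A y"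
      using cstar_identity[OF y] cnorm_mult[of "adj A y" y] y by simp
    moreover have "0 < cnorm A y"
      using False cnorm_nonneg[OF y] by simp
    ultimately show ?thesis
      by (simp add: power2_eq_square)
  qed
  assume "x \<in> carrier A"
  then show ?thesis
    using le[of x] le[of "adj A x"] by (simp add: adj_adj)
qed

end

instantiation cstar_product :: (type) cstar_algebra
begin

definition "star X = mk_prod (\<lambda>A. adj A (coord A X)) (cnj (scal X))"
definition "imag = mk_prod (\<lambda>A. \<i> \<odot>\<^bsub>A\<^esub> \<one>\<^bsub>A\<^esub>) \<i>"

lemma coord_star [coord_simps]:
  "unital_cstar_algebra A \<Longrightarrow> coord A (star X) = adj A (coord A X)"
  "scal (star X) = cnj (scal X)"
proof -
  have *: "adj A (coord A X) \<in> carrier A" "cnorm A (adj A (coord A X)) \<le> norm X"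
    if "unital_cstar_algebra A" for A
    using cnorm_coord_le[OF that, of X] coord_in_carrier[OF that, of X]
    by (simp_all add: that unital_cstar_algebra.adj_closed unital_cstar_algebra.cnorm_adj)
  show "unital_cstar_algebra A \<Longrightarrow> coord A (star X) = adj A (coord A X)"
    "scal (star X) = cnj (scal X)"
    unfolding star_cstar_product_def by (rule coord_mk_prod[OF *]; assumption)+
qed

lemma coord_imag [coord_simps]:
  "unital_cstar_algebra (A :: 'a cstar) \<Longrightarrow> coord A imag = \<i> \<odot>\<^bsub>A\<^esub> \<one>\<^bsub>A\<^esub>"
  "scal (imag :: 'a cstar_product) = \<i>"
proof -
  have *: "\<i> \<odot>\<^bsub>A\<^esub> \<one>\<^bsub>A\<^esub> \<in> carrier A" "cnorm A (\<i> \<odot>\<^bsub>A\<^esub> \<one>\<^bsub>A\<^esub>) \<le> 1"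
    if "unital_cstar_algebra A" for A :: "'a cstar"
  proof -
    interpret unital_cstar_algebra A by fact
    show "\<i> \<odot>\<^bsub>A\<^esub> \<one>\<^bsub>A\<^esub> \<in> carrier A" "cnorm A (\<i> \<odot>\<^bsub>A\<^esub> \<one>\<^bsub>A\<^esub>) \<le> 1"
      by (simp_all add: cnorm_smult one_closed)
  qed
  show "unital_cstar_algebra A \<Longrightarrow> coord A imag = \<i> \<odot>\<^bsub>A\<^esub> \<one>\<^bsub>A\<^esub>" "scal (imag :: 'a cstar_product) = \<i>"
    for A :: "'a cstar"
    unfolding imag_cstar_product_def by (rule coord_mk_prod[OF *]; assumption)+
qed

instance
proof
  fix X Y :: "'a cstar_product" and r :: real
  have *: "coord A (star (star X)) = coord A X"
      "coord A (star (X + Y)) = coord A (star X + star Y)"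
      "coord A (star (r *\<^sub>R X)) = coord A (r *\<^sub>R star X)"
      "coord A (star (X * Y)) = coord A (star Y * star X)"
      "coord A (star imag) = coord A (- imag)"
      "coord A (imag * imag) = coord A (- 1)"
      "coord A (imag * X) = coord A (X * imag)"
    if A: "unital_cstar_algebra A" for A
  proof -
    interpret unital_cstar_algebra A by fact
    show "coord A (star (star X)) = coord A X"
      "coord A (star (X + Y)) = coord A (star X + star Y)"
      "coord A (star (r *\<^sub>R X)) = coord A (r *\<^sub>R star X)"
      "coord A (star (X * Y)) = coord A (star Y * star X)"
      "coord A (star imag) = coord A (- imag)"
      "coord A (imag * imag) = coord A (- 1)"
      "coord A (imag * X) = coord A (X * imag)"
      by (simp_all add: coord_simps A adj_adj adj_add adj_smult adj_mult minus_eq_smult smult_smult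
          smult_mult_left smult_mult_right one_closed zero_closed l_zero l_one r_one)
  qed
  show "star (star X) = X" "star (X + Y) = star X + star Y" "star (r *\<^sub>R X) = r *\<^sub>R star X"
    "star (X * Y) = star Y * star X" "star imag = (- imag :: 'a cstar_product)"
    "imag * imag = (- 1 :: 'a cstar_product)" "imag * X = X * imag"
    by (rule cstar_product_eqI; (erule *)?; simp add: coord_simps)+
  \<comment> \<open>The C*-identity of each coordinate bounds its norm by the root of the norm of
    \<open>star X * X\<close>, and the supremum inherits the bound. The other inequality is
    submultiplicativity with an isometric involution.\<close>
  have sq: "(norm X)\<^sup>2 \<le> norm (star X * X)"
  proof -
    have "norm X \<le> sqrt (norm (star X * X))"
    proof (rule cstar_product_norm_leI)
      show "cmod (scal X) \<le> sqrt (norm (star X * X))"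
        using cmod_scal_le[of "star X * X"]
        by (intro real_le_rsqrt) (simp add: coord_simps norm_mult power2_eq_square)
      fix A :: "'a cstar" assume A: "unital_cstar_algebra A"
      show "cnorm A (coord A X) \<le> sqrt (norm (star X * X))"
        using cnorm_coord_le[OF A, of "star X * X"] coord_in_carrier[OF A, of X]
        by (intro real_le_rsqrt) (simp add: coord_simps A unital_cstar_algebra.cstar_identity)
    qed
    then have "(norm X)\<^sup>2 \<le> (sqrt (norm (star X * X)))\<^sup>2"
      by (intro power_mono) auto
    then show ?thesis by simp
  qed
  have "norm (star X) \<le> norm X"
    by (rule cstar_product_norm_leI)
      (use cmod_scal_le[of X] cnorm_coord_le[of _ X] in \<open>auto simp: coord_simps
        unital_cstar_algebra.cnorm_adj coord_in_carrier\<close>)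
  then have "norm (star X * X) \<le> norm X * norm X"
    using norm_mult_ineq[of "star X" X] mult_right_mono[of "norm (star X)" "norm X" "norm X"] by simp
  with sq show "norm (star X * X) = (norm X)\<^sup>2"
    by (simp add: power2_eq_square)
qed

end

section \<open>Transfer of positivity\<close>

text \<open>An isometric real-linear section of \<open>coord A\<close>. It need not be unital: the
  unit of \<open>A\<close> goes to an element that vanishes in all other coordinates. Statements
  about the unit must therefore be read off through \<open>coord A\<close>, or checked separately in
  the remaining coordinates.\<close>

definition lift :: "'a cstar \<Rightarrow> 'a \<Rightarrow> 'a cstar_product" where
  "lift A x = mk_prod (\<lambda>B. if B = A then x else \<zero>\<^bsub>B\<^esub>) 0"

context unital_cstar_algebra
begin

lemma
  assumes "x \<in> carrier A"
  shows coord_lift: "unital_cstar_algebra B \<Longrightarrow> coord B (lift A x) = (if B = A then x else \<zero>\<^bsub>B\<^esub>)"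
    and scal_lift: "scal (lift A x) = 0"
proof -
  have *: "(if B = A then x else \<zero>\<^bsub>B\<^esub>) \<in> carrier B"
    "cnorm B (if B = A then x else \<zero>\<^bsub>B\<^esub>) \<le> cnorm A x" if B: "unital_cstar_algebra B" for B
    using assms unital_cstar_algebra.zero_closed[OF B] unital_cstar_algebra.cnorm_zero[OF B] cnorm_nonneg
    by auto
  show "unital_cstar_algebra B \<Longrightarrow> coord B (lift A x) = (if B = A then x else \<zero>\<^bsub>B\<^esub>)"
    "scal (lift A x) = 0"
    unfolding lift_def by (rule coord_mk_prod[OF *]; assumption)+
qed

lemma coord_lift_self: "x \<in> carrier A \<Longrightarrow> coord A (lift A x) = x"
  by (simp add: coord_lift unital_cstar_algebra_axioms)

lemma lift_add: "x \<in> carrier A \<Longrightarrow> y \<in> carrier A \<Longrightarrow> lift A (x \<oplus> y) = lift A x + lift A y"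
  by (rule cstar_product_eqI)
    (auto simp: coord_simps coord_lift scal_lift a_closed unital_cstar_algebra.zero_closed
      unital_cstar_algebra.l_zero)

lemma lift_smult: "x \<in> carrier A \<Longrightarrow> lift A (complex_of_real r \<odot> x) = r *\<^sub>R lift A x"
  by (rule cstar_product_eqI)
    (auto simp: coord_simps coord_lift scal_lift unital_cstar_algebra.smult_zero)

lemma lift_adj: "x \<in> carrier A \<Longrightarrow> lift A (adj A x) = star (lift A x)"
  by (rule cstar_product_eqI)
    (auto simp: coord_simps coord_lift scal_lift unital_cstar_algebra.adj_zero)

lemma norm_lift: "x \<in> carrier A \<Longrightarrow> norm (lift A x) = cnorm A x"
proof (rule antisym)
  assume x: "x \<in> carrier A"
  show "norm (lift A x) \<le> cnorm A x"
    using x by (intro cstar_product_norm_leI)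
      (auto simp: scal_lift coord_lift cnorm_nonneg unital_cstar_algebra.cnorm_zero)
  show "cnorm A x \<le> norm (lift A x)"
    using cnorm_coord_le[OF unital_cstar_algebra_axioms, of "lift A x"] x by (simp add: coord_lift_self)
qed

lemma coord_of_real: "coord A (of_real r) = complex_of_real r \<odot> \<one>"
  by (simp add: of_real_def coord_ops)

text \<open>Positivity of a state refers to products \<open>adj A x \<otimes> x\<close> only, and
  this lemma brings \<open>t \<one> \<ominus> a\<close> into that form. In the product,
  \<open>of_real t - lift A a\<close> is positive because \<open>lift A a\<close> has norm at most
  \<open>t\<close>; its root is sent back by \<open>coord A\<close>.\<close>

lemma sqrt_shift:
  assumes "a \<in> self_adjoint A" "cnorm A a \<le> t"
  obtains y where "y \<in> self_adjoint A" "y \<otimes> y = complex_of_real t \<odot> \<one> \<ominus> a"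
proof -
  have a: "a \<in> carrier A" "adj A a = a"
    using assms by (auto simp: self_adjoint_def)
  have "star (lift A a) = lift A a"
    using lift_adj[of a] a by simp
  then have "pos (of_real t - lift A a)"
    using assms a by (auto simp: pos_def star_diff norm_lift intro!: exI[of _ t])
  then obtain k where k: "pos k" "k * k = of_real t - lift A a"
    using pos_sqrt by blast
  have "adj A (coord A k) = coord A (star k)"
    by (simp add: coord_star unital_cstar_algebra_axioms)
  also have "star k = k"
    using k by (simp add: pos_def)
  finally have "coord A k \<in> self_adjoint A"
    by (simp add: self_adjoint_def)
  moreover have "coord A k \<otimes> coord A k = complex_of_real t \<odot> \<one> \<ominus> a"
    using arg_cong[OF k(2), of "coord A"] a by (simp add: coord_ops coord_of_real coord_lift_self)
  ultimately show thesis
    using that by blast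
qed

text \<open>Coordinates do not increase norms, so the norm inequality that expresses
  \<open>pos_star_mult\<close> in the product descends to \<open>A\<close>.\<close>

lemma adj_mult_positive:
  assumes "x \<in> carrier A"
  obtains t where "cnorm A (complex_of_real t \<odot> \<one> \<ominus> adj A x \<otimes> x) \<le> t"
proof -
  obtain t where t: "norm (of_real t - star (lift A x) * lift A x) \<le> t"
    using pos_star_mult[of "lift A x"] by (auto simp: pos_def)
  have "coord A (of_real t - star (lift A x) * lift A x) = complex_of_real t \<odot> \<one> \<ominus> adj A x \<otimes> x"
    using assms by (simp add: coord_ops coord_of_real coord_star coord_lift_self unital_cstar_algebra_axioms)
  then have "cnorm A (complex_of_real t \<odot> \<one> \<ominus> adj A x \<otimes> x) \<le> t"
    using t cnorm_coord_le[OF unital_cstar_algebra_axioms] order_trans by metis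
  then show thesis
    using that by blast
qed

text \<open>The hypotheses express positivity of \<open>t - a\<close> with parameter
  \<open>s + t\<close> and of \<open>t + a\<close> with parameter \<open>s' + t\<close>. The shifts
  are kept apart from \<open>t\<close> because in \<open>norming_state\<close> they come from
  near-minimizers of an infimum and their size is not controlled.\<close>

lemma cnorm_le_of_order_bound:
  assumes "a \<in> self_adjoint A" "0 \<le> t" "0 \<le> s" "0 \<le> s'"
    and "cnorm A (complex_of_real s \<odot> \<one> \<oplus> a) \<le> s + t"
    and "cnorm A (complex_of_real s' \<odot> \<one> \<ominus> a) \<le> s' + t"
  shows "cnorm A a \<le> 3 * t"
proof -
  have a: "a \<in> carrier A" "adj A a = a"
    using assms by (auto simp: self_adjoint_def)
  have sl: "star (lift A a) = lift A a"
    using lift_adj[of a] a by simp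
  \<comment> \<open>In every coordinate other than \<open>A\<close> the element is \<open>r\<close>
    times the unit, of norm \<open>r\<close>, which \<open>0 \<le> t\<close> covers.\<close>
  have bound: "norm (of_real r + c *\<^sub>R lift A a) \<le> r + t"
    if "0 \<le> r" "cnorm A (complex_of_real r \<odot> \<one> \<oplus> complex_of_real c \<odot> a) \<le> r + t" for r c
  proof (rule cstar_product_norm_leI)
    show "cmod (scal (of_real r + c *\<^sub>R lift A a)) \<le> r + t"
      using that assms a by (simp add: of_real_def coord_simps scal_lift)
    fix B :: "'a cstar" assume B: "unital_cstar_algebra B"
    show "cnorm B (coord B (of_real r + c *\<^sub>R lift A a)) \<le> r + t"
    proof (cases "B = A")
      case True
      then show ?thesis
        using that a by (simp add: coord_ops coord_of_real coord_lift_self)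
    next
      case False
      then show ?thesis
        using that assms a
        by (simp add: coord_simps B coord_lift of_real_def unital_cstar_algebra.cnorm_smult
            unital_cstar_algebra.one_closed unital_cstar_algebra.smult_zero
            unital_cstar_algebra.r_zero unital_cstar_algebra.smult_in unital_cstar_algebra.cnorm_one)
    qed
  qed
  have "norm (of_real (s + t) - (of_real t - lift A a)) \<le> s + t"
    using bound[of s 1] assms a by simp
  then have "pos (of_real t - lift A a)"
    using sl by (auto simp: pos_def star_diff intro!: exI[of _ "s + t"])
  moreover have "norm (of_real (s' + t) - (of_real t + lift A a)) \<le> s' + t"
    using bound[of s' "-1"] assms a by (simp add: minus_eq_smult one_closed)
  then have "pos (of_real t + lift A a)"
    using sl by (auto simp: pos_def star_add intro!: exI[of _ "s' + t"])
  ultimately have "norm (lift A a) \<le> 3 * \<bar>t\<bar>"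
    by (rule norm_le_of_order_bound)
  then show ?thesis
    using a assms by (simp add: norm_lift)
qed

end

section \<open>The Hahn-Banach theorem\<close>

definition sublinear :: "('v::real_vector \<Rightarrow> real) \<Rightarrow> bool" where
  "sublinear p \<longleftrightarrow> (\<forall>x y. p (x + y) \<le> p x + p y) \<and> (\<forall>r\<ge>0. \<forall>x. p (r *\<^sub>R x) = r * p x)"

lemma sublinear_add: "sublinear p \<Longrightarrow> p (x + y) \<le> p x + p y"
  and sublinear_scaleR: "sublinear p \<Longrightarrow> 0 \<le> r \<Longrightarrow> p (r *\<^sub>R x) = r * p x"
  by (simp_all add: sublinear_def)

lemma sublinear_zero: "sublinear p \<Longrightarrow> p 0 = 0"
  using sublinear_scaleR[of p 0 0] by simp

lemma sublinear_minus: "sublinear p \<Longrightarrow> - p (- x) \<le> p x"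
  using sublinear_add[of p x "- x"] by (simp add: sublinear_zero)

lemma sublinear_norm: "sublinear (norm :: 'v::real_normed_vector \<Rightarrow> real)"
  by (simp add: sublinear_def norm_triangle_ineq)

lemma positively_homogeneousI:
  fixes q :: "'v::real_vector \<Rightarrow> real"
  assumes zero: "q 0 = 0" and le: "\<And>s z. 0 < s \<Longrightarrow> q (s *\<^sub>R z) \<le> s * q z" and r: "0 \<le> r"
  shows "q (r *\<^sub>R x) = r * q x"
proof (cases "r = 0")
  case False
  with r have r: "0 < r" by simp
  have "q x \<le> (1 / r) * q (r *\<^sub>R x)"
    using le[of "1 / r" "r *\<^sub>R x"] r by simp
  then have "r * q x \<le> q (r *\<^sub>R x)"
    using r by (simp add: field_simps)
  then show ?thesis
    using le[OF r, of x] by simp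
qed (simp add: zero)

text \<open>The functional is the infimum of \<open>p (x + y) - f y\<close> over \<open>y\<close> in
  \<open>F\<close>, the largest sublinear one below \<open>p\<close> with the stated bound on
  \<open>- F\<close>. It is finite since \<open>f \<le> p\<close> keeps the values above
  \<open>- p (- x)\<close>. Linear functionals below it automatically dominate \<open>f\<close> on
  \<open>F\<close>. The near-minimizers of the last conclusion are what \<open>norming_state\<close>
  extracts.\<close>

lemma sublinear_below_cone:
  fixes p f :: "'v::real_vector \<Rightarrow> real"
  assumes p: "sublinear p"
    and F: "0 \<in> F" "\<And>x y. x \<in> F \<Longrightarrow> y \<in> F \<Longrightarrow> x + y \<in> F" "\<And>r x. 0 \<le> r \<Longrightarrow> x \<in> F \<Longrightarrow> r *\<^sub>R x \<in> F"
    and f: "\<And>x y. x \<in> F \<Longrightarrow> y \<in> F \<Longrightarrow> f x + f y \<le> f (x + y)"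
      "\<And>r x. 0 \<le> r \<Longrightarrow> x \<in> F \<Longrightarrow> f (r *\<^sub>R x) = r * f x"
    and fp: "\<And>x. x \<in> F \<Longrightarrow> f x \<le> p x"
  obtains q where "sublinear q" "\<And>x. q x \<le> p x" "\<And>y. y \<in> F \<Longrightarrow> q (- y) \<le> - f y"
    "\<And>x t. q x < t \<Longrightarrow> \<exists>y\<in>F. p (x + y) - f y < t"
proof -
  define q where "q x = (INF y\<in>F. p (x + y) - f y)" for x
  have f0: "f 0 = 0"
    using f(2)[of 0 0] F(1) by simp
  have bdd: "bdd_below ((\<lambda>y. p (x + y) - f y) ` F)" for x
  proof (rule bdd_belowI2)
    fix y assume "y \<in> F"
    have "p y \<le> p (x + y) + p (- x)"
      using sublinear_add[OF p, of "x + y" "- x"] by simp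
    then show "- p (- x) \<le> p (x + y) - f y"
      using fp[OF \<open>y \<in> F\<close>] by simp
  qed
  have lower: "q x \<le> p (x + y) - f y" if "y \<in> F" for x y
    unfolding q_def by (rule cINF_lower[OF bdd that])
  have greatest: "m \<le> q x" if "\<And>y. y \<in> F \<Longrightarrow> m \<le> p (x + y) - f y" for m x
    unfolding q_def by (rule cINF_greatest) (use F(1) that in auto)
  have "q (x + y) \<le> q x + q y" for x y
  proof -
    have "q (x + y) - (p (y + v) - f v) \<le> p (x + u) - f u" if "u \<in> F" "v \<in> F" for u v
    proof -
      have "q (x + y) \<le> p (x + y + (u + v)) - f (u + v)"
        by (intro lower F that)
      moreover have "p (x + y + (u + v)) \<le> p (x + u) + p (y + v)"
        using sublinear_add[OF p, of "x + u" "y + v"] by (simp add: algebra_simps)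
      ultimately show ?thesis
        using f(1)[OF that] by simp
    qed
    then have "q (x + y) - (p (y + v) - f v) \<le> q x" if "v \<in> F" for v
      using that by (intro greatest)
    then have "q (x + y) - q x \<le> q y"
      by (intro greatest) (simp add: algebra_simps)
    then show ?thesis by simp
  qed
  moreover have "q (r *\<^sub>R x) = r * q x" if r: "0 \<le> r" for r x
  proof (rule positively_homogeneousI[OF _ _ r])
    have "q 0 \<le> 0"
      using lower[OF F(1), of 0] f0 sublinear_zero[OF p] by simp
    moreover have "0 \<le> q 0"
      by (rule greatest) (simp add: fp)
    ultimately show "q 0 = 0"
      by simp
  next
    fix s :: real and z assume s: "0 < s"
    have "q (s *\<^sub>R z) / s \<le> q z"
    proof (rule greatest)
      fix y assume "y \<in> F"
      have "q (s *\<^sub>R z) \<le> p (s *\<^sub>R z + s *\<^sub>R y) - f (s *\<^sub>R y)"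
        using s \<open>y \<in> F\<close> by (intro lower F) auto
      also have "\<dots> = s * (p (z + y) - f y)"
        using s \<open>y \<in> F\<close> by (simp add: f sublinear_scaleR[OF p] right_diff_distrib flip: scaleR_add_right)
      finally show "q (s *\<^sub>R z) / s \<le> p (z + y) - f y"
        using s by (simp add: field_simps)
    qed
    then show "q (s *\<^sub>R z) \<le> s * q z"
      using s by (simp add: field_simps)
  qed
  ultimately have "sublinear q"
    by (simp add: sublinear_def)
  moreover have "q x \<le> p x" for x
    using lower[OF F(1), of x] f0 by simp
  moreover have "q (- y) \<le> - f y" if "y \<in> F" for y
    using lower[OF that, of "- y"] sublinear_zero[OF p] by simp
  moreover have "\<exists>y\<in>F. p (x + y) - f y < t" if "q x < t" for x t
    using greatest[of t x] that by (meson not_le)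
  ultimately show thesis
    using that by blast
qed

text \<open>Every sublinear functional below \<open>p\<close> stays above \<open>- p (- x)\<close>,
  so infima over chains are finite. They are subadditive because two members of a chain can both be
  replaced by the smaller one.\<close>

lemma minimal_sublinear:
  fixes p :: "'v::real_vector \<Rightarrow> real"
  assumes p: "sublinear p"
  obtains q where "sublinear q" "q \<le> p" "\<And>q'. sublinear q' \<Longrightarrow> q' \<le> q \<Longrightarrow> q' = q"
proof -
  let ?S = "{q. sublinear q \<and> q \<le> p}"
  \<comment> \<open>\<open>predicate_Zorn\<close> yields maximal elements, hence the reversed
    order.\<close>
  let ?P = "\<lambda>a u :: 'v \<Rightarrow> real. u \<le> a"
  have "\<exists>m\<in>?S. \<forall>a\<in>?S. ?P m a \<longrightarrow> a = m"
  proof (rule predicate_Zorn)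
    show "partial_order_on ?S (relation_of ?P ?S)"
      by (auto simp: partial_order_on_def preorder_on_def refl_on_def trans_def antisym_def relation_of_def)
    fix C assume "C \<in> Chains (relation_of ?P ?S)"
    then have CS: "C \<subseteq> ?S" and chain: "\<And>a b. a \<in> C \<Longrightarrow> b \<in> C \<Longrightarrow> a \<le> b \<or> b \<le> a"
      by (auto simp: Chains_def relation_of_def)
    show "\<exists>u\<in>?S. \<forall>a\<in>C. u \<le> a"
    proof (cases "C = {}")
      case True
      then show ?thesis using p by auto
    next
      case False
      define u where "u x = (INF q\<in>C. q x)" for x
      have C: "sublinear q" "q x \<le> p x" if "q \<in> C" for q x
        using CS that by (auto simp: le_fun_def)
      have "- p (- x) \<le> q x" if "q \<in> C" for q x
        using sublinear_minus[OF C(1)[OF that], of x] C(2)[OF that, of "- x"] by simp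
      then have bdd: "bdd_below ((\<lambda>q. q x) ` C)" for x
        by (rule bdd_belowI2)
      have lower: "u x \<le> q x" if "q \<in> C" for q x
        unfolding u_def by (rule cINF_lower[OF bdd that])
      have greatest: "m \<le> u x" if "\<And>q. q \<in> C \<Longrightarrow> m \<le> q x" for m x
        unfolding u_def by (rule cINF_greatest[OF False that])
      have "u (x + y) \<le> u x + u y" for x y
      proof -
        have "u (x + y) \<le> q x + q' y" if q: "q \<in> C" "q' \<in> C" for q q'
        proof -
          obtain r where r: "r \<in> C" "r \<le> q" "r \<le> q'"
            using chain[OF q] q by blast
          have "u (x + y) \<le> r x + r y"
            using lower[OF r(1), of "x + y"] sublinear_add[OF C(1)[OF r(1)], of x y] by simp
          also have "\<dots> \<le> q x + q' y"
            using r by (simp add: le_fun_def add_mono)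
          finally show ?thesis .
        qed
        then have "u (x + y) - q' y \<le> u x" if "q' \<in> C" for q'
          using that by (intro greatest) (simp add: algebra_simps)
        then have "u (x + y) - u x \<le> u y"
          by (intro greatest) (simp add: algebra_simps)
        then show ?thesis by simp
      qed
      moreover have "u (r *\<^sub>R x) = r * u x" if r: "0 \<le> r" for r x
      proof (rule positively_homogeneousI[OF _ _ r])
        have "(\<lambda>q. q 0) ` C = {0}"
          using False sublinear_zero[OF C(1)] by force
        then show "u 0 = 0"
          by (simp add: u_def)
      next
        fix s :: real and z assume s: "0 < s"
        have "u (s *\<^sub>R z) / s \<le> u z"
        proof (rule greatest)
          fix q assume "q \<in> C"
          then show "u (s *\<^sub>R z) / s \<le> q z"
            using lower[of q "s *\<^sub>R z"] sublinear_scaleR[OF C(1), of q s z] s by (simp add: field_simps)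
        qed
        then show "u (s *\<^sub>R z) \<le> s * u z"
          using s by (simp add: field_simps)
      qed
      ultimately have "sublinear u"
        by (simp add: sublinear_def)
      moreover obtain q where "q \<in> C"
        using False by blast
      then have "u x \<le> p x" for x
        using lower[of q x] C(2)[of q x] by simp
      then have "u \<le> p"
        by (simp add: le_fun_def)
      ultimately show ?thesis
        using lower by (auto simp: le_fun_def)
    qed
  qed
  then obtain q where q: "sublinear q" "q \<le> p" "\<forall>a\<in>?S. a \<le> q \<longrightarrow> a = q"
    by blast
  then have "q' = q" if "sublinear q'" "q' \<le> q" for q'
    using that order_trans by blast
  with q show thesis
    using that by blast
qed

definition ray :: "'v::real_vector \<Rightarrow> 'v set" where
  "ray v = {s *\<^sub>R v | s. 0 \<le> s}"

lemma ray_cone: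
  "0 \<in> ray v" "x \<in> ray v \<Longrightarrow> y \<in> ray v \<Longrightarrow> x + y \<in> ray v"
  "0 \<le> r \<Longrightarrow> x \<in> ray v \<Longrightarrow> r *\<^sub>R x \<in> ray v"
proof -
  show "0 \<in> ray v"
    unfolding ray_def by (rule CollectI, rule exI[of _ 0]) simp
  show "x \<in> ray v \<Longrightarrow> y \<in> ray v \<Longrightarrow> x + y \<in> ray v"
    unfolding ray_def by (auto simp flip: scaleR_add_left)
  show "0 \<le> r \<Longrightarrow> x \<in> ray v \<Longrightarrow> r *\<^sub>R x \<in> ray v"
    unfolding ray_def by (clarsimp, metis mult_nonneg_nonneg)
qed

lemma self_in_ray: "v \<in> ray v"
  unfolding ray_def by (rule CollectI, rule exI[of _ 1]) simp

text \<open>Being additive along a ray, a sublinear functional can itself serve as the superadditive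
  datum \<open>f\<close> on that ray.\<close>

lemma sublinear_additive_ray:
  assumes "sublinear q" "x \<in> ray v" "y \<in> ray v"
  shows "q x + q y \<le> q (x + y)"
  using assms by (auto simp: ray_def sublinear_scaleR[OF assms(1)] distrib_right simp flip: scaleR_add_left)

text \<open>A minimal sublinear functional is odd: its modification along the ray of
  \<open>a\<close> lies below it, hence equals it. Odd and sublinear functionals are linear.
  Domination on a cone covers both a supporting functional along a ray and an extension from a
  subspace, where the inequalities at \<open>y\<close> and \<open>- y\<close> combine to an
  equality.\<close>

theorem hahn_banach:
  fixes p f :: "'v::real_vector \<Rightarrow> real"
  assumes p: "sublinear p"
    and F: "0 \<in> F" "\<And>x y. x \<in> F \<Longrightarrow> y \<in> F \<Longrightarrow> x + y \<in> F" "\<And>r x. 0 \<le> r \<Longrightarrow> x \<in> F \<Longrightarrow> r *\<^sub>R x \<in> F"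
    and f: "\<And>x y. x \<in> F \<Longrightarrow> y \<in> F \<Longrightarrow> f x + f y \<le> f (x + y)"
      "\<And>r x. 0 \<le> r \<Longrightarrow> x \<in> F \<Longrightarrow> f (r *\<^sub>R x) = r * f x"
    and fp: "\<And>x. x \<in> F \<Longrightarrow> f x \<le> p x"
  obtains g where "linear g" "\<And>x. g x \<le> p x" "\<And>y. y \<in> F \<Longrightarrow> f y \<le> g y"
proof -
  obtain q0 where q0: "sublinear q0" "\<And>x. q0 x \<le> p x" "\<And>y. y \<in> F \<Longrightarrow> q0 (- y) \<le> - f y"
    by (rule sublinear_below_cone[of p F f]) (auto intro: assms that)
  obtain q where q: "sublinear q" "q \<le> q0" "\<And>q'. sublinear q' \<Longrightarrow> q' \<le> q \<Longrightarrow> q' = q"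
    using minimal_sublinear[OF q0(1)] by blast
  have odd: "q (- a) = - q a" for a
  proof -
    obtain q' where q': "sublinear q'" "\<And>x. q' x \<le> q x" "\<And>y. y \<in> ray a \<Longrightarrow> q' (- y) \<le> - q y"
      by (rule sublinear_below_cone[of q "ray a" q])
        (auto intro: q(1) ray_cone sublinear_additive_ray sublinear_scaleR that)
    have "q' = q"
      by (rule q(3)[OF q'(1)]) (use q'(2) in \<open>simp add: le_fun_def\<close>)
    with q'(3)[OF self_in_ray] have "q (- a) \<le> - q a"
      by simp
    then show ?thesis
      using sublinear_minus[OF q(1), of a] by simp
  qed
  have "linear q"
  proof
    show "q (x + y) = q x + q y" for x y
      using sublinear_add[OF q(1), of "x + y" "- y"] sublinear_add[OF q(1), of x y] odd[of y] by simp
    show "q (r *\<^sub>R x) = r *\<^sub>R q x" for r x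
    proof (cases "0 \<le> r")
      case True
      then show ?thesis
        by (simp add: sublinear_scaleR[OF q(1)])
    next
      case False
      then have "q ((- r) *\<^sub>R x) = (- r) * q x"
        by (intro sublinear_scaleR[OF q(1)]) simp
      then show ?thesis
        using odd[of "(- r) *\<^sub>R x"] by simp
    qed
  qed
  moreover have "q x \<le> p x" for x
    using order_trans[OF le_funD[OF q(2)] q0(2)] .
  moreover have "f y \<le> q y" if "y \<in> F" for y
    using q0(3)[OF that] q(2) odd[of y] by (simp add: le_fun_def) (metis neg_le_iff_le order_trans)
  ultimately show thesis
    using that by blast
qed

section \<open>States\<close>

context unital_cstar_algebra
begin

lemma selfadjoint_carrier: "a \<in> self_adjoint A \<Longrightarrow> a \<in> carrier A"
  by (simp add: self_adjoint_def)

lemma self_adjoint_add: "a \<in> self_adjoint A \<Longrightarrow> b \<in> self_adjoint A \<Longrightarrow> a \<oplus> b \<in> self_adjoint A"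
  by (simp add: self_adjoint_def adj_add a_closed)

lemma self_adjoint_smult: "a \<in> self_adjoint A \<Longrightarrow> complex_of_real r \<odot> a \<in> self_adjoint A"
  by (simp add: self_adjoint_def adj_smult)

lemma self_adjoint_minus: "a \<in> self_adjoint A \<Longrightarrow> b \<in> self_adjoint A \<Longrightarrow> a \<ominus> b \<in> self_adjoint A"
  by (simp add: self_adjoint_def adj_minus minus_closed)

lemma self_adjoint_one: "\<one> \<in> self_adjoint A"
  by (simp add: self_adjoint_def one_closed)

lemma self_adjoint_zero: "\<zero> \<in> self_adjoint A"
  by (simp add: self_adjoint_def zero_closed)

lemma self_adjoint_adj_mult: "x \<in> carrier A \<Longrightarrow> adj A x \<otimes> x \<in> self_adjoint A"
  by (simp add: self_adjoint_def adj_mult adj_adj m_closed)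

lemma add_swap:
  assumes "x \<in> carrier A" "y \<in> carrier A" "z \<in> carrier A" "w \<in> carrier A"
  shows "(x \<oplus> y) \<oplus> (z \<oplus> w) = (x \<oplus> z) \<oplus> (y \<oplus> w)"
  using assms by (simp add: a_assoc a_lcomm[of y z w] a_closed)

definition re_part :: "'a \<Rightarrow> 'a" where
  "re_part x = (1 / 2) \<odot> x \<oplus> (1 / 2) \<odot> adj A x"

definition im_part :: "'a \<Rightarrow> 'a" where
  "im_part x = (- \<i> / 2) \<odot> x \<oplus> (\<i> / 2) \<odot> adj A x"

lemma re_part_sa: "x \<in> carrier A \<Longrightarrow> re_part x \<in> self_adjoint A"
  by (simp add: re_part_def self_adjoint_def adj_add adj_smult adj_adj a_closed a_comm)

lemma im_part_sa: "x \<in> carrier A \<Longrightarrow> im_part x \<in> self_adjoint A"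
  by (simp add: im_part_def self_adjoint_def adj_add adj_smult adj_adj a_closed a_comm)

lemma re_im_decomp:
  assumes "x \<in> carrier A"
  shows "x = re_part x \<oplus> \<i> \<odot> im_part x"
proof -
  have "re_part x \<oplus> \<i> \<odot> im_part x
      = ((1 / 2) \<odot> x \<oplus> (1 / 2) \<odot> x) \<oplus> ((1 / 2) \<odot> adj A x \<oplus> (- 1 / 2) \<odot> adj A x)"
    using assms by (simp add: re_part_def im_part_def smult_add_right smult_smult add_swap)
  also have "\<dots> = (1 / 2 + 1 / 2) \<odot> x \<oplus> (1 / 2 + - 1 / 2) \<odot> adj A x"
    using assms by (simp only: smult_add_left adj_closed')
  also have "\<dots> = x"
    using assms by (simp add: r_zero)
  finally show ?thesis by simp
qed

lemma
  assumes "h \<in> self_adjoint A" "k \<in> self_adjoint A"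
  shows re_part_decomp: "re_part (h \<oplus> \<i> \<odot> k) = h"
    and im_part_decomp: "im_part (h \<oplus> \<i> \<odot> k) = k"
proof -
  have hk: "h \<in> carrier A" "k \<in> carrier A" "adj A h = h" "adj A k = k"
    using assms by (auto simp: self_adjoint_def)
  have "re_part (h \<oplus> \<i> \<odot> k) = ((1 / 2) \<odot> h \<oplus> (1 / 2) \<odot> h) \<oplus> ((\<i> / 2) \<odot> k \<oplus> (- \<i> / 2) \<odot> k)"
    using hk by (simp add: re_part_def smult_add_right smult_smult add_swap adj_add adj_smult)
  also have "\<dots> = (1 / 2 + 1 / 2) \<odot> h \<oplus> (\<i> / 2 + - \<i> / 2) \<odot> k"
    using hk by (simp only: smult_add_left)
  finally show "re_part (h \<oplus> \<i> \<odot> k) = h"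
    using hk by (simp add: r_zero)
  have "im_part (h \<oplus> \<i> \<odot> k) = ((- \<i> / 2) \<odot> h \<oplus> (\<i> / 2) \<odot> h) \<oplus> ((1 / 2) \<odot> k \<oplus> (1 / 2) \<odot> k)"
    using hk by (simp add: im_part_def smult_add_right smult_smult add_swap adj_add adj_smult)
  also have "\<dots> = (- \<i> / 2 + \<i> / 2) \<odot> h \<oplus> (1 / 2 + 1 / 2) \<odot> k"
    using hk by (simp only: smult_add_left)
  finally show "im_part (h \<oplus> \<i> \<odot> k) = k"
    using hk by (simp add: l_zero)
qed

lemma cnorm_re_part: "x \<in> carrier A \<Longrightarrow> cnorm A (re_part x) \<le> cnorm A x"
  using cnorm_triangle[of "(1 / 2) \<odot> x" "(1 / 2) \<odot> adj A x"]
  by (simp add: re_part_def cnorm_smult cnorm_adj)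

lemma cnorm_im_part: "x \<in> carrier A \<Longrightarrow> cnorm A (im_part x) \<le> cnorm A x"
  using cnorm_triangle[of "(- \<i> / 2) \<odot> x" "(\<i> / 2) \<odot> adj A x"]
  by (simp add: im_part_def cnorm_smult cnorm_adj norm_divide)

text \<open>A functional of norm 1 attaining its norm at the unit is positive.\<close>

lemma state_of_real_functional:
  assumes add: "\<And>a b. a \<in> self_adjoint A \<Longrightarrow> b \<in> self_adjoint A \<Longrightarrow> g (a \<oplus> b) = g a + g b"
    and smult: "\<And>r a. a \<in> self_adjoint A \<Longrightarrow> g (complex_of_real r \<odot> a) = r * g a"
    and le: "\<And>a. a \<in> self_adjoint A \<Longrightarrow> g a \<le> cnorm A a"
    and one: "g \<one> = 1"
  obtains \<phi> where "\<phi> \<in> states A" "\<And>a. a \<in> self_adjoint A \<Longrightarrow> \<phi> a = complex_of_real (g a)"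
proof -
  \<comment> \<open>The complexification of \<open>g\<close>. Its linearity is checked on
    decompositions \<open>h \<oplus> \<i> \<odot> k\<close> into self-adjoint parts.\<close>
  define \<phi> where "\<phi> = (\<lambda>x\<in>carrier A. Complex (g (re_part x)) (g (im_part x)))"
  have g0: "g \<zero> = 0"
    using smult[of \<zero> 0] self_adjoint_zero by simp
  have \<phi>: "\<phi> (h \<oplus> \<i> \<odot> k) = Complex (g h) (g k)" if "h \<in> self_adjoint A" "k \<in> self_adjoint A" for h k
    using that selfadjoint_carrier by (simp add: \<phi>_def re_part_decomp im_part_decomp a_closed)
  have \<phi>sa: "\<phi> a = complex_of_real (g a)" if "a \<in> self_adjoint A" for a
    using \<phi>[OF that self_adjoint_zero] selfadjoint_carrier[OF that]
    by (simp add: r_zero g0 complex_of_real_def)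
  have dec: "\<exists>h\<in>self_adjoint A. \<exists>k\<in>self_adjoint A. x = h \<oplus> \<i> \<odot> k" if "x \<in> carrier A" for x
    using re_im_decomp re_part_sa im_part_sa that by blast
  have "\<phi> \<in> states A"
    unfolding states_def mem_Collect_eq
  proof (intro conjI ballI allI)
    show "\<phi> \<in> extensional (carrier A)"
      by (simp add: \<phi>_def)
    show "\<phi> \<one> = 1"
      using \<phi>sa[OF self_adjoint_one] one by simp
  next
    fix x y assume "x \<in> carrier A" "y \<in> carrier A"
    then obtain h k h' k' where *: "h \<in> self_adjoint A" "k \<in> self_adjoint A" "x = h \<oplus> \<i> \<odot> k"
      "h' \<in> self_adjoint A" "k' \<in> self_adjoint A" "y = h' \<oplus> \<i> \<odot> k'"
      using dec by meson
    note c = *(1,2,4,5)[THEN selfadjoint_carrier]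
    have "x \<oplus> y = (h \<oplus> h') \<oplus> \<i> \<odot> (k \<oplus> k')"
      using * c by (simp add: add_swap smult_add_right)
    then show "\<phi> (x \<oplus> y) = \<phi> x + \<phi> y"
      using * by (simp add: \<phi> self_adjoint_add add complex_eq_iff)
  next
    fix c x assume "x \<in> carrier A"
    then obtain h k where *: "h \<in> self_adjoint A" "k \<in> self_adjoint A" "x = h \<oplus> \<i> \<odot> k"
      using dec by meson
    note hk = *(1,2)[THEN selfadjoint_carrier]
    let ?a = "complex_of_real (Re c)" and ?b = "complex_of_real (Im c)"
    have c: "c = ?a + \<i> * ?b"
      by (simp add: complex_eq_iff)
    have "c \<odot> x = (?a \<odot> h \<oplus> (\<i> * ?b) \<odot> h) \<oplus> ((\<i> * ?a) \<odot> k \<oplus> complex_of_real (- Im c) \<odot> k)"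
    proof -
      have "c * \<i> = \<i> * ?a + complex_of_real (- Im c)"
        by (simp add: complex_eq_iff)
      then have "c \<odot> (\<i> \<odot> k) = (\<i> * ?a) \<odot> k \<oplus> complex_of_real (- Im c) \<odot> k"
        using hk by (simp only: smult_smult smult_add_left)
      moreover have "c \<odot> h = ?a \<odot> h \<oplus> (\<i> * ?b) \<odot> h"
        using hk by (subst c) (simp only: smult_add_left)
      ultimately show ?thesis
        using * hk by (simp add: smult_add_right)
    qed
    also have "\<dots> = (?a \<odot> h \<oplus> complex_of_real (- Im c) \<odot> k) \<oplus> ((\<i> * ?b) \<odot> h \<oplus> (\<i> * ?a) \<odot> k)"
      using hk a_comm[of "(\<i> * ?a) \<odot> k" "complex_of_real (- Im c) \<odot> k"]
      by (metis add_swap smult_in)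
    also have "(\<i> * ?b) \<odot> h \<oplus> (\<i> * ?a) \<odot> k = \<i> \<odot> (?b \<odot> h \<oplus> ?a \<odot> k)"
      using hk by (simp add: smult_add_right smult_smult)
    finally have "\<phi> (c \<odot> x) = Complex (g (?a \<odot> h \<oplus> complex_of_real (- Im c) \<odot> k)) (g (?b \<odot> h \<oplus> ?a \<odot> k))"
      using * by (simp only: \<phi> self_adjoint_add self_adjoint_smult)
    also have "\<dots> = Complex (Re c * g h - Im c * g k) (Im c * g h + Re c * g k)"
      using * smult[of k "- Im c"] by (simp add: add smult self_adjoint_smult del: of_real_minus)
    also have "\<dots> = c * \<phi> x"
      using * by (simp add: \<phi> complex_eq_iff)
    finally show "\<phi> (c \<odot> x) = c * \<phi> x" .
  next
    fix x assume x: "x \<in> carrier A"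
    obtain t where t: "cnorm A (complex_of_real t \<odot> \<one> \<ominus> adj A x \<otimes> x) \<le> t"
      using adj_mult_positive[OF x] .
    have sa: "adj A x \<otimes> x \<in> self_adjoint A"
      by (rule self_adjoint_adj_mult[OF x])
    \<comment> \<open>Applying \<open>g\<close> to this sum gives \<open>t\<close>. The first
      summand contributes at most its norm, hence at most \<open>t\<close>, so the value on the
      second is nonnegative.\<close>
    have "complex_of_real t \<odot> \<one> = (complex_of_real t \<odot> \<one> \<ominus> adj A x \<otimes> x) \<oplus> adj A x \<otimes> x"
      using sa selfadjoint_carrier by (simp add: minus_add_self one_closed)
    then have "t = g (complex_of_real t \<odot> \<one> \<ominus> adj A x \<otimes> x) + g (adj A x \<otimes> x)"
      using sa smult[OF self_adjoint_one, of t] one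
      by (metis add mult_1_right self_adjoint_minus self_adjoint_one self_adjoint_smult)
    moreover have "g (complex_of_real t \<odot> \<one> \<ominus> adj A x \<otimes> x) \<le> t"
      using t le[OF self_adjoint_minus[OF self_adjoint_smult[OF self_adjoint_one] sa]] order_trans by blast
    ultimately show "\<phi> (adj A x \<otimes> x) \<in> \<real>\<^sub>\<ge>\<^sub>0"
      by (simp add: \<phi>sa[OF sa])
  qed
  with \<phi>sa show thesis
    using that by blast
qed

section \<open>Bounds for states and existence of norming states\<close>

lemma state_add: "\<phi> \<in> states A \<Longrightarrow> x \<in> carrier A \<Longrightarrow> y \<in> carrier A \<Longrightarrow> \<phi> (x \<oplus> y) = \<phi> x + \<phi> y"
  and state_smult: "\<phi> \<in> states A \<Longrightarrow> x \<in> carrier A \<Longrightarrow> \<phi> (c \<odot> x) = c * \<phi> x"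
  and state_one: "\<phi> \<in> states A \<Longrightarrow> \<phi> \<one> = 1"
  and state_positive: "\<phi> \<in> states A \<Longrightarrow> x \<in> carrier A \<Longrightarrow> \<phi> (adj A x \<otimes> x) \<in> \<real>\<^sub>\<ge>\<^sub>0"
  by (auto simp: states_def)

lemma state_minus: "\<phi> \<in> states A \<Longrightarrow> x \<in> carrier A \<Longrightarrow> y \<in> carrier A \<Longrightarrow> \<phi> (x \<ominus> y) = \<phi> x - \<phi> y"
  by (simp add: minus_eq_smult state_add state_smult)

text \<open>By \<open>sqrt_shift\<close> the norm of \<open>a\<close> times the unit, minus
  \<open>a\<close>, has the form \<open>adj A y \<otimes> y\<close>. A nonnegative real value there
  yields reality and the upper bound at once.\<close>

lemma state_sa:
  assumes \<phi>: "\<phi> \<in> states A" and a: "a \<in> self_adjoint A"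
  shows "Im (\<phi> a) = 0" "Re (\<phi> a) \<le> cnorm A a"
proof -
  have ca: "a \<in> carrier A"
    using a by (rule selfadjoint_carrier)
  obtain y where y: "y \<in> self_adjoint A" "y \<otimes> y = complex_of_real (cnorm A a) \<odot> \<one> \<ominus> a"
    using sqrt_shift[OF a order_refl] .
  have "\<phi> (adj A y \<otimes> y) \<in> \<real>\<^sub>\<ge>\<^sub>0"
    using y selfadjoint_carrier by (intro state_positive[OF \<phi>]) auto
  then have "complex_of_real (cnorm A a) - \<phi> a \<in> \<real>\<^sub>\<ge>\<^sub>0"
    using y ca by (simp add: self_adjoint_def state_minus[OF \<phi>] state_smult[OF \<phi>] state_one[OF \<phi>] one_closed)
  then show "Im (\<phi> a) = 0" "Re (\<phi> a) \<le> cnorm A a"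
    by (auto simp: complex_nonneg_Reals_iff)
qed

lemma state_sa_of_real: "\<phi> \<in> states A \<Longrightarrow> a \<in> self_adjoint A \<Longrightarrow> \<phi> a = complex_of_real (Re (\<phi> a))"
  using state_sa(1) by (simp add: complex_eq_iff)

lemma state_sa_bound:
  assumes \<phi>: "\<phi> \<in> states A" and a: "a \<in> self_adjoint A"
  shows "cmod (\<phi> a) \<le> cnorm A a"
proof -
  have "Re (\<phi> (complex_of_real (- 1) \<odot> a)) \<le> cnorm A (complex_of_real (- 1) \<odot> a)"
    by (intro state_sa(2)[OF \<phi>] self_adjoint_smult a)
  then have "- Re (\<phi> a) \<le> cnorm A a"
    using selfadjoint_carrier[OF a] by (simp add: state_smult[OF \<phi>] cnorm_smult)
  then have "\<bar>Re (\<phi> a)\<bar> \<le> cnorm A a"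
    using state_sa(2)[OF \<phi> a] by simp
  then show ?thesis
    by (subst state_sa_of_real[OF \<phi> a]) simp
qed

text \<open>Splitting into real and imaginary parts costs the factor 2, which is harmless: the bound
  only encloses the states in a product of discs.\<close>

lemma state_bound:
  assumes \<phi>: "\<phi> \<in> states A" and x: "x \<in> carrier A"
  shows "cmod (\<phi> x) \<le> 2 * cnorm A x"
proof -
  note c = selfadjoint_carrier[OF re_part_sa[OF x]] selfadjoint_carrier[OF im_part_sa[OF x]]
  have "\<phi> x = \<phi> (re_part x) + \<i> * \<phi> (im_part x)"
    by (subst re_im_decomp[OF x]) (simp add: state_add[OF \<phi>] state_smult[OF \<phi>] c)
  then have "cmod (\<phi> x) \<le> cmod (\<phi> (re_part x)) + cmod (\<phi> (im_part x))"
    using norm_triangle_ineq[of "\<phi> (re_part x)" "\<i> * \<phi> (im_part x)"] by (simp add: norm_mult)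
  also have "\<dots> \<le> cnorm A x + cnorm A x"
    using state_sa_bound[OF \<phi> re_part_sa[OF x]] state_sa_bound[OF \<phi> im_part_sa[OF x]]
      cnorm_re_part[OF x] cnorm_im_part[OF x] by (intro add_mono) auto
  finally show ?thesis by simp
qed

lemma states_eqI:
  assumes \<phi>: "\<phi> \<in> states A" and \<psi>: "\<psi> \<in> states A" and eq: "\<And>a. a \<in> self_adjoint A \<Longrightarrow> \<phi> a = \<psi> a"
  shows "\<phi> = \<psi>"
proof (rule extensionalityI)
  show "\<phi> \<in> extensional (carrier A)" "\<psi> \<in> extensional (carrier A)"
    using \<phi> \<psi> by (auto simp: states_def)
  fix x assume x: "x \<in> carrier A"
  note c = selfadjoint_carrier[OF re_part_sa[OF x]] selfadjoint_carrier[OF im_part_sa[OF x]]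
  show "\<phi> x = \<psi> x"
    by (subst (1 2) re_im_decomp[OF x])
      (simp add: state_add[OF \<phi>] state_smult[OF \<phi>] state_add[OF \<psi>] state_smult[OF \<psi>] c eq
        re_part_sa[OF x] im_part_sa[OF x])
qed

text \<open>Hahn-Banach functionals live on the product algebra; pulled back along
  \<open>lift\<close> and complexified they become states of \<open>A\<close>.\<close>

lemma state_of_lift_functional:
  assumes g: "linear g" "\<And>X. g X \<le> norm X" "g (lift A \<one>) = 1"
  obtains \<phi> where "\<phi> \<in> states A" "\<And>a. a \<in> self_adjoint A \<Longrightarrow> \<phi> a = complex_of_real (g (lift A a))"
proof (rule state_of_real_functional[of "\<lambda>a. g (lift A a)"])
  show "g (lift A (a \<oplus> b)) = g (lift A a) + g (lift A b)" if "a \<in> self_adjoint A" "b \<in> self_adjoint A" for a b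
    using that by (simp add: lift_add selfadjoint_carrier linear_add[OF g(1)])
  show "g (lift A (complex_of_real r \<odot> a)) = r * g (lift A a)" if "a \<in> self_adjoint A" for r a
    using that by (simp add: lift_smult selfadjoint_carrier linear_scale[OF g(1)])
  show "g (lift A a) \<le> cnorm A a" if "a \<in> self_adjoint A" for a
    using g(2)[of "lift A a"] that by (simp add: norm_lift selfadjoint_carrier)
  show "g (lift A \<one>) = 1"
    by (rule g(3))
qed (rule that)

lemma lift_zero: "lift A \<zero> = 0"
  using lift_smult[of \<zero> 0] by (simp add: zero_closed)

text \<open>The functional \<open>q\<close> is the largest sublinear one below the norm with
  \<open>q (- y) \<le> - norm y\<close> along the ray of the unit, so linear functionals below it
  give states. Some state reaches its larger value at \<open>a\<close> or \<open>- a\<close>. The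
  near-minimizers in its definition are multiples of the unit and provide the hypotheses of
  \<open>cnorm_le_of_order_bound\<close>, the origin of the factor 3.\<close>

lemma norming_state:
  assumes a: "a \<in> self_adjoint A"
  obtains \<phi> where "\<phi> \<in> states A" "cnorm A a \<le> 3 * cmod (\<phi> a)"
proof -
  let ?e = "lift A \<one>" and ?a = "lift A a"
  have ca: "a \<in> carrier A"
    using a by (rule selfadjoint_carrier)
  have ne: "norm ?e = 1"
    by (simp add: norm_lift one_closed)
  have norm_ray: "norm x + norm y \<le> norm (x + y)" if "x \<in> ray ?e" "y \<in> ray ?e" for x y
    using that by (rule sublinear_additive_ray[OF sublinear_norm])
  obtain q where q: "sublinear q" "\<And>x. q x \<le> norm x" "\<And>y. y \<in> ray ?e \<Longrightarrow> q (- y) \<le> - norm y"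
    "\<And>x t. q x < t \<Longrightarrow> \<exists>y\<in>ray ?e. norm (x + y) - norm y < t"
    by (rule sublinear_below_cone[OF sublinear_norm, of "ray ?e" norm])
      (auto intro: ray_cone norm_ray that)
  have qe: "q (- ?e) \<le> - 1"
    using q(3)[OF self_in_ray] ne by simp
  \<comment> \<open>Hahn-Banach along the ray of \<open>X\<close> forces
    \<open>q X \<le> g X\<close>, and the values of \<open>q\<close> at the unit and its negative
    force \<open>g ?e = 1\<close>.\<close>
  have state: "\<exists>\<phi>\<in>states A. \<forall>b\<in>self_adjoint A. lift A b = X \<longrightarrow> q X \<le> Re (\<phi> b)" for X
  proof -
    obtain g where g: "linear g" "\<And>x. g x \<le> q x" "\<And>y. y \<in> ray X \<Longrightarrow> q y \<le> g y"
      by (rule hahn_banach[of q "ray X" q])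
        (auto intro: q(1) ray_cone sublinear_additive_ray sublinear_scaleR that)
    have "g ?e \<le> 1"
      using g(2)[of ?e] q(2)[of ?e] ne by simp
    moreover have "- g ?e \<le> - 1"
      using g(2)[of "- ?e"] qe linear_neg[OF g(1), of ?e] by simp
    ultimately have "g ?e = 1" by simp
    moreover have "g x \<le> norm x" for x
      using g(2) q(2) order_trans by blast
    ultimately obtain \<phi> where "\<phi> \<in> states A" "\<And>b. b \<in> self_adjoint A \<Longrightarrow> \<phi> b = complex_of_real (g (lift A b))"
      using state_of_lift_functional[OF g(1)] by blast
    then show ?thesis
      using g(3)[OF self_in_ray] by (intro bexI[of _ \<phi>]) auto
  qed
  define m where "m = max (q ?a) (q (- ?a))"
  have m0: "0 \<le> m"
    using sublinear_minus[OF q(1), of ?a] by (auto simp: m_def max_def)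
  have shift: "\<exists>s\<ge>0. cnorm A (complex_of_real s \<odot> \<one> \<oplus> complex_of_real c \<odot> a) \<le> s + t"
    if qt: "q (c *\<^sub>R ?a) < t" for c t
  proof -
    obtain y where "y \<in> ray ?e" "norm (c *\<^sub>R ?a + y) - norm y < t"
      using q(4)[OF qt] by blast
    then obtain s where s: "0 \<le> s" "norm (c *\<^sub>R ?a + s *\<^sub>R ?e) - norm (s *\<^sub>R ?e) < t"
      by (auto simp: ray_def)
    have "c *\<^sub>R ?a + s *\<^sub>R ?e = lift A (complex_of_real s \<odot> \<one> \<oplus> complex_of_real c \<odot> a)"
      using ca by (simp add: lift_add lift_smult one_closed add.commute)
    then have "norm (c *\<^sub>R ?a + s *\<^sub>R ?e) = cnorm A (complex_of_real s \<odot> \<one> \<oplus> complex_of_real c \<odot> a)"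
      using ca by (simp only: norm_lift a_closed smult_in one_closed)
    with s ne show ?thesis by auto
  qed
  have le: "cnorm A a \<le> 3 * t" if t: "m < t" for t
  proof -
    obtain s where s: "0 \<le> s" "cnorm A (complex_of_real s \<odot> \<one> \<oplus> complex_of_real 1 \<odot> a) \<le> s + t"
      using shift[of 1 t] t by (auto simp: m_def)
    obtain s' where s': "0 \<le> s'" "cnorm A (complex_of_real s' \<odot> \<one> \<oplus> complex_of_real (- 1) \<odot> a) \<le> s' + t"
      using shift[of "- 1" t] t by (auto simp: m_def)
    show ?thesis
      by (rule cnorm_le_of_order_bound[OF a _ s(1) s'(1)])
        (use s s' t m0 ca in \<open>simp_all add: minus_eq_smult one_closed\<close>)
  qed
  \<comment> \<open>Shifts are available only for \<open>t\<close> strictly above \<open>m\<close>,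
    so the bound at \<open>m\<close> is a limit.\<close>
  have "cnorm A a \<le> 3 * m"
  proof (rule field_le_epsilon)
    fix e :: real assume "0 < e"
    then show "cnorm A a \<le> 3 * m + e"
      using le[of "m + e / 3"] by simp
  qed
  moreover have "\<exists>\<phi>\<in>states A. m \<le> cmod (\<phi> a)"
  proof (cases "m = q ?a")
    case True
    then show ?thesis
      using state[of ?a] a abs_Re_le_cmod by (metis abs_le_D1 order_trans)
  next
    case False
    then have "m = q (- ?a)"
      by (auto simp: m_def max_def split: if_splits)
    moreover have "lift A (complex_of_real (- 1) \<odot> a) = - ?a"
      by (simp only: lift_smult ca scaleR_minus1_left)
    ultimately obtain \<phi> where \<phi>: "\<phi> \<in> states A" "m \<le> Re (\<phi> (complex_of_real (- 1) \<odot> a))"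
      using state[of "- ?a"] self_adjoint_smult[OF a] by metis
    then have "m \<le> - Re (\<phi> a)"
      using ca by (simp add: state_smult)
    with \<phi> show ?thesis
      using abs_Re_le_cmod[of "\<phi> a"] by force
  qed
  ultimately show thesis
    using that by force
qed

lemma states_nonempty: "states A \<noteq> {}"
  using norming_state[OF self_adjoint_one] by blast

end

text \<open>The real part of \<open>\<phi>\<close> is dominated by the norm on the lifted
  self-adjoint part of \<open>S\<close>, so it extends with the same bound. As the unit lies in
  \<open>S\<close>, the extension is still 1 there and \<open>state_of_lift_functional\<close>
  applies.\<close>

lemma state_extension:
  assumes A: "unital_cstar_algebra A" and B: "unital_cstar_algebra (A\<lparr>carrier := S\<rparr>)"
    and S: "S \<subseteq> carrier A" and \<phi>: "\<phi> \<in> states (A\<lparr>carrier := S\<rparr>)"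
  obtains \<psi> where "\<psi> \<in> states A" "\<And>x. x \<in> S \<Longrightarrow> \<psi> x = \<phi> x"
proof -
  interpret A: unital_cstar_algebra A by fact
  let ?B = "A\<lparr>carrier := S\<rparr>"
  interpret B: unital_cstar_algebra ?B by fact
  let ?F = "lift A ` self_adjoint ?B"
  have sub: "a \<in> self_adjoint A" "a \<in> S" "a \<in> carrier A" if "a \<in> self_adjoint ?B" for a
    using that S by (auto simp: self_adjoint_def)
  let ?f = "\<lambda>X. Re (\<phi> (coord A X))"
  have f: "?f (lift A a) = Re (\<phi> a)" if "a \<in> self_adjoint ?B" for a
    using sub[OF that] by (simp add: A.coord_lift_self)
  have add: "lift A a + lift A b = lift A (a \<oplus>\<^bsub>A\<^esub> b)" "a \<oplus>\<^bsub>A\<^esub> b \<in> self_adjoint ?B"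
    "\<phi> (a \<oplus>\<^bsub>A\<^esub> b) = \<phi> a + \<phi> b" if "a \<in> self_adjoint ?B" "b \<in> self_adjoint ?B" for a b
    using that sub B.self_adjoint_add[of a b] B.state_add[OF \<phi>, of a b] by (simp_all add: A.lift_add)
  have smult: "r *\<^sub>R lift A a = lift A (complex_of_real r \<odot>\<^bsub>A\<^esub> a)" "complex_of_real r \<odot>\<^bsub>A\<^esub> a \<in> self_adjoint ?B"
    "\<phi> (complex_of_real r \<odot>\<^bsub>A\<^esub> a) = r * \<phi> a" if "a \<in> self_adjoint ?B" for a r
    using that sub B.self_adjoint_smult[of a r] B.state_smult[OF \<phi>, of a "complex_of_real r"]
    by (simp_all add: A.lift_smult)
  have one: "\<one>\<^bsub>A\<^esub> \<in> self_adjoint ?B"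
    using B.self_adjoint_one by simp
  obtain g where g: "linear g" "\<And>x. g x \<le> norm x" "\<And>y. y \<in> ?F \<Longrightarrow> ?f y \<le> g y"
  proof (rule hahn_banach[OF sublinear_norm, of ?F ?f])
    show "0 \<in> ?F"
      using B.self_adjoint_zero A.lift_zero by (intro image_eqI[of _ _ "\<zero>\<^bsub>A\<^esub>"]) simp_all
    show "?f X \<le> norm X" if "X \<in> ?F" for X
      using that B.state_sa(2)[OF \<phi>] sub by (auto simp: f A.norm_lift)
  qed (auto simp: add smult f intro: that)
  \<comment> \<open>\<open>?F\<close> is a subspace, so domination at an element and at its negative
    gives equality.\<close>
  have eq: "g (lift A a) = Re (\<phi> a)" if a: "a \<in> self_adjoint ?B" for a
  proof -
    have "Re (\<phi> a) \<le> g (lift A a)"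
      using g(3)[of "lift A a"] f[OF a] a by simp
    moreover have "?f ((- 1) *\<^sub>R lift A a) \<le> g ((- 1) *\<^sub>R lift A a)"
      using smult[OF a, of "- 1"] by (intro g(3)) auto
    then have "- Re (\<phi> a) \<le> - g (lift A a)"
      unfolding smult(1)[OF a] linear_scale[OF g(1)] f[OF smult(2)[OF a]] smult(3)[OF a]
      using linear_scale[OF g(1), of "- 1" "lift A a"] smult(1)[OF a, of "- 1"] by simp
    ultimately show ?thesis by simp
  qed
  have "g (lift A \<one>\<^bsub>A\<^esub>) = 1"
    using eq[OF one] B.state_one[OF \<phi>] by simp
  then obtain \<psi> where \<psi>: "\<psi> \<in> states A" "\<And>a. a \<in> self_adjoint A \<Longrightarrow> \<psi> a = complex_of_real (g (lift A a))"
    using A.state_of_lift_functional[OF g(1,2)] by blast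
  have sa: "\<psi> a = \<phi> a" if "a \<in> self_adjoint ?B" for a
    using \<psi>(2)[OF sub(1)[OF that]] eq[OF that] B.state_sa_of_real[OF \<phi> that] by simp
  have "\<psi> x = \<phi> x" if x: "x \<in> S" for x
  proof -
    have xB: "x \<in> carrier ?B" using x by simp
    note sas = B.re_part_sa[OF xB] B.im_part_sa[OF xB]
    have dec: "x = B.re_part x \<oplus>\<^bsub>A\<^esub> \<i> \<odot>\<^bsub>A\<^esub> B.im_part x"
      using B.re_im_decomp[OF xB] by simp
    have "\<phi> x = \<phi> (B.re_part x) + \<i> * \<phi> (B.im_part x)"
      using B.state_add[OF \<phi>, of "B.re_part x" "\<i> \<odot>\<^bsub>A\<^esub> B.im_part x"] B.smult_in[of "B.im_part x" \<i>]
        B.state_smult[OF \<phi>, of "B.im_part x" \<i>] sub(2)[OF sas(1)] sub(2)[OF sas(2)] dec by simp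
    moreover have "\<psi> x = \<psi> (B.re_part x) + \<i> * \<psi> (B.im_part x)"
      using sub(3)[OF sas(1)] sub(3)[OF sas(2)]
      by (subst dec) (simp add: A.state_add[OF \<psi>(1)] A.state_smult[OF \<psi>(1)])
    ultimately show ?thesis
      using sa sas by simp
  qed
  with \<psi>(1) show thesis
    using that by blast
qed

section \<open>The weak* topology\<close>

lemma closedin_Collect_ball:
  assumes "\<And>i. i \<in> I \<Longrightarrow> closedin X {x \<in> topspace X. P i x}"
  shows "closedin X {x \<in> topspace X. \<forall>i\<in>I. P i x}"
proof (cases "I = {}")
  case False
  have "closedin X (\<Inter>i\<in>I. {x \<in> topspace X. P i x})"
    using False assms by (intro closedin_INT) auto
  also have "(\<Inter>i\<in>I. {x \<in> topspace X. P i x}) = {x \<in> topspace X. \<forall>i\<in>I. P i x}"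
    using False by auto
  finally show ?thesis .
qed simp

lemma closedin_Collect_conj:
  assumes "closedin X {x \<in> topspace X. P x}" "closedin X {x \<in> topspace X. Q x}"
  shows "closedin X {x \<in> topspace X. P x \<and> Q x}"
proof -
  have "{x \<in> topspace X. P x \<and> Q x} = {x \<in> topspace X. P x} \<inter> {x \<in> topspace X. Q x}"
    by auto
  then show ?thesis
    using assms by (simp add: closedin_Int)
qed

lemma closedin_Collect_eq_complex:
  assumes "continuous_map X euclidean f" "continuous_map X euclidean (g :: _ \<Rightarrow> complex)"
  shows "closedin X {x \<in> topspace X. f x = g x}"
proof -
  have "closedin X {x \<in> topspace X. f x - g x \<in> {0}}"
    by (intro closedin_continuous_map_preimage[where Y = euclidean] continuous_map_diff assms) simp
  then show ?thesis by simp
qed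

lemma continuous_map_cmult:
  "continuous_map X euclidean f \<Longrightarrow> continuous_map X euclidean (\<lambda>x. c * f x :: complex)"
  by (simp add: continuous_map_atin tendsto_mult_left)

context unital_cstar_algebra
begin

text \<open>The Banach-Alaoglu argument: by Tychonoff a product of discs is compact, and each
  condition defining a state is closed because it involves finitely many evaluations.\<close>

lemma compact_space_states: "compact_space (weak_star_topology A)"
proof -
  let ?P = "product_topology (\<lambda>_. euclidean :: complex topology) (carrier A)"
  let ?K = "\<Pi>\<^sub>E x\<in>carrier A. cball 0 (2 * cnorm A x)"
  have "compactin ?P ?K"
    by (simp add: compactin_PiE)
  moreover have "states A \<subseteq> ?K"
    proof
    fix \<phi> assume \<phi>: "\<phi> \<in> states A"
    then have "\<phi> \<in> extensional (carrier A)"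
      by (simp add: states_def)
    with state_bound[OF \<phi>] show "\<phi> \<in> ?K"
      by (simp add: PiE_iff)
  qed
  moreover have "closedin ?P (states A)"
  proof -
    note pc = continuous_map_product_projection[where X = "\<lambda>_. euclidean"]
    have top: "topspace ?P = extensional (carrier A)"
      by (simp add: PiE_def)
    have "closedin ?P {\<phi> \<in> topspace ?P.
       (\<forall>x\<in>carrier A. \<forall>y\<in>carrier A. \<phi> (x \<oplus> y) = \<phi> x + \<phi> y) \<and>
       (\<forall>c\<in>UNIV. \<forall>x\<in>carrier A. \<phi> (c \<odot> x) = c * \<phi> x) \<and>
       (\<forall>x\<in>carrier A. \<phi> (adj A x \<otimes> x) \<in> \<real>\<^sub>\<ge>\<^sub>0) \<and> \<phi> \<one> = 1}"
      by (intro closedin_Collect_conj closedin_Collect_ball closedin_Collect_eq_complex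
          continuous_map_add continuous_map_cmult pc closedin_continuous_map_preimage[where Y = euclidean])
        (auto simp: a_closed m_closed one_closed)
    then show ?thesis
      unfolding states_def by (simp only: top) simp
  qed
  ultimately have "compactin ?P (states A)"
    by (meson closed_compactin)
  then show ?thesis
    unfolding weak_star_topology_def by (rule compact_space_subtopology)
qed

lemma topspace_weak_star: "topspace (weak_star_topology A) = states A"
  by (auto simp: weak_star_topology_def states_def extensional_def)

lemma continuous_map_eval:
  assumes "x \<in> carrier A"
  shows "continuous_map (weak_star_topology A) euclidean (\<lambda>\<phi>. \<phi> x)"
  unfolding weak_star_topology_def using assms
  by (intro continuous_map_from_subtopology continuous_map_product_projection[where X = "\<lambda>_. euclidean"])

end

section \<open>Total boundedness of the Lipschitz ball\<close>

locale lip_algebra = unital_cstar_algebra A for A :: "'a cstar" (structure) +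
  fixes L :: "'a \<Rightarrow> ennreal"
  assumes metrizes: "mk_metrizes_weak_star A L"
begin

lemma mk_le:
  assumes "\<phi> \<in> states A" "\<psi> \<in> states A" "a \<in> self_adjoint A" "L a \<le> 1"
  shows "cmod (\<phi> a - \<psi> a) \<le> enn2real (mk_dist A L \<phi> \<psi>)"
proof -
  have "L a < \<infinity>"
    using assms(4) by (auto simp: top_unique less_top[symmetric])
  then have "ennreal (cmod (\<phi> a - \<psi> a)) \<le> mk_dist A L \<phi> \<psi>"
    unfolding mk_dist_def using assms by (intro SUP_upper) (auto simp: fin_dom_def)
  moreover have "mk_dist A L \<phi> \<psi> < \<infinity>"
    using metrizes assms by (auto simp: mk_metrizes_weak_star_def)
  ultimately show ?thesis
    by (metis enn2real_ennreal enn2real_mono infinity_ennreal_def norm_ge_zero)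
qed

text \<open>An element of \<open>G\<close> is encoded by its values on a finite net of states,
  normalized at \<open>\<phi>0\<close> and rounded to multiples of \<open>\<delta>\<close>; the
  Lipschitz bound leaves finitely many codes. Equal codes mean uniform closeness on all states up to
  a scalar. Representatives are chosen in \<open>G\<close> itself, so a net for the core ball
  consists of core elements.\<close>

lemma finite_net:
  assumes G: "G \<subseteq> {a \<in> self_adjoint A. L a \<le> 1}" and e: "0 < e"
  obtains F where "finite F" "F \<subseteq> G"
    "\<And>a. a \<in> G \<Longrightarrow> \<exists>f\<in>F. \<exists>r. cnorm A (a \<ominus> (f \<oplus> complex_of_real r \<odot> \<one>)) \<le> e"
proof -
  \<comment> \<open>Moving to a state of the net costs \<open>\<delta>\<close> for each of the two
    elements and rounding costs a third; \<open>norming_state\<close> multiplies the total by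
    3.\<close>
  define \<delta> where "\<delta> = e / 9"
  have \<delta>: "0 < \<delta>" using e by (simp add: \<delta>_def)
  let ?d = "\<lambda>\<phi> \<psi>. enn2real (mk_dist A L \<phi> \<psi>)"
  interpret mk: Metric_space "states A" ?d
    using metrizes by (simp add: mk_metrizes_weak_star_def)
  have "compact_space mk.mtopology"
    using metrizes compact_space_states by (simp add: mk_metrizes_weak_star_def)
  then have "mk.mtotally_bounded (states A)"
    by (intro mk.compactin_imp_mtotally_bounded) (simp add: compact_space_def)
  from this[unfolded mk.mtotally_bounded_def, rule_format, OF \<delta>] obtain \<Phi> where \<Phi>: "finite \<Phi>" "\<Phi> \<subseteq> states A" "states A \<subseteq> (\<Union>\<phi>\<in>\<Phi>. mk.mball \<phi> \<delta>)"
    by (elim exE conjE)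
  then obtain \<phi>0 where \<phi>0: "\<phi>0 \<in> \<Phi>"
    using states_nonempty by auto
  define h where "h a = (\<lambda>\<phi>\<in>\<Phi>. \<lfloor>(Re (\<phi> a) - Re (\<phi>0 a)) / \<delta>\<rfloor>)" for a
  define K where "K = (\<Sum>\<phi>\<in>\<Phi>. ?d \<phi> \<phi>0)"
  have "h ` G \<subseteq> (\<Pi>\<^sub>E \<phi>\<in>\<Phi>. {\<lfloor>- K / \<delta>\<rfloor>..\<lfloor>K / \<delta>\<rfloor>})"
  proof
    fix x assume "x \<in> h ` G"
    then obtain a where a: "a \<in> G" "x = h a" by blast
    have leK: "\<bar>Re (\<phi> a) - Re (\<phi>0 a)\<bar> \<le> K" if "\<phi> \<in> \<Phi>" for \<phi>
    proof -
      have "\<bar>Re (\<phi> a) - Re (\<phi>0 a)\<bar> \<le> cmod (\<phi> a - \<phi>0 a)"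
        using abs_Re_le_cmod[of "\<phi> a - \<phi>0 a"] by simp
      also have "\<dots> \<le> ?d \<phi> \<phi>0"
        using a G \<Phi>(2) \<phi>0 that by (intro mk_le) auto
      also have "\<dots> \<le> K"
        unfolding K_def using \<Phi>(1) that by (intro member_le_sum) auto
      finally show ?thesis .
    qed
    have "\<lfloor>- K / \<delta>\<rfloor> \<le> \<lfloor>(Re (\<phi> a) - Re (\<phi>0 a)) / \<delta>\<rfloor> \<and>
        \<lfloor>(Re (\<phi> a) - Re (\<phi>0 a)) / \<delta>\<rfloor> \<le> \<lfloor>K / \<delta>\<rfloor>" if "\<phi> \<in> \<Phi>" for \<phi>
      using leK[OF that] \<delta> by (intro conjI floor_mono divide_right_mono) auto
    then show "x \<in> (\<Pi>\<^sub>E \<phi>\<in>\<Phi>. {\<lfloor>- K / \<delta>\<rfloor>..\<lfloor>K / \<delta>\<rfloor>})"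
      unfolding a(2) h_def restrict_PiE_iff atLeastAtMost_iff by blast
  qed
  then have "finite (h ` G)"
    by (rule finite_subset) (simp add: finite_PiE \<Phi>(1))
  then obtain F where F: "F \<subseteq> G" "finite F" "h ` G = h ` F"
    using finite_subset_image[of "h ` G" h G] by auto
  have "\<exists>f\<in>F. \<exists>r. cnorm A (a \<ominus> (f \<oplus> complex_of_real r \<odot> \<one>)) \<le> e" if a: "a \<in> G" for a
  proof -
    obtain f where f: "f \<in> F" "h a = h f"
      using F(3) a by (metis imageE image_eqI)
    \<comment> \<open>The metric controls elements only through differences of states, in which
      scalars cancel; \<open>r\<close> is the offset between \<open>a\<close> and \<open>f\<close>
      at \<open>\<phi>0\<close>.\<close>
    define r where "r = Re (\<phi>0 a) - Re (\<phi>0 f)"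
    have sa: "a \<in> self_adjoint A" "f \<in> self_adjoint A" "L a \<le> 1" "L f \<le> 1"
      using a f F(1) G by auto
    define b where "b = a \<ominus> (f \<oplus> complex_of_real r \<odot> \<one>)"
    have b: "b \<in> self_adjoint A"
      unfolding b_def by (intro self_adjoint_minus self_adjoint_add self_adjoint_smult self_adjoint_one sa)
    have ev: "\<phi> b = complex_of_real (Re (\<phi> a) - Re (\<phi> f) - r)" if \<phi>: "\<phi> \<in> states A" for \<phi>
      using sa selfadjoint_carrier state_sa_of_real[OF \<phi>, of a] state_sa_of_real[OF \<phi>, of f]
      by (simp add: b_def state_minus[OF \<phi>] state_add[OF \<phi>] state_smult[OF \<phi>] state_one[OF \<phi>]
          a_closed one_closed)
    have le: "cmod (\<phi> b) \<le> 3 * \<delta>" if \<phi>: "\<phi> \<in> states A" for \<phi>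
    proof -
      obtain \<psi> where \<psi>: "\<psi> \<in> \<Phi>" "?d \<psi> \<phi> < \<delta>"
        using \<Phi>(3) \<phi> by auto
      then have \<psi>s: "\<psi> \<in> states A"
        using \<Phi>(2) by auto
      have close: "\<bar>Re (\<psi> c) - Re (\<phi> c)\<bar> \<le> \<delta>" if "c \<in> self_adjoint A" "L c \<le> 1" for c
        using abs_Re_le_cmod[of "\<psi> c - \<phi> c"] mk_le[OF \<psi>s \<phi> that] \<psi>(2) by simp
      let ?u = "(Re (\<psi> a) - Re (\<phi>0 a)) / \<delta>" and ?v = "(Re (\<psi> f) - Re (\<phi>0 f)) / \<delta>"
      have "\<lfloor>?u\<rfloor> = \<lfloor>?v\<rfloor>"
        using fun_cong[OF f(2), of \<psi>] \<psi>(1) by (simp add: h_def)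
      then have "\<bar>?u - ?v\<bar> \<le> 1"
        by linarith
      then have "\<bar>(?u - ?v) * \<delta>\<bar> \<le> \<delta>"
        using \<delta> by (simp add: abs_mult)
      moreover have "(?u - ?v) * \<delta> = Re (\<psi> a) - Re (\<psi> f) - r"
        using \<delta> by (simp add: r_def field_simps)
      ultimately have "\<bar>Re (\<psi> a) - Re (\<psi> f) - r\<bar> \<le> \<delta>"
        by simp
      then have "\<bar>Re (\<phi> a) - Re (\<phi> f) - r\<bar> \<le> 3 * \<delta>"
        using close[OF sa(1,3)] close[OF sa(2,4)] by linarith
      then show ?thesis
        unfolding ev[OF \<phi>] norm_of_real .
    qed
    obtain \<phi> where "\<phi> \<in> states A" "cnorm A b \<le> 3 * cmod (\<phi> b)"
      using norming_state[OF b] .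
    then have "cnorm A b \<le> e"
      using le[of \<phi>] by (simp add: \<delta>_def)
    then show ?thesis
      using f by (auto simp: b_def)
  qed
  with F show thesis
    using that by blast
qed

end

text \<open>The metric of a seminorm dominating \<open>L\<close> on a subalgebra metrizes the weak* topology of
  the subalgebra because the unit ball of the seminorm is contained in that of \<open>L\<close>.\<close>

lemma (in lip_algebra) mk_metrizes_subalgebra:
  assumes B: "unital_cstar_algebra (A\<lparr>carrier := S\<rparr>)" and S: "S \<subseteq> carrier A"
    and M: "seminorm_sa (A\<lparr>carrier := S\<rparr>) M"
    and le: "\<And>a. a \<in> self_adjoint (A\<lparr>carrier := S\<rparr>) \<Longrightarrow> M a \<le> 1 \<Longrightarrow> L a \<le> 1"
    and dense: "\<And>a e. a \<in> self_adjoint (A\<lparr>carrier := S\<rparr>) \<Longrightarrow> 0 < e \<Longrightarrow>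
      \<exists>b\<in>self_adjoint (A\<lparr>carrier := S\<rparr>). M b < \<infinity> \<and> cnorm A (a \<ominus>\<^bsub>A\<lparr>carrier := S\<rparr>\<^esub> b) < e"
  shows "mk_metrizes_weak_star (A\<lparr>carrier := S\<rparr>) M"
proof -
  let ?B = "A\<lparr>carrier := S\<rparr>"
  interpret B: unital_cstar_algebra ?B by fact
  let ?mk = "mk_dist ?B M" and ?d = "\<lambda>\<phi> \<psi>. enn2real (mk_dist ?B M \<phi> \<psi>)"
  let ?G = "{a \<in> fin_dom ?B M. M a \<le> 1}"
  have saS: "a \<in> self_adjoint A" "a \<in> S" "a \<in> carrier A" if "a \<in> self_adjoint ?B" for a
    using that S by (auto simp: self_adjoint_def)
  have Gsub: "?G \<subseteq> {a \<in> self_adjoint A. L a \<le> 1}"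
    using saS le by (auto simp: fin_dom_def)
  have GI: "a \<in> ?G" if "a \<in> self_adjoint ?B" "M a \<le> 1" for a
    using that by (auto simp: fin_dom_def order_le_less_trans)
  have subst_minus: "x \<ominus>\<^bsub>?B\<^esub> y = x \<ominus>\<^bsub>A\<^esub> y" if "x \<in> S" "y \<in> S" for x y
    using that S by (subst B.minus_eq_smult; (subst minus_eq_smult)?) auto
  \<comment> \<open>The scalar \<open>r\<close> cancels in a difference of two states, so passing
    from \<open>a\<close> to its net element costs \<open>e / 2\<close> for each state. The distance
    is thus controlled by finitely many evaluations.\<close>
  have est: "\<exists>F. finite F \<and> F \<subseteq> ?G \<and> (\<forall>\<phi>\<in>states ?B. \<forall>\<psi>\<in>states ?B.
      ?mk \<phi> \<psi> \<le> ennreal ((\<Sum>f\<in>F. cmod (\<phi> f - \<psi> f)) + e))" if e: "0 < e" for e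
  proof -
    obtain F where F: "finite F" "F \<subseteq> ?G"
      "\<And>a. a \<in> ?G \<Longrightarrow> \<exists>f\<in>F. \<exists>r. cnorm A (a \<ominus> (f \<oplus> complex_of_real r \<odot> \<one>)) \<le> e / 2"
      using finite_net[OF Gsub, of "e / 2"] e by auto
    have "?mk \<phi> \<psi> \<le> ennreal ((\<Sum>f\<in>F. cmod (\<phi> f - \<psi> f)) + e)"
      if \<phi>: "\<phi> \<in> states ?B" and \<psi>: "\<psi> \<in> states ?B" for \<phi> \<psi>
      unfolding mk_dist_def
    proof (rule SUP_least)
      fix a assume a: "a \<in> ?G"
      then obtain f r where f: "f \<in> F" "cnorm A (a \<ominus> (f \<oplus> complex_of_real r \<odot> \<one>)) \<le> e / 2"
        using F(3) by blast
      let ?c = "f \<oplus> complex_of_real r \<odot> \<one>"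
      have sa: "a \<in> self_adjoint ?B" "f \<in> self_adjoint ?B"
        using a f F(2) by (auto simp: fin_dom_def)
      have c: "?c \<in> self_adjoint ?B"
        using B.self_adjoint_add[OF sa(2) B.self_adjoint_smult[OF B.self_adjoint_one, of r]] by simp
      have b: "a \<ominus>\<^bsub>?B\<^esub> ?c \<in> self_adjoint ?B"
        by (rule B.self_adjoint_minus[OF sa(1) c])
      have n: "cnorm A (a \<ominus>\<^bsub>?B\<^esub> ?c) \<le> e / 2"
        using f(2) subst_minus[OF saS(2)[OF sa(1)] saS(2)[OF c]] by simp
      have ev: "\<xi> (a \<ominus>\<^bsub>?B\<^esub> ?c) = \<xi> a - \<xi> f - complex_of_real r" "cmod (\<xi> (a \<ominus>\<^bsub>?B\<^esub> ?c)) \<le> e / 2"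
        if \<xi>: "\<xi> \<in> states ?B" for \<xi>
      proof -
        have "\<xi> ?c = \<xi> f + complex_of_real r"
          using B.state_add[OF \<xi>, of f "complex_of_real r \<odot> \<one>"] B.state_smult[OF \<xi>, of \<one> "complex_of_real r"]
            B.state_one[OF \<xi>] saS(2)[OF sa(2)] B.one_closed B.smult_in[of \<one> "complex_of_real r"]
          by simp
        then show "\<xi> (a \<ominus>\<^bsub>?B\<^esub> ?c) = \<xi> a - \<xi> f - complex_of_real r"
          using B.state_minus[OF \<xi>, of a ?c] saS(2)[OF sa(1)] saS(2)[OF c] by simp
        show "cmod (\<xi> (a \<ominus>\<^bsub>?B\<^esub> ?c)) \<le> e / 2"
          using B.state_sa_bound[OF \<xi> b] n by simp
      qed
      have "\<phi> a - \<psi> a = (\<phi> f - \<psi> f) + (\<phi> (a \<ominus>\<^bsub>?B\<^esub> ?c) - \<psi> (a \<ominus>\<^bsub>?B\<^esub> ?c))"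
        unfolding ev(1)[OF \<phi>] ev(1)[OF \<psi>] by simp
      then have "cmod (\<phi> a - \<psi> a) \<le> cmod (\<phi> f - \<psi> f) + (e / 2 + e / 2)"
        using ev(2)[OF \<phi>] ev(2)[OF \<psi>] norm_triangle_ineq4 norm_triangle_ineq
        by (smt (verit))
      also have "cmod (\<phi> f - \<psi> f) \<le> (\<Sum>f\<in>F. cmod (\<phi> f - \<psi> f))"
        using F(1) f(1) by (intro member_le_sum) auto
      finally show "ennreal (cmod (\<phi> a - \<psi> a)) \<le> ennreal ((\<Sum>f\<in>F. cmod (\<phi> f - \<psi> f)) + e)"
        by (intro ennreal_leI) simp
    qed
    with F(1,2) show ?thesis by blast
  qed
  have fin: "?mk \<phi> \<psi> < \<infinity>" if st: "\<phi> \<in> states ?B" "\<psi> \<in> states ?B" for \<phi> \<psi>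
  proof -
    obtain F where "?mk \<phi> \<psi> \<le> ennreal ((\<Sum>f\<in>F. cmod (\<phi> f - \<psi> f)) + 1)"
      using est[OF zero_less_one] st by blast
    then show ?thesis
      by (rule order_le_less_trans) simp
  qed
  have mk_upper: "cmod (\<phi> a - \<psi> a) \<le> ?d \<phi> \<psi>"
    if "\<phi> \<in> states ?B" "\<psi> \<in> states ?B" "a \<in> ?G" for \<phi> \<psi> a
  proof -
    have "ennreal (cmod (\<phi> a - \<psi> a)) \<le> ?mk \<phi> \<psi>"
      unfolding mk_dist_def using that(3) by (intro SUP_upper)
    then show ?thesis
      using fin[OF that(1,2)] by (metis enn2real_ennreal enn2real_mono infinity_ennreal_def norm_ge_zero)
  qed
  have mk_scaled: "\<exists>K>0. \<forall>\<phi>\<in>states ?B. \<forall>\<psi>\<in>states ?B. cmod (\<phi> b - \<psi> b) \<le> K * ?d \<phi> \<psi>"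
    if b: "b \<in> self_adjoint ?B" "M b < \<infinity>" for b
  proof -
    \<comment> \<open>The summand 1 keeps \<open>K\<close> positive when \<open>M b\<close> is 0,
      and division by \<open>K\<close> moves \<open>b\<close> into the unit ball.\<close>
    define K where "K = enn2real (M b) + 1"
    have K: "0 < K" by (simp add: K_def add_nonneg_pos)
    let ?b = "complex_of_real (1 / K) \<odot> b"
    have "M ?b = ennreal (1 / K) * M b"
      using conjunct2[OF M[unfolded seminorm_sa_def], rule_format, OF b(1), of "1 / K"] K
      by (simp del: of_real_divide)
    also have "M b = ennreal (enn2real (M b))"
      using b by (simp add: less_top)
    also have "ennreal (1 / K) * ennreal (enn2real (M b)) = ennreal (1 / K * enn2real (M b))"
      using K by (subst ennreal_mult) auto
    also have "\<dots> \<le> ennreal 1"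
      using K by (intro ennreal_leI) (simp add: K_def divide_simps)
    finally have "?b \<in> ?G"
      using B.self_adjoint_smult[OF b(1), of "1 / K"] by (intro GI) simp_all
    have "cmod (\<phi> b - \<psi> b) \<le> K * ?d \<phi> \<psi>" if \<phi>: "\<phi> \<in> states ?B" and \<psi>: "\<psi> \<in> states ?B" for \<phi> \<psi>
    proof -
      have "\<xi> ?b = complex_of_real (1 / K) * \<xi> b" if "\<xi> \<in> states ?B" for \<xi>
        using B.state_smult[OF that, of b "complex_of_real (1 / K)"] saS(2)[OF b(1)] by simp
      then have "\<phi> ?b - \<psi> ?b = complex_of_real (1 / K) * (\<phi> b - \<psi> b)"
        using \<phi> \<psi> by (simp add: right_diff_distrib)
      then have "cmod (\<phi> ?b - \<psi> ?b) = cmod (\<phi> b - \<psi> b) / K"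
        using K by (simp only: norm_mult norm_of_real) simp
      then have "cmod (\<phi> b - \<psi> b) / K \<le> ?d \<phi> \<psi>"
        using mk_upper[OF \<phi> \<psi> \<open>?b \<in> ?G\<close>] by simp
      then show ?thesis
        using K by (simp add: pos_divide_le_eq mult.commute)
    qed
    with K show ?thesis by blast
  qed
  \<comment> \<open>Density extends \<open>mk_scaled\<close> to elements of infinite seminorm, at
    the price of the additive error \<open>e\<close>.\<close>
  have mk_approx: "\<exists>K>0. \<forall>\<phi>\<in>states ?B. \<forall>\<psi>\<in>states ?B. cmod (\<phi> a - \<psi> a) \<le> K * ?d \<phi> \<psi> + e"
    if a: "a \<in> self_adjoint ?B" and e: "0 < e" for a e
  proof -
    obtain b where b: "b \<in> self_adjoint ?B" "M b < \<infinity>" "cnorm A (a \<ominus>\<^bsub>?B\<^esub> b) < e / 2"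
      using dense[OF a, of "e / 2"] e by auto
    obtain K where K: "0 < K" "\<And>\<phi> \<psi>. \<phi> \<in> states ?B \<Longrightarrow> \<psi> \<in> states ?B \<Longrightarrow> cmod (\<phi> b - \<psi> b) \<le> K * ?d \<phi> \<psi>"
      using mk_scaled[OF b(1,2)] by blast
    have "cmod (\<phi> a - \<psi> a) \<le> K * ?d \<phi> \<psi> + e" if \<phi>: "\<phi> \<in> states ?B" and \<psi>: "\<psi> \<in> states ?B" for \<phi> \<psi>
    proof -
      have ev: "\<xi> (a \<ominus>\<^bsub>?B\<^esub> b) = \<xi> a - \<xi> b" "cmod (\<xi> (a \<ominus>\<^bsub>?B\<^esub> b)) \<le> e / 2" if \<xi>: "\<xi> \<in> states ?B" for \<xi>
        using B.state_minus[OF \<xi>, of a b] B.state_sa_bound[OF \<xi> B.self_adjoint_minus[OF a b(1)]]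
          saS(2)[OF a] saS(2)[OF b(1)] b(3) by simp_all
      have "\<phi> a - \<psi> a = (\<phi> b - \<psi> b) + (\<phi> (a \<ominus>\<^bsub>?B\<^esub> b) - \<psi> (a \<ominus>\<^bsub>?B\<^esub> b))"
        unfolding ev(1)[OF \<phi>] ev(1)[OF \<psi>] by simp
      then have "cmod (\<phi> a - \<psi> a) \<le> cmod (\<phi> b - \<psi> b) + (e / 2 + e / 2)"
        using ev(2)[OF \<phi>] ev(2)[OF \<psi>] norm_triangle_ineq4 norm_triangle_ineq
        by (smt (verit))
      then show ?thesis
        using K(2)[OF \<phi> \<psi>] by simp
    qed
    with K(1) show ?thesis by blast
  qed
  have mk_sym: "?mk \<phi> \<psi> = ?mk \<psi> \<phi>" for \<phi> \<psi>
    by (simp add: mk_dist_def norm_minus_commute)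
  have metric: "Metric_space (states ?B) ?d"
  proof
    show "0 \<le> ?d \<phi> \<psi>" "?d \<phi> \<psi> = ?d \<psi> \<phi>" for \<phi> \<psi>
      using mk_sym by simp_all
  next
    fix \<phi> \<psi> assume \<phi>: "\<phi> \<in> states ?B" and \<psi>: "\<psi> \<in> states ?B"
    show "?d \<phi> \<psi> = 0 \<longleftrightarrow> \<phi> = \<psi>"
    proof
      assume d0: "?d \<phi> \<psi> = 0"
      show "\<phi> = \<psi>"
      proof (rule B.states_eqI[OF \<phi> \<psi>])
        fix a assume a: "a \<in> self_adjoint ?B"
        have "cmod (\<phi> a - \<psi> a) \<le> 0"
        proof (rule field_le_epsilon)
          fix e :: real assume "0 < e"
          then show "cmod (\<phi> a - \<psi> a) \<le> 0 + e"
            using mk_approx[OF a, of e] \<phi> \<psi> d0 by fastforce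
        qed
        then show "\<phi> a = \<psi> a" by simp
      qed
    next
      assume "\<phi> = \<psi>"
      have "?mk \<psi> \<psi> \<le> 0"
        unfolding mk_dist_def by (rule SUP_least) simp
      then show "?d \<phi> \<psi> = 0"
        using \<open>\<phi> = \<psi>\<close> by simp
    qed
    fix \<xi> assume \<xi>: "\<xi> \<in> states ?B"
    have "?mk \<phi> \<xi> \<le> ennreal (?d \<phi> \<psi> + ?d \<psi> \<xi>)"
      unfolding mk_dist_def[of _ _ \<phi> \<xi>]
    proof (rule SUP_least, rule ennreal_leI)
      fix a assume a: "a \<in> ?G"
      show "cmod (\<phi> a - \<xi> a) \<le> ?d \<phi> \<psi> + ?d \<psi> \<xi>"
        using mk_upper[OF \<phi> \<psi> a] mk_upper[OF \<psi> \<xi> a] norm_triangle_ineq[of "\<phi> a - \<psi> a" "\<psi> a - \<xi> a"]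
        by simp
    qed
    then show "?d \<phi> \<xi> \<le> ?d \<phi> \<psi> + ?d \<psi> \<xi>"
      by (intro enn2real_leI) simp_all
  qed
  interpret mk: Metric_space "states ?B" ?d
    by (rule metric)
  let ?W = "weak_star_topology ?B"
  \<comment> \<open>The finitely many evaluations in \<open>est\<close> cut out a weak-star
    neighbourhood inside a metric ball; this is where total boundedness enters.\<close>
  have "continuous_map ?W mk.mtopology id"
    unfolding mk.continuous_map_to_metric B.topspace_weak_star
  proof (intro ballI allI impI)
    fix \<phi> and e :: real assume \<phi>: "\<phi> \<in> states ?B" and e: "0 < e"
    obtain F where F: "finite F" "F \<subseteq> ?G"
      "\<And>\<phi> \<psi>. \<phi> \<in> states ?B \<Longrightarrow> \<psi> \<in> states ?B \<Longrightarrow> ?mk \<phi> \<psi> \<le> ennreal ((\<Sum>f\<in>F. cmod (\<phi> f - \<psi> f)) + e / 2)"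
      using est[of "e / 2"] e by auto
    let ?s = "\<lambda>\<psi>. \<Sum>f\<in>F. cmod (\<phi> f - \<psi> f)"
    have FS: "f \<in> carrier ?B" if "f \<in> F" for f
      using that F(2) B.selfadjoint_carrier by (auto simp: fin_dom_def)
    have "continuous_map ?W euclideanreal ?s"
      using FS by (intro continuous_map_sum continuous_map_norm continuous_map_diff B.continuous_map_eval F(1)) auto
    then have "openin ?W {\<psi> \<in> topspace ?W. ?s \<psi> \<in> {..<e / 2}}"
      by (rule openin_continuous_map_preimage) simp
    moreover have "\<psi> \<in> mk.mball \<phi> e" if "\<psi> \<in> states ?B" "?s \<psi> < e / 2" for \<psi>
    proof -
      have "?d \<phi> \<psi> \<le> ?s \<psi> + e / 2"
        using F(3)[OF \<phi> that(1)] e by (intro enn2real_leI) (simp_all add: sum_nonneg)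
      then show ?thesis
        using that \<phi> by simp
    qed
    ultimately show "\<exists>U. openin ?W U \<and> \<phi> \<in> U \<and> (\<forall>\<psi>\<in>U. id \<psi> \<in> mk.mball (id \<phi>) e)"
      using \<phi> e by (intro exI[of _ "{\<psi> \<in> topspace ?W. ?s \<psi> \<in> {..<e / 2}}"]) (simp add: B.topspace_weak_star)
  qed
  \<comment> \<open>Evaluations are continuous for the metric: at self-adjoint elements by
    \<open>mk_approx\<close>, at the others through real and imaginary parts.\<close>
  moreover have "continuous_map mk.mtopology ?W id"
  proof -
    have cont: "continuous_map mk.mtopology euclidean (\<lambda>\<phi>. \<phi> a)" if a: "a \<in> self_adjoint ?B" for a
      unfolding mtopology_is_euclidean[symmetric] Met_TC.continuous_map_to_metric
    proof (intro ballI allI impI)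
      fix \<phi> and e :: real assume "\<phi> \<in> topspace mk.mtopology" and e: "0 < e"
      then have \<phi>: "\<phi> \<in> states ?B" by simp
      obtain K where K: "0 < K" "\<And>\<phi> \<psi>. \<phi> \<in> states ?B \<Longrightarrow> \<psi> \<in> states ?B \<Longrightarrow> cmod (\<phi> a - \<psi> a) \<le> K * ?d \<phi> \<psi> + e / 2"
        using mk_approx[OF a, of "e / 2"] e by auto
      have "cmod (\<phi> a - \<psi> a) < e" if "\<psi> \<in> states ?B" "?d \<phi> \<psi> < e / (2 * K)" for \<psi>
      proof -
        have "K * ?d \<phi> \<psi> < e / 2"
          using that(2) K(1) by (simp add: field_simps)
        then show ?thesis
          using K(2)[OF \<phi> that(1)] by simp
      qed
      then show "\<exists>U. openin mk.mtopology U \<and> \<phi> \<in> U \<and> (\<forall>\<psi>\<in>U. \<psi> a \<in> Met_TC.mball (\<phi> a) e)"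
        using \<phi> e K by (intro exI[of _ "mk.mball \<phi> (e / (2 * K))"]) (auto simp: dist_norm)
    qed
    have "continuous_map mk.mtopology euclidean (\<lambda>\<phi>. \<phi> x)" if x: "x \<in> carrier ?B" for x
    proof (rule continuous_map_eq)
      show "continuous_map mk.mtopology euclidean (\<lambda>\<phi>. \<phi> (B.re_part x) + \<i> * \<phi> (B.im_part x))"
        using x by (intro continuous_map_add continuous_map_cmult cont B.re_part_sa B.im_part_sa)
      fix \<phi> assume "\<phi> \<in> topspace mk.mtopology"
      then have \<phi>: "\<phi> \<in> states ?B" by simp
      note c = B.selfadjoint_carrier[OF B.re_part_sa[OF x]] B.selfadjoint_carrier[OF B.im_part_sa[OF x]]
      have "\<phi> x = \<phi> (B.re_part x \<oplus>\<^bsub>?B\<^esub> \<i> \<odot>\<^bsub>?B\<^esub> B.im_part x)"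
        using B.re_im_decomp[OF x] by simp
      also have "\<dots> = \<phi> (B.re_part x) + \<i> * \<phi> (B.im_part x)"
        by (simp only: B.state_add[OF \<phi>] B.state_smult[OF \<phi>] c B.smult_in)
      finally show "\<phi> (B.re_part x) + \<i> * \<phi> (B.im_part x) = \<phi> x" ..
    qed
    moreover have "states ?B \<subseteq> extensional (carrier ?B)"
      by (auto simp: states_def)
    ultimately have "continuous_map mk.mtopology (product_topology (\<lambda>_. euclidean) (carrier ?B)) id"
      unfolding continuous_map_componentwise by (simp add: image_subset_iff)
    then show ?thesis
      unfolding weak_star_topology_def by (intro continuous_map_into_subtopology) auto
  qed
  ultimately have "mk.mtopology = ?W"
    using topology_finer_continuous_id[of mk.mtopology ?W] topology_finer_continuous_id[of ?W mk.mtopology]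
    by (auto simp: topology_eq B.topspace_weak_star)
  with metric fin show ?thesis
    by (auto simp: mk_metrizes_weak_star_def)
qed

section \<open>Subalgebras\<close>

context unital_cstar_algebra
begin

lemma norm_closure_iff:
  assumes "S \<subseteq> carrier A"
  shows "x \<in> norm_topology A closure_of S \<longleftrightarrow>
    x \<in> carrier A \<and> (\<forall>e>0. \<exists>y\<in>S. cnorm A (x \<ominus> y) < e)"
  using assms unfolding norm_topology_def norm.metric_closure_of
  by (auto simp: norm_dist_def subset_iff)

lemma closedin_self_adjoint: "closedin (norm_topology A) (self_adjoint A)"
proof -
  have "x \<in> self_adjoint A" if x: "x \<in> norm_topology A closure_of self_adjoint A" for x
  proof -
    have cx: "x \<in> carrier A" and *: "\<And>e. 0 < e \<Longrightarrow> \<exists>y\<in>self_adjoint A. cnorm A (x \<ominus> y) < e"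
      using x by (auto simp: norm_closure_iff[OF subsetI[OF selfadjoint_carrier]])
    have "cnorm A (x \<ominus> adj A x) \<le> 0"
    proof (rule field_le_epsilon)
      fix e :: real assume "0 < e"
      then obtain y where y: "y \<in> self_adjoint A" "cnorm A (x \<ominus> y) < e / 2"
        using *[of "e / 2"] by auto
      then have cy: "y \<in> carrier A" "adj A y = y"
        by (auto simp: self_adjoint_def)
      have "cnorm A (y \<ominus> adj A x) = cnorm A (adj A (y \<ominus> x))"
        using cx cy by (simp add: adj_minus)
      also have "\<dots> = cnorm A (x \<ominus> y)"
        using cx cy by (simp add: cnorm_adj minus_closed cnorm_minus_commute[of y x])
      finally show "cnorm A (x \<ominus> adj A x) \<le> 0 + e"
        using cnorm_triangle_minus[of x y "adj A x"] cx cy y(2) by simp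
    qed
    then have "cnorm A (x \<ominus> adj A x) = 0"
      using cnorm_nonneg[of "x \<ominus> adj A x"] cx by (simp add: minus_closed)
    then have "x = adj A x"
      using cx by (simp add: cnorm_eq_zero minus_closed minus_eq_zero_iff)
    then show ?thesis
      using cx by (simp add: self_adjoint_def)
  qed
  moreover have "self_adjoint A \<subseteq> topspace (norm_topology A)"
    using selfadjoint_carrier by (auto simp: norm_topology_def)
  ultimately show ?thesis
    by (simp add: closure_of_subset_eq[symmetric] subset_iff)
qed

text \<open>The self-adjoint part is closed, so relative closedness is closedness in
  \<open>A\<close>, and limits need to be tested at self-adjoint points only.\<close>

lemma closedin_sa_iff:
  assumes T: "T \<subseteq> self_adjoint A"
  shows "closedin (subtopology (norm_topology A) (self_adjoint A)) T \<longleftrightarrow>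
    (\<forall>x\<in>self_adjoint A. (\<forall>e>0. \<exists>y\<in>T. cnorm A (x \<ominus> y) < e) \<longrightarrow> x \<in> T)"
proof -
  have TA: "T \<subseteq> carrier A"
    using T selfadjoint_carrier by blast
  have "closedin (subtopology (norm_topology A) (self_adjoint A)) T \<longleftrightarrow> closedin (norm_topology A) T"
    using closedin_self_adjoint T by (simp add: closedin_closed_subtopology)
  also have "\<dots> \<longleftrightarrow> norm_topology A closure_of T \<subseteq> T"
    using TA by (simp add: closure_of_subset_eq[symmetric] norm_topology_def)
  also have "\<dots> \<longleftrightarrow> (\<forall>x\<in>self_adjoint A. (\<forall>e>0. \<exists>y\<in>T. cnorm A (x \<ominus> y) < e) \<longrightarrow> x \<in> T)"
  proof -
    have "norm_topology A closure_of T \<subseteq> self_adjoint A"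
      using closedin_self_adjoint T by (rule closure_of_minimal[rotated])
    then show ?thesis
      using T selfadjoint_carrier unfolding subset_iff norm_closure_iff[OF TA] by blast
  qed
  finally show ?thesis .
qed

text \<open>The additive inverse is defined as an element of the carrier, so shrinking the carrier
  might change it. In both algebras it is multiplication by -1.\<close>

lemma subalgebra_minus:
  assumes R: "ring (A\<lparr>carrier := S\<rparr>)" and S: "S \<subseteq> carrier A" "\<And>c x. x \<in> S \<Longrightarrow> c \<odot> x \<in> S"
    and xy: "x \<in> S" "y \<in> S"
  shows "x \<ominus>\<^bsub>A\<lparr>carrier := S\<rparr>\<^esub> y = x \<ominus> y"
proof -
  let ?B = "A\<lparr>carrier := S\<rparr>"
  have y: "y \<in> carrier A"
    using S xy by blast
  have "(- 1) \<odot> y \<oplus> y = (- 1 + 1) \<odot> y"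
    using y by (simp only: smult_add_left smult_1)
  then have "(- 1) \<odot> y \<oplus>\<^bsub>?B\<^esub> y = \<zero>\<^bsub>?B\<^esub>"
    using y by simp
  then have "\<ominus>\<^bsub>?B\<^esub> y = (- 1) \<odot> y"
    using abelian_group.minus_equality[OF ring.is_abelian_group[OF R], of "(- 1) \<odot> y" y] xy S(2)
    by simp
  then show ?thesis
    using ring.ring_simprules(14)[OF R, of x y] xy S(1) by (simp add: minus_eq_smult subset_iff)
qed

lemma subalgebra_unital_cstar_algebra:
  assumes S: "cstar_subalgebra S A" and one: "\<one> \<in> S"
  shows "unital_cstar_algebra (A\<lparr>carrier := S\<rparr>)"
proof -
  let ?B = "A\<lparr>carrier := S\<rparr>"
  have sm: "submodule S complex_ring A"
    and mult: "\<And>x y. x \<in> S \<Longrightarrow> y \<in> S \<Longrightarrow> x \<otimes> y \<in> S" and adj: "\<And>x. x \<in> S \<Longrightarrow> adj A x \<in> S"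
    and closed: "closedin (norm_topology A) S"
    using S by (auto simp: cstar_subalgebra_def)
  have sub: "S \<subseteq> carrier A" and add: "\<And>x y. x \<in> S \<Longrightarrow> y \<in> S \<Longrightarrow> x \<oplus> y \<in> S" and zero: "\<zero> \<in> S"
    using sm subgroup.subset subgroup.m_closed subgroup.one_closed
    by (fastforce simp: submodule_def)+
  have smult: "\<And>c x. x \<in> S \<Longrightarrow> c \<odot> x \<in> S"
    using sm by (auto simp: submodule_def submodule_axioms_def)
  have cS: "x \<in> S \<Longrightarrow> x \<in> carrier A" for x
    using sub by blast
  have "\<exists>y\<in>S. y \<oplus> x = \<zero>" if x: "x \<in> S" for x
  proof
    have "(- 1) \<odot> x \<oplus> x = (- 1 + 1) \<odot> x"
      using cS[OF x] by (simp only: smult_add_left smult_1)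
    then show "(- 1) \<odot> x \<oplus> x = \<zero>"
      using cS[OF x] by simp
    show "(- 1) \<odot> x \<in> S"
      by (rule smult[OF x])
  qed
  then have ag: "abelian_group ?B"
    by (intro abelian_groupI) (auto simp: add zero cS a_assoc a_comm a_lcomm l_zero)
  have R: "ring ?B"
    by (intro ringI ag monoidI) (auto simp: mult one cS m_assoc l_one r_one l_distr r_distr)
  have M: "module complex_ring ?B"
    by (intro moduleI cring_complex_ring ag)
      (auto simp: smult cS smult_add_left smult_add_right smult_smult)
  note minus = subalgebra_minus[OF R sub smult]
  have dist: "norm_dist ?B x y = norm_dist A x y" if "x \<in> S" "y \<in> S" for x y
    using that cS by (simp add: norm_dist_def minus)
  have ms: "Metric_space S (norm_dist ?B)"
  proof
    fix x y z
    show "0 \<le> norm_dist ?B x y" "norm_dist ?B x y = norm_dist ?B y x"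
      using cS minus by (auto simp: norm_dist_def cnorm_nonneg minus_closed cnorm_minus_commute[of x y])
    show "norm_dist ?B x y = 0 \<longleftrightarrow> x = y" if "x \<in> S" "y \<in> S"
      using that cS by (simp add: dist)
    show "norm_dist ?B x z \<le> norm_dist ?B x y + norm_dist ?B y z" if "x \<in> S" "y \<in> S" "z \<in> S"
      using that cS by (simp add: dist norm.triangle)
  qed
  interpret sub: Metric_space S "norm_dist ?B"
    by (rule ms)
  have "sub.mcomplete"
    unfolding sub.mcomplete_def
  proof (intro allI impI)
    fix \<sigma> assume \<sigma>: "sub.MCauchy \<sigma>"
    then have \<sigma>S: "\<sigma> n \<in> S" for n
      by (auto simp: sub.MCauchy_def)
    have "norm.MCauchy \<sigma>"
      using \<sigma> \<sigma>S cS by (auto simp: sub.MCauchy_def norm.MCauchy_def dist)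
    then obtain l where l: "limitin norm.mtopology \<sigma> l sequentially"
      using complete by (auto simp: norm.mcomplete_def)
    have lS: "l \<in> S"
      by (rule limitin_closedin[OF l]) (use closed \<sigma>S in \<open>auto simp: norm_topology_def\<close>)
    have "(\<lambda>n. norm_dist A (\<sigma> n) l) \<longlonglongrightarrow> 0"
      using l by (simp add: norm.limitin_metric_dist_null)
    then show "\<exists>x. limitin sub.mtopology \<sigma> x sequentially"
      using lS \<sigma>S by (auto simp: sub.limitin_metric_dist_null dist intro!: exI[of _ l])
  qed
  then show ?thesis
    using R M one_not_zero
    by (intro unital_cstar_algebra.intro unital_cstar_algebra_axioms.intro)
      (auto simp: cS smult_mult_left smult_mult_right adj adj_adj adj_add adj_smult adj_mult cnorm_nonneg
        cnorm_eq_zero cnorm_triangle cnorm_smult cnorm_mult cstar_identity)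
qed

lemma jordan_prod_sa:
  "a \<in> self_adjoint A \<Longrightarrow> b \<in> self_adjoint A \<Longrightarrow> jordan_prod A a b \<in> self_adjoint A"
  by (auto simp: jordan_prod_def self_adjoint_def adj_smult adj_add adj_mult m_closed a_closed a_comm)

lemma lie_prod_sa:
  assumes "a \<in> self_adjoint A" "b \<in> self_adjoint A"
  shows "lie_prod A a b \<in> self_adjoint A"
proof -
  have ab: "a \<in> carrier A" "b \<in> carrier A" "adj A a = a" "adj A b = b"
    using assms by (auto simp: self_adjoint_def)
  have "adj A (lie_prod A a b) = cnj (1 / (2 * \<i>)) \<odot> (b \<otimes> a \<oplus> (- 1) \<odot> (a \<otimes> b))"
    using ab by (simp add: lie_prod_def adj_smult adj_add adj_mult m_closed a_closed minus_eq_smult)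
  also have "\<dots> = (1 / (2 * \<i>)) \<odot> (a \<otimes> b \<oplus> (- 1) \<odot> (b \<otimes> a))"
    using ab by (simp add: smult_add_right smult_smult m_closed a_comm)
  finally show ?thesis
    using ab by (simp add: lie_prod_def self_adjoint_def m_closed minus_closed minus_eq_smult)
qed

lemma cnorm_mult_diff:
  assumes "a \<in> carrier A" "b \<in> carrier A" "a' \<in> carrier A" "b' \<in> carrier A"
  shows "cnorm A (a \<otimes> b \<ominus> a' \<otimes> b') \<le> cnorm A a * cnorm A (b \<ominus> b') + cnorm A (a \<ominus> a') * cnorm A b'"
proof -
  have "cnorm A (a \<otimes> b \<ominus> a' \<otimes> b') \<le> cnorm A (a \<otimes> b \<ominus> a \<otimes> b') + cnorm A (a \<otimes> b' \<ominus> a' \<otimes> b')"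
    using assms by (intro cnorm_triangle_minus) (auto simp: m_closed)
  moreover have "a \<otimes> b \<ominus> a \<otimes> b' = a \<otimes> (b \<ominus> b')" "a \<otimes> b' \<ominus> a' \<otimes> b' = (a \<ominus> a') \<otimes> b'"
    using assms by (simp_all add: minus_eq_smult m_closed r_distr l_distr smult_mult_left smult_mult_right)
  ultimately show ?thesis
    using cnorm_mult[of a "b \<ominus> b'"] cnorm_mult[of "a \<ominus> a'" b'] assms by (simp add: minus_closed)
qed

lemma minus_add_minus:
  assumes "x \<in> carrier A" "y \<in> carrier A" "z \<in> carrier A" "w \<in> carrier A"
  shows "(x \<oplus> y) \<ominus> (z \<oplus> w) = (x \<ominus> z) \<oplus> (y \<ominus> w)"
  using assms by (simp add: minus_eq_smult smult_add_right add_swap a_closed)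

lemma smult_minus: "x \<in> carrier A \<Longrightarrow> y \<in> carrier A \<Longrightarrow> c \<odot> x \<ominus> c \<odot> y = c \<odot> (x \<ominus> y)"
  by (simp add: minus_eq_smult smult_add_right smult_smult)

text \<open>One estimate serves the Jordan product with \<open>d = 1\<close> and the Lie product
  with \<open>d = - 1\<close>. Since \<open>r \<le> 1\<close>, the primed norms exceed the others by
  at most 1; averaging the two orders of multiplication gives the factor.\<close>

lemma cnorm_commutator_diff:
  assumes "a \<in> carrier A" "b \<in> carrier A" "a' \<in> carrier A" "b' \<in> carrier A"
    and c: "cmod c = 1 / 2" "cmod d = 1"
    and P: "\<And>a b. a \<in> carrier A \<Longrightarrow> b \<in> carrier A \<Longrightarrow> P a b = c \<odot> (a \<otimes> b \<oplus> d \<odot> (b \<otimes> a))"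
    and r: "cnorm A (a \<ominus> a') \<le> r" "cnorm A (b \<ominus> b') \<le> r" "r \<le> 1"
  shows "cnorm A (P a b \<ominus> P a' b') \<le> (cnorm A a + cnorm A b + 1) * r"
proof -
  have n: "cnorm A a' \<le> cnorm A a + 1" "cnorm A b' \<le> cnorm A b + 1"
    using cnorm_le_add_minus[of a' a] cnorm_le_add_minus[of b' b] assms
      cnorm_minus_commute[of a a'] cnorm_minus_commute[of b b'] by simp_all
  have nn: "0 \<le> cnorm A a" "0 \<le> cnorm A b" "0 \<le> cnorm A b'" "0 \<le> cnorm A a'" "0 \<le> cnorm A (a \<ominus> a')"
    "0 \<le> cnorm A (b \<ominus> b')"
    using assms cnorm_nonneg by (simp_all add: minus_closed)
  have r0: "0 \<le> r"
    using nn r by linarith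
  have "cnorm A (a \<otimes> b \<ominus> a' \<otimes> b') \<le> cnorm A a * r + r * (cnorm A b + 1)"
    using nn r n r0 cnorm_mult_diff[OF assms(1-4)]
      mult_left_mono[of "cnorm A (b \<ominus> b')" r "cnorm A a"] mult_mono[of "cnorm A (a \<ominus> a')" r "cnorm A b'" "cnorm A b + 1"]
    by linarith
  moreover have "cnorm A (b \<otimes> a \<ominus> b' \<otimes> a') \<le> cnorm A b * r + r * (cnorm A a + 1)"
    using nn r n r0 cnorm_mult_diff[OF assms(2,1,4,3)]
      mult_left_mono[of "cnorm A (a \<ominus> a')" r "cnorm A b"] mult_mono[of "cnorm A (b \<ominus> b')" r "cnorm A a'" "cnorm A a + 1"]
    by linarith
  moreover have "P a b \<ominus> P a' b' = c \<odot> ((a \<otimes> b \<ominus> a' \<otimes> b') \<oplus> d \<odot> (b \<otimes> a \<ominus> b' \<otimes> a'))"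
    using assms(1-4) by (simp add: P smult_minus minus_add_minus m_closed a_closed)
  then have "cnorm A (P a b \<ominus> P a' b') =
      1 / 2 * cnorm A ((a \<otimes> b \<ominus> a' \<otimes> b') \<oplus> d \<odot> (b \<otimes> a \<ominus> b' \<otimes> a'))"
    using assms(1-4) c by (simp only: cnorm_smult m_closed a_closed minus_closed smult_in)
  then have "cnorm A (P a b \<ominus> P a' b') \<le> (cnorm A (a \<otimes> b \<ominus> a' \<otimes> b') + cnorm A (b \<otimes> a \<ominus> b' \<otimes> a')) / 2"
    using cnorm_triangle[of "a \<otimes> b \<ominus> a' \<otimes> b'" "d \<odot> (b \<otimes> a \<ominus> b' \<otimes> a')"] assms(1-4) c
    by (simp add: cnorm_smult m_closed a_closed minus_closed)
  ultimately show ?thesis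
    by (simp add: algebra_simps)
qed

end

section \<open>The seminorm generated by a dense core\<close>

text \<open>\<open>V\<close> stands for the self-adjoint part of the union of the subalgebras. The
  new seminorm sees it only as a norm-dense unital Jordan-Lie algebra on which \<open>L\<close> is
  finite.\<close>

locale lip_core = lip_algebra A L for A :: "'a cstar" (structure) and L +
  fixes C D :: real and V :: "'a set"
  assumes C: "1 \<le> C" and D: "0 \<le> D"
    and seminorm: "seminorm_sa A L"
    and kernel: "{a \<in> self_adjoint A. L a = 0} = {complex_of_real r \<odot> \<one> | r. True}"
    and leibniz: "\<And>a b. a \<in> fin_dom A L \<Longrightarrow> b \<in> fin_dom A L \<Longrightarrow>
      max (L (jordan_prod A a b)) (L (lie_prod A a b))
        \<le> ennreal C * (ennreal (cnorm A a) * L b + ennreal (cnorm A b) * L a) + ennreal D * L a * L b"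
    and lsc: "\<And>r. closedin (subtopology (norm_topology A) (self_adjoint A)) {a \<in> self_adjoint A. L a \<le> r}"
    and V_fin: "V \<subseteq> fin_dom A L"
    and V_one: "\<one> \<in> V"
    and V_add: "\<And>a b. a \<in> V \<Longrightarrow> b \<in> V \<Longrightarrow> a \<oplus> b \<in> V"
    and V_smult: "\<And>r a. a \<in> V \<Longrightarrow> complex_of_real r \<odot> a \<in> V"
    and V_jordan: "\<And>a b. a \<in> V \<Longrightarrow> b \<in> V \<Longrightarrow> jordan_prod A a b \<in> V"
    and V_lie: "\<And>a b. a \<in> V \<Longrightarrow> b \<in> V \<Longrightarrow> lie_prod A a b \<in> V"
    and V_dense: "\<And>a e. a \<in> self_adjoint A \<Longrightarrow> 0 < e \<Longrightarrow> \<exists>b\<in>V. cnorm A (a \<ominus> b) < e"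
begin

section \<open>Approximation from the core\<close>

lemma V_sa: "a \<in> V \<Longrightarrow> a \<in> self_adjoint A"
  using V_fin by (auto simp: fin_dom_def)

lemma V_carrier: "a \<in> V \<Longrightarrow> a \<in> carrier A"
  using V_sa selfadjoint_carrier by blast

lemma L_add: "a \<in> self_adjoint A \<Longrightarrow> b \<in> self_adjoint A \<Longrightarrow> L (a \<oplus> b) \<le> L a + L b"
  and L_smult: "a \<in> self_adjoint A \<Longrightarrow> L (complex_of_real r \<odot> a) = ennreal \<bar>r\<bar> * L a"
  using seminorm by (simp_all add: seminorm_sa_def)

text \<open>For \<open>r > 0\<close> this is \<open>Lbar a \<le> ennreal r\<close>, as
  \<open>Lbar_le_iff\<close> shows. Inequalities for the Minkowski functional thus become statements
  about approximation by core elements.\<close>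

definition near :: "'a \<Rightarrow> real \<Rightarrow> bool" where
  "near a r \<longleftrightarrow> a \<in> self_adjoint A \<and> (\<forall>e>0. \<exists>b\<in>V. L b \<le> ennreal r \<and> cnorm A (a \<ominus> b) < e)"

lemma near_iff_closure: "near a r \<longleftrightarrow> a \<in> norm_topology A closure_of {b \<in> V. L b \<le> ennreal r}"
proof -
  have sub: "{b \<in> V. L b \<le> ennreal r} \<subseteq> self_adjoint A" "{b \<in> V. L b \<le> ennreal r} \<subseteq> carrier A"
    using V_sa V_carrier by auto
  have "norm_topology A closure_of {b \<in> V. L b \<le> ennreal r} \<subseteq> self_adjoint A"
    using closedin_self_adjoint sub(1) by (rule closure_of_minimal[rotated])
  moreover have "a \<in> norm_topology A closure_of {b \<in> V. L b \<le> ennreal r} \<longleftrightarrow>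
      a \<in> carrier A \<and> (\<forall>e>0. \<exists>b\<in>V. L b \<le> ennreal r \<and> cnorm A (a \<ominus> b) < e)"
    unfolding norm_closure_iff[OF sub(2)] by blast
  ultimately show ?thesis
    using selfadjoint_carrier by (auto simp: near_def)
qed

lemma near_core: "a \<in> V \<Longrightarrow> L a \<le> ennreal r \<Longrightarrow> near a r"
  using V_sa V_carrier[of a] minus_eq_zero_iff[of a a]
  by (auto simp: near_def intro!: bexI[of _ a])

lemma near_mono: "near a r \<Longrightarrow> r \<le> s \<Longrightarrow> near a s"
  unfolding near_def by (meson ennreal_leI order_trans)

lemma near_add:
  assumes "near a r" "near b s" "0 \<le> r" "0 \<le> s"
  shows "near (a \<oplus> b) (r + s)"
proof -
  have ab: "a \<in> self_adjoint A" "b \<in> self_adjoint A"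
    using assms by (auto simp: near_def)
  have "\<exists>c\<in>V. L c \<le> ennreal (r + s) \<and> cnorm A (a \<oplus> b \<ominus> c) < e" if e: "0 < e" for e
  proof -
    obtain a' where a': "a' \<in> V" "L a' \<le> ennreal r" "cnorm A (a \<ominus> a') < e / 2"
      using assms(1) e unfolding near_def by (meson half_gt_zero)
    obtain b' where b': "b' \<in> V" "L b' \<le> ennreal s" "cnorm A (b \<ominus> b') < e / 2"
      using assms(2) e unfolding near_def by (meson half_gt_zero)
    note c = selfadjoint_carrier[OF ab(1)] selfadjoint_carrier[OF ab(2)] V_carrier[OF a'(1)] V_carrier[OF b'(1)]
    have "L (a' \<oplus> b') \<le> L a' + L b'"
      by (intro L_add V_sa a' b')
    also have "\<dots> \<le> ennreal r + ennreal s"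
      by (intro add_mono a' b')
    finally have "L (a' \<oplus> b') \<le> ennreal (r + s)"
      using assms by simp
    moreover have "cnorm A (a \<oplus> b \<ominus> (a' \<oplus> b')) < e"
      using cnorm_triangle[of "a \<ominus> a'" "b \<ominus> b'"] a' b' c by (simp add: minus_add_minus minus_closed)
    ultimately show ?thesis
      using V_add a' b' by blast
  qed
  then show ?thesis
    using ab self_adjoint_add by (simp add: near_def)
qed

lemma near_smult:
  assumes "near a r" "0 \<le> r"
  shows "near (complex_of_real t \<odot> a) (\<bar>t\<bar> * r)"
proof -
  have a: "a \<in> self_adjoint A"
    using assms by (auto simp: near_def)
  have "\<exists>c\<in>V. L c \<le> ennreal (\<bar>t\<bar> * r) \<and> cnorm A (complex_of_real t \<odot> a \<ominus> c) < e" if e: "0 < e" for e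
  proof -
    have "0 < e / (\<bar>t\<bar> + 1)"
      using e by (simp add: add_nonneg_pos)
    then obtain b where b: "b \<in> V" "L b \<le> ennreal r" "cnorm A (a \<ominus> b) < e / (\<bar>t\<bar> + 1)"
      using assms(1) unfolding near_def by meson
    have "L (complex_of_real t \<odot> b) \<le> ennreal \<bar>t\<bar> * ennreal r"
      unfolding L_smult[OF V_sa[OF b(1)]] by (intro mult_left_mono b) simp
    then have "L (complex_of_real t \<odot> b) \<le> ennreal (\<bar>t\<bar> * r)"
      using assms(2) by (simp add: ennreal_mult)
    moreover have "cnorm A (complex_of_real t \<odot> a \<ominus> complex_of_real t \<odot> b) < e"
    proof -
      have "cnorm A (complex_of_real t \<odot> a \<ominus> complex_of_real t \<odot> b) = \<bar>t\<bar> * cnorm A (a \<ominus> b)"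
        using selfadjoint_carrier[OF a] V_carrier[OF b(1)]
        by (simp add: smult_minus cnorm_smult minus_closed)
      also have "\<dots> \<le> (\<bar>t\<bar> + 1) * cnorm A (a \<ominus> b)"
        using selfadjoint_carrier[OF a] V_carrier[OF b(1)]
        by (intro mult_right_mono) (simp_all add: cnorm_nonneg minus_closed)
      also have "\<dots> < e"
        using b(3) by (simp add: field_simps add_nonneg_pos)
      finally show ?thesis .
    qed
    ultimately show ?thesis
      using V_smult b(1) by blast
  qed
  then show ?thesis
    using a self_adjoint_smult by (simp add: near_def)
qed

text \<open>Here lower semicontinuity of \<open>L\<close> enters: sublevel sets are closed, so the
  bound on the approximants passes to their limit.\<close>

lemma near_imp_L_le:
  assumes "near a r"
  shows "L a \<le> ennreal r"
proof -
  have "a \<in> {a \<in> self_adjoint A. L a \<le> ennreal r}"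
    using lsc[of "ennreal r"] assms V_sa
    by (subst (asm) closedin_sa_iff) (auto simp: near_def, blast)
  then show ?thesis by simp
qed

lemma near_closed:
  assumes "a \<in> self_adjoint A" "\<And>e. 0 < e \<Longrightarrow> \<exists>b. near b r \<and> cnorm A (a \<ominus> b) < e"
  shows "near a r"
  unfolding near_def
proof (intro conjI allI impI)
  fix e :: real assume e: "0 < e"
  then obtain b where b: "near b r" "cnorm A (a \<ominus> b) < e / 2"
    using assms(2)[of "e / 2"] by auto
  then obtain c where c: "c \<in> V" "L c \<le> ennreal r" "cnorm A (b \<ominus> c) < e / 2"
    using e unfolding near_def by (meson half_gt_zero)
  have "cnorm A (a \<ominus> c) < e"
    using cnorm_triangle_minus[of a b c] selfadjoint_carrier[OF assms(1)] V_carrier[OF c(1)] b c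
      selfadjoint_carrier by (force simp: near_def)
  with c show "\<exists>b\<in>V. L b \<le> ennreal r \<and> cnorm A (a \<ominus> b) < e"
    by blast
qed (rule assms(1))

text \<open>The infimum in the Minkowski functional supplies radii above \<open>r\<close> only.
  Shrinking \<open>a\<close> slightly brings it to radius \<open>r\<close>, and closedness recovers
  \<open>a\<close> itself.\<close>

lemma near_right_continuous:
  assumes r: "0 < r" and near: "\<And>s. r < s \<Longrightarrow> near a s"
  shows "near a r"
proof (rule near_closed)
  show a: "a \<in> self_adjoint A"
    using near[of "r + 1"] by (simp add: near_def)
  then have ca: "a \<in> carrier A"
    by (rule selfadjoint_carrier)
  fix e :: real assume e: "0 < e"
  \<comment> \<open>Scaling by \<open>r / s = 1 / (1 + t)\<close> moves \<open>a\<close> by at most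
    \<open>t * cnorm A a < e\<close>; the summand 1 prevents division by 0.\<close>
  define t where "t = e / (cnorm A a + 1)"
  have n: "0 \<le> cnorm A a"
    using ca by (rule cnorm_nonneg)
  then have t: "0 < t" "t * cnorm A a < e"
    using e by (auto simp: t_def field_simps)
  define s where "s = r * (1 + t)"
  have s: "r < s" "0 < s"
    using r t by (simp_all add: s_def add_pos_pos)
  have "near (complex_of_real (r / s) \<odot> a) (\<bar>r / s\<bar> * s)"
    using near[OF s(1)] s by (intro near_smult) auto
  then have "near (complex_of_real (r / s) \<odot> a) r"
    using r s by simp
  moreover have "cnorm A (a \<ominus> complex_of_real (r / s) \<odot> a) < e"
  proof -
    have "a \<ominus> complex_of_real (r / s) \<odot> a = complex_of_real (1 - r / s) \<odot> a"
    proof -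
      have "a \<ominus> complex_of_real (r / s) \<odot> a = 1 \<odot> a \<oplus> (- complex_of_real (r / s)) \<odot> a"
        using ca by (simp add: minus_eq_smult smult_smult)
      also have "\<dots> = (1 + - complex_of_real (r / s)) \<odot> a"
        using ca by (simp only: smult_add_left)
      finally show ?thesis by simp
    qed
    then have eq: "cnorm A (a \<ominus> complex_of_real (r / s) \<odot> a) = \<bar>1 - r / s\<bar> * cnorm A a"
      using ca by (simp only: cnorm_smult norm_of_real)
    have "r / s = 1 / (1 + t)"
      using r by (simp add: s_def)
    then have "1 - r / s = t / (1 + t)"
      using t by (simp add: field_simps)
    moreover have "t / (1 + t) \<le> t"
      using t by (simp add: pos_divide_le_eq algebra_simps)
    ultimately have "\<bar>1 - r / s\<bar> \<le> t"
      using t by simp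
    then have "\<bar>1 - r / s\<bar> * cnorm A a \<le> t * cnorm A a"
      using n by (rule mult_right_mono)
    then show ?thesis
      using t eq by simp
  qed
  ultimately show "\<exists>b. near b r \<and> cnorm A (a \<ominus> b) < e"
    by blast
qed

definition Lbar :: "'a \<Rightarrow> ennreal" where
  "Lbar = minkowski A (norm_topology A closure_of {b \<in> V. L b \<le> 1})"

lemma Lbar_eq_Inf:
  assumes a: "a \<in> self_adjoint A"
  shows "Lbar a = Inf {ennreal r | r. 0 < r \<and> near a r}"
proof -
  have "near (complex_of_real (1 / r) \<odot> a) 1 \<longleftrightarrow> near a r" if r: "0 < r" for r
  proof
    assume "near (complex_of_real (1 / r) \<odot> a) 1"
    then have "near (complex_of_real r \<odot> (complex_of_real (1 / r) \<odot> a)) (\<bar>r\<bar> * 1)"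
      by (rule near_smult) simp
    moreover have "complex_of_real r \<odot> (complex_of_real (1 / r) \<odot> a) = a"
      using r selfadjoint_carrier[OF a] by (simp add: smult_smult)
    ultimately show "near a r"
      using r by simp
  next
    assume "near a r"
    then have "near (complex_of_real (1 / r) \<odot> a) (\<bar>1 / r\<bar> * r)"
      using r by (intro near_smult) simp_all
    then show "near (complex_of_real (1 / r) \<odot> a) 1"
      using r by simp
  qed
  then show ?thesis
    unfolding Lbar_def minkowski_def by (simp add: near_iff_closure cong: conj_cong)
qed

lemma Lbar_le_iff:
  assumes a: "a \<in> self_adjoint A" and r: "0 < r"
  shows "Lbar a \<le> ennreal r \<longleftrightarrow> near a r"
proof
  assume "near a r"
  then show "Lbar a \<le> ennreal r"
    unfolding Lbar_eq_Inf[OF a] using r by (intro Inf_lower) auto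
next
  assume le: "Lbar a \<le> ennreal r"
  show "near a r"
  proof (rule near_right_continuous[OF r])
    fix s assume s: "r < s"
    then have "Lbar a < ennreal s"
      using le r by (meson ennreal_lessI less_trans order_le_less_trans)
    then obtain t where "0 < t" "near a t" "ennreal t < ennreal s"
      unfolding Lbar_eq_Inf[OF a] Inf_less_iff by auto
    then show "near a s"
      using near_mono[of a t s] by (simp add: ennreal_less_iff)
  qed
qed

text \<open>This yields the kernel of the new seminorm and puts its unit ball inside that of
  \<open>L\<close>, as \<open>mk_metrizes_subalgebra\<close> asks.\<close>

lemma L_le_Lbar: "a \<in> self_adjoint A \<Longrightarrow> L a \<le> Lbar a"
  by (subst Lbar_eq_Inf) (auto intro!: Inf_greatest near_imp_L_le)

text \<open>The margin \<open>e\<close> keeps the radius positive, as \<open>Lbar_le_iff\<close>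
  demands, even when the value is 0.\<close>

lemma Lbar_finite_obtain:
  assumes "a \<in> self_adjoint A" "Lbar a < \<infinity>"
  obtains x where "0 \<le> x" "Lbar a = ennreal x" "\<And>e. 0 < e \<Longrightarrow> near a (x + e)"
proof -
  obtain x where x: "0 \<le> x" "Lbar a = ennreal x"
    using assms(2) by (cases "Lbar a") auto
  moreover have "near a (x + e)" if "0 < e" for e
    using Lbar_le_iff[OF assms(1), of "x + e"] x that by (simp add: ennreal_leI add_nonneg_pos)
  ultimately show thesis
    using that by blast
qed

lemma Lbar_le_of_near:
  assumes a: "a \<in> self_adjoint A" and x: "0 \<le> x" and near: "\<And>e. 0 < e \<Longrightarrow> near a (x + e)"
  shows "Lbar a \<le> ennreal x"
proof (rule ennreal_le_epsilon)
  fix e :: real assume e: "0 < e"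
  have "Lbar a \<le> ennreal (x + e)"
    using Lbar_le_iff[OF a, of "x + e"] near[OF e] x e by simp
  then show "Lbar a \<le> ennreal x + ennreal e"
    using x e by simp
qed

lemma Lbar_core: "a \<in> V \<Longrightarrow> Lbar a = L a"
proof (rule antisym)
  assume a: "a \<in> V"
  obtain x where x: "0 \<le> x" "L a = ennreal x"
    using a V_fin by (cases "L a") (auto simp: fin_dom_def)
  then show "Lbar a \<le> L a"
    using a by (auto intro!: Lbar_le_of_near V_sa near_core simp del: ennreal_plus)
  show "L a \<le> Lbar a"
    using a by (intro L_le_Lbar V_sa)
qed

lemma Lbar_unit_ball: "{a \<in> self_adjoint A. Lbar a \<le> 1} = norm_topology A closure_of {b \<in> V. L b \<le> 1}"
proof -
  have "a \<in> self_adjoint A \<and> Lbar a \<le> 1 \<longleftrightarrow> near a 1" for a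
    using Lbar_le_iff[of a 1] near_def by auto
  then show ?thesis
    using near_iff_closure[of _ 1] by auto
qed

lemma Lbar_seminorm: "seminorm_sa A Lbar"
  unfolding seminorm_sa_def
proof (intro conjI ballI allI)
  fix a b assume a: "a \<in> self_adjoint A" and b: "b \<in> self_adjoint A"
  show "Lbar (a \<oplus> b) \<le> Lbar a + Lbar b"
  proof (cases "Lbar a < \<infinity> \<and> Lbar b < \<infinity>")
    case True
    obtain x where x: "0 \<le> x" "Lbar a = ennreal x" "\<And>e. 0 < e \<Longrightarrow> near a (x + e)"
      using Lbar_finite_obtain[OF a] True by metis
    obtain y where y: "0 \<le> y" "Lbar b = ennreal y" "\<And>e. 0 < e \<Longrightarrow> near b (y + e)"
      using Lbar_finite_obtain[OF b] True by metis
    have "Lbar (a \<oplus> b) \<le> ennreal (x + y)"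
    proof (rule Lbar_le_of_near)
      show "near (a \<oplus> b) (x + y + e)" if "0 < e" for e
        using near_add[OF x(3)[of "e / 2"] y(3)[of "e / 2"]] that x(1) y(1) by (simp add: algebra_simps)
    qed (use a b x y self_adjoint_add in auto)
    then show ?thesis
      using x y by simp
  next
    case False
    then show ?thesis
      by (auto simp: not_less top_unique)
  qed
next
  fix r :: real and a assume a: "a \<in> self_adjoint A"
  \<comment> \<open>The reverse inequality comes from this one with \<open>1 / r\<close>, so
    \<open>r = 0\<close> is treated apart; there the convention \<open>0 * \<infinity> = 0\<close>
    leaves only the value at the zero vector.\<close>
  have le: "Lbar (complex_of_real t \<odot> b) \<le> ennreal \<bar>t\<bar> * Lbar b" if b: "b \<in> self_adjoint A" and t: "t \<noteq> 0" for t b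
  proof (cases "Lbar b < \<infinity>")
    case True
    obtain x where x: "0 \<le> x" "Lbar b = ennreal x" "\<And>e. 0 < e \<Longrightarrow> near b (x + e)"
      using Lbar_finite_obtain[OF b True] by metis
    have "Lbar (complex_of_real t \<odot> b) \<le> ennreal (\<bar>t\<bar> * x)"
    proof (rule Lbar_le_of_near)
      show "near (complex_of_real t \<odot> b) (\<bar>t\<bar> * x + e)" if "0 < e" for e
        using near_smult[OF x(3)[of "e / \<bar>t\<bar>"], of t] that x(1) t by (simp add: algebra_simps)
    qed (use b x self_adjoint_smult in auto)
    then show ?thesis
      using x by (simp add: ennreal_mult)
  next
    case False
    then show ?thesis
      using t by (simp add: not_less top_unique ennreal_mult_top)
  qed
  show "Lbar (complex_of_real r \<odot> a) = ennreal \<bar>r\<bar> * Lbar a"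
  proof (cases "r = 0")
    case True
    have "complex_of_real 0 \<odot> \<one> \<in> V"
      by (intro V_smult V_one)
    then have "\<zero> \<in> V"
      by (simp add: one_closed)
    moreover have "L \<zero> = 0"
      using L_smult[OF self_adjoint_zero, of 0] by simp
    ultimately have "Lbar \<zero> = 0"
      by (simp add: Lbar_core)
    then show ?thesis
      using True selfadjoint_carrier[OF a] by simp
  next
    case False
    have "complex_of_real (1 / r) \<odot> (complex_of_real r \<odot> a) = a"
      using False selfadjoint_carrier[OF a] by (simp add: smult_smult)
    then have "Lbar a \<le> ennreal \<bar>1 / r\<bar> * Lbar (complex_of_real r \<odot> a)"
      using le[OF self_adjoint_smult[OF a, of r], of "1 / r"] False by simp
    then have "ennreal \<bar>r\<bar> * Lbar a \<le> ennreal \<bar>r\<bar> * (ennreal \<bar>1 / r\<bar> * Lbar (complex_of_real r \<odot> a))"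
      by (rule mult_left_mono) simp
    also have "\<dots> = ennreal (\<bar>r\<bar> * \<bar>1 / r\<bar>) * Lbar (complex_of_real r \<odot> a)"
      by (simp only: ennreal_mult[symmetric] mult.assoc[symmetric] abs_ge_zero)
    also have "\<bar>r\<bar> * \<bar>1 / r\<bar> = 1"
      using False by (simp add: abs_mult[symmetric])
    finally have "ennreal \<bar>r\<bar> * Lbar a \<le> Lbar (complex_of_real r \<odot> a)"
      by simp
    then show ?thesis
      using le[OF a False] by simp
  qed
qed

text \<open>In the core the inequality is that of \<open>L\<close>, with norms and seminorms of the
  approximants at most \<open>e\<close> too large. Their products lie in the core and converge in
  norm, so \<open>near_closed\<close> carries the bound over. \<open>P\<close> is either of the two
  products.\<close>

lemma Lbar_leibniz:
  assumes a: "a \<in> fin_dom A Lbar" and b: "b \<in> fin_dom A Lbar"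
    and c: "cmod c = 1 / 2" "cmod d = 1"
    and P: "\<And>a b. a \<in> carrier A \<Longrightarrow> b \<in> carrier A \<Longrightarrow> P a b = c \<odot> (a \<otimes> b \<oplus> d \<odot> (b \<otimes> a))"
    and PV: "\<And>a b. a \<in> V \<Longrightarrow> b \<in> V \<Longrightarrow> P a b \<in> V"
    and Psa: "\<And>a b. a \<in> self_adjoint A \<Longrightarrow> b \<in> self_adjoint A \<Longrightarrow> P a b \<in> self_adjoint A"
    and PL: "\<And>a b. a \<in> fin_dom A L \<Longrightarrow> b \<in> fin_dom A L \<Longrightarrow> L (P a b)
        \<le> ennreal C * (ennreal (cnorm A a) * L b + ennreal (cnorm A b) * L a) + ennreal D * L a * L b"
  shows "Lbar (P a b) \<le> ennreal C * (ennreal (cnorm A a) * Lbar b + ennreal (cnorm A b) * Lbar a)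
      + ennreal D * Lbar a * Lbar b"
proof -
  have sa: "a \<in> self_adjoint A" "b \<in> self_adjoint A"
    using a b by (auto simp: fin_dom_def)
  note ca = selfadjoint_carrier[OF sa(1)] and cb = selfadjoint_carrier[OF sa(2)]
  obtain x where x: "0 \<le> x" "Lbar a = ennreal x" "\<And>e. 0 < e \<Longrightarrow> near a (x + e)"
    using Lbar_finite_obtain[OF sa(1)] a by (auto simp: fin_dom_def)
  obtain y where y: "0 \<le> y" "Lbar b = ennreal y" "\<And>e. 0 < e \<Longrightarrow> near b (y + e)"
    using Lbar_finite_obtain[OF sa(2)] b by (auto simp: fin_dom_def)
  define na nb where "na = cnorm A a" and "nb = cnorm A b"
  have n0: "0 \<le> na" "0 \<le> nb"
    using ca cb by (simp_all add: na_def nb_def cnorm_nonneg)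
  \<comment> \<open>The Leibniz bound with both norms and both seminorm values enlarged by
    \<open>e\<close>, the room the approximants need. It is positive, so \<open>Lbar_le_iff\<close>
    applies.\<close>
  define R where "R e = C * ((na + e) * (y + e) + (nb + e) * (x + e)) + D * (x + e) * (y + e)" for e
  have "Lbar (P a b) \<le> ennreal (R e)" if e: "0 < e" for e
  proof -
    have pos: "0 < na + e" "0 < nb + e" "0 < x + e" "0 < y + e"
      using e x(1) y(1) n0 by simp_all
    then have "0 < C * ((na + e) * (y + e) + (nb + e) * (x + e))"
      by (intro mult_pos_pos[OF _ add_pos_pos[OF mult_pos_pos[OF pos(1,4)] mult_pos_pos[OF pos(2,3)]]])
        (use C in simp)
    moreover have "0 \<le> D * (x + e) * (y + e)"
      using D pos by (intro mult_nonneg_nonneg) auto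
    ultimately have R0: "0 < R e"
      by (simp add: R_def)
    have "near (P a b) (R e)"
    proof (rule near_closed)
      show "P a b \<in> self_adjoint A"
        by (intro Psa sa)
      fix e' :: real assume e': "0 < e'"
      \<comment> \<open>The three bounds limit the growth of the norms to \<open>e\<close>, meet the
        hypothesis \<open>r \<le> 1\<close> of \<open>cnorm_commutator_diff\<close>, and make the
        error less than \<open>e'\<close>; 2 in place of 1 makes the last inequality strict.\<close>
      define s where "s = min (min e 1) (e' / (na + nb + 2))"
      have s: "0 < s" "s \<le> e" "s \<le> 1" "s \<le> e' / (na + nb + 2)"
        using e e' n0 by (auto simp: s_def)
      obtain a' where a': "a' \<in> V" "L a' \<le> ennreal (x + e)" "cnorm A (a \<ominus> a') < s"
        using x(3)[OF e] s(1) unfolding near_def by meson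
      obtain b' where b': "b' \<in> V" "L b' \<le> ennreal (y + e)" "cnorm A (b \<ominus> b') < s"
        using y(3)[OF e] s(1) unfolding near_def by meson
      note ca' = V_carrier[OF a'(1)] and cb' = V_carrier[OF b'(1)]
      have n: "cnorm A a' \<le> na + e" "cnorm A b' \<le> nb + e"
        using cnorm_le_add_minus[OF ca' ca] cnorm_le_add_minus[OF cb' cb] a' b' s
          cnorm_minus_commute[OF ca ca'] cnorm_minus_commute[OF cb cb'] by (simp_all add: na_def nb_def)
      have "L (P a' b') \<le> ennreal C * (ennreal (cnorm A a') * L b' + ennreal (cnorm A b') * L a')
          + ennreal D * L a' * L b'"
        using V_fin a' b' by (intro PL) auto
      also have "\<dots> \<le> ennreal C * (ennreal (na + e) * ennreal (y + e) + ennreal (nb + e) * ennreal (x + e))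
          + ennreal D * ennreal (x + e) * ennreal (y + e)"
        using a' b' n by (intro add_mono mult_mono ennreal_leI) auto
      also have "\<dots> = ennreal (R e)"
        using C D e x(1) y(1) n0
        by (simp add: R_def ennreal_mult'[symmetric] ennreal_plus[symmetric] del: ennreal_plus)
      finally have "near (P a' b') (R e)"
        by (intro near_core PV a' b')
      moreover have "cnorm A (P a b \<ominus> P a' b') < e'"
      proof -
        have "cnorm A (P a b \<ominus> P a' b') \<le> (na + nb + 1) * s"
          unfolding na_def nb_def
          by (rule cnorm_commutator_diff[OF ca cb ca' cb' c P]) (use a' b' s in auto)
        also have "\<dots> < (na + nb + 2) * s"
          using s by simp
        also have "\<dots> \<le> e'"
          using s(4) n0 by (simp add: field_simps)
        finally show ?thesis .
      qed
      ultimately show "\<exists>q. near q (R e) \<and> cnorm A (P a b \<ominus> q) < e'"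
        by blast
    qed
    then show ?thesis
      using Lbar_le_iff[OF Psa[OF sa] R0] by simp
  qed
  \<comment> \<open>The margin is removed along the sequence \<open>1 / (n + 1)\<close>, by
    continuity of \<open>R\<close>.\<close>
  moreover have "(\<lambda>n. ennreal (R (inverse (real (Suc n))))) \<longlonglongrightarrow> ennreal (R 0)"
    unfolding R_def by (intro tendsto_ennrealI tendsto_intros LIMSEQ_inverse_real_of_nat)
  ultimately have "Lbar (P a b) \<le> ennreal (R 0)"
    by (intro LIMSEQ_le_const[where X = "\<lambda>n. ennreal (R (inverse (real (Suc n))))"]) auto
  also have "ennreal (R 0) = ennreal C * (ennreal na * ennreal y + ennreal nb * ennreal x)
      + ennreal D * ennreal x * ennreal y"
    using C D x(1) y(1) n0
    by (simp add: R_def ennreal_mult'[symmetric] ennreal_plus[symmetric] del: ennreal_plus)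
  finally show ?thesis
    by (simp add: x(2) y(2) na_def nb_def)
qed

lemma jordan_lie_forms:
  assumes "a \<in> carrier A" "b \<in> carrier A"
  shows "jordan_prod A a b = (1 / 2) \<odot> (a \<otimes> b \<oplus> 1 \<odot> (b \<otimes> a))"
    "lie_prod A a b = (1 / (2 * \<i>)) \<odot> (a \<otimes> b \<oplus> (- 1) \<odot> (b \<otimes> a))"
  using assms by (simp_all add: jordan_prod_def lie_prod_def m_closed minus_eq_smult)

lemma Lbar_quasi_Leibniz: "quasi_Leibniz_qcms C D (A, Lbar)"
proof -
  have fin_V: "V \<subseteq> fin_dom A Lbar"
    using V_fin V_sa by (auto simp: fin_dom_def Lbar_core)
  have fin_sub: "fin_dom A Lbar \<subseteq> self_adjoint A"
    by (auto simp: fin_dom_def)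
  have max_le: "max (Lbar (jordan_prod A a b)) (Lbar (lie_prod A a b))
      \<le> ennreal C * (ennreal (cnorm A a) * Lbar b + ennreal (cnorm A b) * Lbar a) + ennreal D * Lbar a * Lbar b"
    if ab: "a \<in> fin_dom A Lbar" "b \<in> fin_dom A Lbar" for a b
  proof (rule max.boundedI)
    show "Lbar (jordan_prod A a b) \<le> ennreal C * (ennreal (cnorm A a) * Lbar b + ennreal (cnorm A b) * Lbar a)
        + ennreal D * Lbar a * Lbar b"
      by (rule Lbar_leibniz[OF ab _ _ jordan_lie_forms(1)])
        (use leibniz V_jordan jordan_prod_sa in auto)
    show "Lbar (lie_prod A a b) \<le> ennreal C * (ennreal (cnorm A a) * Lbar b + ennreal (cnorm A b) * Lbar a)
        + ennreal D * Lbar a * Lbar b"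
      by (rule Lbar_leibniz[OF ab _ _ jordan_lie_forms(2)])
        (use leibniz V_lie lie_prod_sa in \<open>auto simp: norm_divide norm_mult\<close>)
  qed
  have jl: "unital_jordan_lie_subalgebra (fin_dom A Lbar) A"
    unfolding unital_jordan_lie_subalgebra_def
  proof (intro conjI ballI allI)
    show "fin_dom A Lbar \<subseteq> self_adjoint A" "\<one> \<in> fin_dom A Lbar"
      using fin_sub fin_V V_one by auto
  next
    fix a b assume ab: "a \<in> fin_dom A Lbar" "b \<in> fin_dom A Lbar"
    then have sa: "a \<in> self_adjoint A" "b \<in> self_adjoint A" and lt: "Lbar a < \<infinity>" "Lbar b < \<infinity>"
      by (auto simp: fin_dom_def)
    have "Lbar (a \<oplus> b) \<le> Lbar a + Lbar b"
      using Lbar_seminorm sa by (simp add: seminorm_sa_def)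
    then have "Lbar (a \<oplus> b) < \<infinity>"
      by (rule order_le_less_trans) (use lt in simp)
    then show "a \<oplus> b \<in> fin_dom A Lbar"
      using sa by (simp add: fin_dom_def self_adjoint_add)
    have "max (Lbar (jordan_prod A a b)) (Lbar (lie_prod A a b)) < \<infinity>"
      by (rule order_le_less_trans[OF max_le[OF ab]]) (use lt in \<open>simp add: ennreal_mult_less_top\<close>)
    then show "jordan_prod A a b \<in> fin_dom A Lbar" "lie_prod A a b \<in> fin_dom A Lbar"
      using sa by (simp_all add: fin_dom_def jordan_prod_sa lie_prod_sa)
  next
    fix r :: real and a assume "a \<in> fin_dom A Lbar"
    then show "complex_of_real r \<odot> a \<in> fin_dom A Lbar"
      using Lbar_seminorm by (simp add: fin_dom_def seminorm_sa_def self_adjoint_smult ennreal_mult_less_top)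
  qed
  have dense: "norm_topology A closure_of (fin_dom A Lbar) = self_adjoint A"
  proof
    show "norm_topology A closure_of (fin_dom A Lbar) \<subseteq> self_adjoint A"
      using closedin_self_adjoint fin_sub by (rule closure_of_minimal[rotated])
    have "fin_dom A Lbar \<subseteq> carrier A"
      using fin_sub selfadjoint_carrier by blast
    then show "self_adjoint A \<subseteq> norm_topology A closure_of (fin_dom A Lbar)"
      using V_dense fin_V selfadjoint_carrier by (auto simp: norm_closure_iff) blast
  qed
  have ker: "{a \<in> self_adjoint A. Lbar a = 0} = {complex_of_real r \<odot> \<one> | r. True}"
  proof
    have "L a = 0" if "a \<in> self_adjoint A" "Lbar a = 0" for a
      using L_le_Lbar[OF that(1)] that(2) by simp
    then show "{a \<in> self_adjoint A. Lbar a = 0} \<subseteq> {complex_of_real r \<odot> \<one> | r. True}"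
      unfolding kernel[symmetric] by auto
    have "complex_of_real r \<odot> \<one> \<in> {a \<in> self_adjoint A. L a = 0}" for r
      unfolding kernel by blast
    then show "{complex_of_real r \<odot> \<one> | r. True} \<subseteq> {a \<in> self_adjoint A. Lbar a = 0}"
      using V_smult[OF V_one] by (auto simp: Lbar_core)
  qed
  have A: "A\<lparr>carrier := carrier A\<rparr> = A"
    by simp
  \<comment> \<open>The algebra is treated as a subalgebra of itself, with \<open>Lbar\<close>
    dominating \<open>L\<close>.\<close>
  have mk: "mk_metrizes_weak_star (A\<lparr>carrier := carrier A\<rparr>) Lbar"
  proof (rule mk_metrizes_subalgebra)
    show "L a \<le> 1" if "a \<in> self_adjoint (A\<lparr>carrier := carrier A\<rparr>)" "Lbar a \<le> 1" for a
      using L_le_Lbar that by (auto intro: order_trans)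
    show "\<exists>b\<in>self_adjoint (A\<lparr>carrier := carrier A\<rparr>).
        Lbar b < \<infinity> \<and> cnorm A (a \<ominus>\<^bsub>A\<lparr>carrier := carrier A\<rparr>\<^esub> b) < e"
      if "a \<in> self_adjoint (A\<lparr>carrier := carrier A\<rparr>)" "0 < e" for a e
      using V_dense[of a e] that fin_V unfolding A by (auto simp: fin_dom_def)
  qed (simp_all add: Lbar_seminorm unital_cstar_algebra_axioms)
  have closed: "closedin (subtopology (norm_topology A) (self_adjoint A)) {a \<in> self_adjoint A. Lbar a \<le> r}" for r
    unfolding closedin_sa_iff[of "{a \<in> self_adjoint A. Lbar a \<le> r}", OF Collect_restrict]
  proof (intro ballI impI CollectI conjI)
    fix a assume a: "a \<in> self_adjoint A"
      and lim: "\<forall>e>0. \<exists>b\<in>{a \<in> self_adjoint A. Lbar a \<le> r}. cnorm A (a \<ominus> b) < e"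
    show "a \<in> self_adjoint A" by (rule a)
    show "Lbar a \<le> r"
    proof (cases r)
      case (real x)
      have "Lbar a \<le> ennreal x"
      proof (rule Lbar_le_of_near[OF a real(1)])
        fix e :: real assume e: "0 < e"
        show "near a (x + e)"
        proof (rule near_closed[OF a])
          fix e' :: real assume "0 < e'"
          then obtain b where b: "b \<in> self_adjoint A" "Lbar b \<le> ennreal x" "cnorm A (a \<ominus> b) < e'"
            using lim real by auto
          have "Lbar b \<le> ennreal (x + e)"
            using b(2) by (rule order_trans) (use e in \<open>simp add: ennreal_leI\<close>)
          then show "\<exists>b. near b (x + e) \<and> cnorm A (a \<ominus> b) < e'"
            using b Lbar_le_iff[OF b(1), of "x + e"] e real(1) by (auto simp del: ennreal_plus)
        qed
      qed
      with real show ?thesis by simp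
    qed simp
  qed
  show ?thesis
    unfolding quasi_Leibniz_qcms_def prod.case
    using unital_cstar_algebra_axioms Lbar_seminorm jl dense ker max_le mk closed by (simp add: A)
qed

end

text \<open>By \<open>fin\<close> the domain is the whole self-adjoint part of \<open>S\<close>,
  which settles density and stability under products; the rest restricts from \<open>A\<close>.
  Requiring only agreement of \<open>M\<close> with \<open>L\<close> lets the lemma serve both
  seminorms of the theorem.\<close>

lemma (in lip_core) subalgebra_quasi_Leibniz:
  assumes S: "cstar_subalgebra S A" and one: "\<one> \<in> S"
    and fin: "self_adjoint (A\<lparr>carrier := S\<rparr>) \<subseteq> fin_dom A L"
    and M: "\<And>a. a \<in> self_adjoint (A\<lparr>carrier := S\<rparr>) \<Longrightarrow> M a = L a"
  shows "quasi_Leibniz_qcms C D (A\<lparr>carrier := S\<rparr>, M)"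
proof -
  let ?B = "A\<lparr>carrier := S\<rparr>"
  interpret B: unital_cstar_algebra ?B
    by (rule subalgebra_unital_cstar_algebra[OF S one])
  have sub: "S \<subseteq> carrier A"
    using S submodule.axioms(1) subgroup.subset by (fastforce simp: cstar_subalgebra_def)
  have smult: "c \<odot> x \<in> S" if "x \<in> S" for c x
    using B.smult_in[of x c] that by simp
  have minus: "x \<ominus>\<^bsub>?B\<^esub> y = x \<ominus> y" if "x \<in> S" "y \<in> S" for x y
    using that smult by (intro subalgebra_minus B.ring_A sub)
  have sa: "a \<in> self_adjoint A" "a \<in> S" "a \<in> carrier A" if "a \<in> self_adjoint ?B" for a
    using that sub by (auto simp: self_adjoint_def)
  have finB: "fin_dom ?B M = self_adjoint ?B"
    using fin M by (auto simp: fin_dom_def)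
  have jordan: "jordan_prod ?B a b = jordan_prod A a b" for a b
    by (simp add: jordan_prod_def)
  have lie: "lie_prod ?B a b = lie_prod A a b" if "a \<in> S" "b \<in> S" for a b
    using that B.m_closed by (simp add: lie_prod_def minus)
  have seminorm: "seminorm_sa ?B M"
    unfolding seminorm_sa_def
  proof (intro conjI ballI allI)
    fix a b assume a: "a \<in> self_adjoint ?B" and b: "b \<in> self_adjoint ?B"
    show "M (a \<oplus>\<^bsub>?B\<^esub> b) \<le> M a + M b"
      using L_add[OF sa(1)[OF a] sa(1)[OF b]] M[OF B.self_adjoint_add[OF a b]] M[OF a] M[OF b] by simp
  next
    fix r :: real and a assume a: "a \<in> self_adjoint ?B"
    show "M (complex_of_real r \<odot>\<^bsub>?B\<^esub> a) = ennreal \<bar>r\<bar> * M a"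
      using L_smult[OF sa(1)[OF a], of r] M[OF B.self_adjoint_smult[OF a, of r]] M[OF a] by simp
  qed
  have "unital_jordan_lie_subalgebra (fin_dom ?B M) ?B"
    unfolding unital_jordan_lie_subalgebra_def finB
    using B.self_adjoint_one B.self_adjoint_add B.self_adjoint_smult B.jordan_prod_sa B.lie_prod_sa
    by auto
  moreover have "norm_topology ?B closure_of (fin_dom ?B M) = self_adjoint ?B"
    unfolding finB using B.closedin_self_adjoint by (simp add: closure_of_closedin)
  moreover have "{a \<in> self_adjoint ?B. M a = 0} = {complex_of_real r \<odot>\<^bsub>?B\<^esub> \<one>\<^bsub>?B\<^esub> | r. True}"
  proof -
    have "a \<in> {a \<in> self_adjoint ?B. M a = 0} \<longleftrightarrow> a \<in> self_adjoint ?B \<and> a \<in> {a \<in> self_adjoint A. L a = 0}" for a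
      using M sa by auto
    moreover have "complex_of_real r \<odot> \<one> \<in> self_adjoint ?B" for r
      using B.self_adjoint_smult[OF B.self_adjoint_one, of r] by simp
    ultimately show ?thesis
      unfolding kernel by auto
  qed
  moreover have "\<forall>a\<in>fin_dom ?B M. \<forall>b\<in>fin_dom ?B M. max (M (jordan_prod ?B a b)) (M (lie_prod ?B a b))
      \<le> ennreal C * (ennreal (cnorm ?B a) * M b + ennreal (cnorm ?B b) * M a) + ennreal D * M a * M b"
  proof (intro ballI)
    fix a b assume "a \<in> fin_dom ?B M" "b \<in> fin_dom ?B M"
    then have ab: "a \<in> self_adjoint ?B" "b \<in> self_adjoint ?B"
      unfolding finB .
    show "max (M (jordan_prod ?B a b)) (M (lie_prod ?B a b))
        \<le> ennreal C * (ennreal (cnorm ?B a) * M b + ennreal (cnorm ?B b) * M a) + ennreal D * M a * M b"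
      using leibniz[of a b] fin ab M[OF B.jordan_prod_sa[OF ab]] M[OF B.lie_prod_sa[OF ab]]
      unfolding M[OF ab(1)] M[OF ab(2)] jordan lie[OF sa(2)[OF ab(1)] sa(2)[OF ab(2)]] by auto
  qed
  moreover have "mk_metrizes_weak_star ?B M"
  proof (rule mk_metrizes_subalgebra[OF B.unital_cstar_algebra_axioms sub seminorm])
    show "L a \<le> 1" if "a \<in> self_adjoint ?B" "M a \<le> 1" for a
      using that M by simp
    show "\<exists>b\<in>self_adjoint ?B. M b < \<infinity> \<and> cnorm A (a \<ominus>\<^bsub>?B\<^esub> b) < e" if a: "a \<in> self_adjoint ?B" "0 < e" for a e
    proof (intro bexI[of _ a] conjI)
      show "M a < \<infinity>"
        using a(1) M fin by (auto simp: fin_dom_def)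
      have "a \<ominus> a = \<zero>"
        using sa(3)[OF a(1)] by (simp add: minus_eq_zero_iff)
      then show "cnorm A (a \<ominus>\<^bsub>?B\<^esub> a) < e"
        using minus[OF sa(2)[OF a(1)] sa(2)[OF a(1)]] a(2) by simp
    qed (rule a(1))
  qed
  moreover have "closedin (subtopology (norm_topology ?B) (self_adjoint ?B)) {a \<in> self_adjoint ?B. M a \<le> r}" for r
    unfolding B.closedin_sa_iff[of "{a \<in> self_adjoint ?B. M a \<le> r}", OF Collect_restrict]
  proof (intro ballI impI CollectI conjI)
    fix a assume a: "a \<in> self_adjoint ?B"
      and lim: "\<forall>e>0. \<exists>b\<in>{a \<in> self_adjoint ?B. M a \<le> r}. cnorm ?B (a \<ominus>\<^bsub>?B\<^esub> b) < e"
    show "a \<in> self_adjoint ?B" by (rule a)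
    have "\<exists>b\<in>{a \<in> self_adjoint A. L a \<le> r}. cnorm A (a \<ominus> b) < e" if e: "0 < e" for e
    proof -
      obtain b where b: "b \<in> self_adjoint ?B" "M b \<le> r" "cnorm ?B (a \<ominus>\<^bsub>?B\<^esub> b) < e"
        using lim e by auto
      then show ?thesis
        using sa[OF b(1)] M[OF b(1)] minus[OF sa(2)[OF a] sa(2)[OF b(1)]] by auto
    qed
    then have "a \<in> {a \<in> self_adjoint A. L a \<le> r}"
      using lsc[of r] sa(1)[OF a] unfolding closedin_sa_iff[of "{a \<in> self_adjoint A. L a \<le> r}", OF Collect_restrict]
      by blast
    then show "M a \<le> r"
      using M[OF a] by simp
  qed
  ultimately show ?thesis
    unfolding quasi_Leibniz_qcms_def prod.case
    using B.unital_cstar_algebra_axioms seminorm by blast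
qed

section \<open>Transport along an injection and bridges\<close>

text \<open>Transport of structure along \<open>i\<close>, which will place a copy of
  \<open>A\<close> over the type of bridge algebras. \<open>inv_into\<close> makes the operations
  total on the target type.\<close>

definition image_cstar :: "('a \<Rightarrow> 'b) \<Rightarrow> 'a cstar \<Rightarrow> 'b cstar" where
  "image_cstar i A = (let j = inv_into (carrier A) i in
     \<lparr>carrier = i ` carrier A, mult = \<lambda>x y. i (j x \<otimes>\<^bsub>A\<^esub> j y), one = i \<one>\<^bsub>A\<^esub>, zero = i \<zero>\<^bsub>A\<^esub>,
      add = \<lambda>x y. i (j x \<oplus>\<^bsub>A\<^esub> j y), smult = \<lambda>c x. i (c \<odot>\<^bsub>A\<^esub> j x),
      adj = \<lambda>x. i (adj A (j x)), cnorm = \<lambda>x. cnorm A (j x)\<rparr>)"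

locale image_algebra = unital_cstar_algebra A for A :: "'a cstar" (structure) +
  fixes i :: "'a \<Rightarrow> 'b"
  assumes inj: "inj_on i (carrier A)"
begin

abbreviation "E \<equiv> image_cstar i A"

lemma image_simps [simp]:
  "carrier E = i ` carrier A" "\<one>\<^bsub>E\<^esub> = i \<one>" "\<zero>\<^bsub>E\<^esub> = i \<zero>"
  "x \<in> carrier A \<Longrightarrow> y \<in> carrier A \<Longrightarrow> i x \<otimes>\<^bsub>E\<^esub> i y = i (x \<otimes> y)"
  "x \<in> carrier A \<Longrightarrow> y \<in> carrier A \<Longrightarrow> i x \<oplus>\<^bsub>E\<^esub> i y = i (x \<oplus> y)"
  "x \<in> carrier A \<Longrightarrow> c \<odot>\<^bsub>E\<^esub> i x = i (c \<odot> x)"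
  "x \<in> carrier A \<Longrightarrow> adj E (i x) = i (adj A x)"
  "x \<in> carrier A \<Longrightarrow> cnorm E (i x) = cnorm A x"
  by (simp_all add: image_cstar_def Let_def inj)

lemma inj_eq: "x \<in> carrier A \<Longrightarrow> y \<in> carrier A \<Longrightarrow> i x = i y \<longleftrightarrow> x = y"
  using inj by (auto simp: inj_on_def)

lemma ring_image: "ring E"
proof -
  have "\<exists>y\<in>carrier E. y \<oplus>\<^bsub>E\<^esub> x = \<zero>\<^bsub>E\<^esub>" if x: "x \<in> carrier E" for x
  proof -
    obtain u where u: "u \<in> carrier A" "x = i u"
      using x by auto
    have "(\<ominus> u) \<oplus> u = \<zero>"
      using u by (simp add: l_neg)
    then show ?thesis
      using u a_inv_closed[of u] by (intro bexI[of _ "i (\<ominus> u)"]) auto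
  qed
  then have "abelian_group E"
    by (intro abelian_groupI)
      (auto simp: a_closed zero_closed a_assoc a_comm a_lcomm l_zero)
  then show ?thesis
    by (intro ringI monoidI)
      (auto simp: m_closed a_closed one_closed m_assoc l_one r_one l_distr r_distr)
qed

lemma minus_image: "x \<in> carrier A \<Longrightarrow> y \<in> carrier A \<Longrightarrow> i x \<ominus>\<^bsub>E\<^esub> i y = i (x \<ominus> y)"
proof -
  assume x: "x \<in> carrier A" and y: "y \<in> carrier A"
  have "i (\<ominus> y) \<oplus>\<^bsub>E\<^esub> i y = \<zero>\<^bsub>E\<^esub>"
    using y by (simp add: a_inv_closed l_neg)
  then have "\<ominus>\<^bsub>E\<^esub> i y = i (\<ominus> y)"
    using y by (intro abelian_group.minus_equality[OF ring.is_abelian_group[OF ring_image]])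
      (auto simp: a_inv_closed)
  then show ?thesis
    using x y ring.ring_simprules(14)[OF ring_image, of "i x" "i y"] by (simp add: a_inv_closed minus_eq)
qed

lemma unital_cstar_algebra_image: "unital_cstar_algebra E"
proof -
  have M: "module complex_ring E"
    by (intro moduleI cring_complex_ring ring.is_abelian_group ring_image)
      (auto simp: smult_add_left smult_add_right smult_smult a_closed)
  have dist: "norm_dist E (i x) (i y) = norm_dist A x y" if "x \<in> carrier A" "y \<in> carrier A" for x y
    using that by (simp add: norm_dist_def minus_image minus_closed)
  have "Metric_space (i ` carrier A) (norm_dist E)"
  proof
    fix x y z
    show "0 \<le> norm_dist E x y" "norm_dist E x y = norm_dist E y x"
      by (auto simp: norm_dist_def minus_image minus_closed cnorm_nonneg cnorm_minus_commute)
    show "norm_dist E x y = 0 \<longleftrightarrow> x = y" if "x \<in> i ` carrier A" "y \<in> i ` carrier A"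
      using that by (auto simp: dist inj_eq)
    show "norm_dist E x z \<le> norm_dist E x y + norm_dist E y z"
      if "x \<in> i ` carrier A" "y \<in> i ` carrier A" "z \<in> i ` carrier A"
      using that by (auto simp: dist norm.triangle)
  qed
  then interpret img: Metric_space "i ` carrier A" "norm_dist E" .
  have "img.mcomplete"
    unfolding img.mcomplete_def
  proof (intro allI impI)
    fix \<sigma> assume \<sigma>: "img.MCauchy \<sigma>"
    then have "range \<sigma> \<subseteq> i ` carrier A"
      by (simp add: img.MCauchy_def)
    then have "\<forall>n. \<exists>x\<in>carrier A. \<sigma> n = i x"
      by blast
    then obtain \<tau> where \<tau>: "\<And>n. \<tau> n \<in> carrier A" "\<And>n. \<sigma> n = i (\<tau> n)"
      by metis
    have "norm.MCauchy \<tau>"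
      using \<sigma> \<tau> by (auto simp: img.MCauchy_def norm.MCauchy_def dist)
    then obtain l where "limitin norm.mtopology \<tau> l sequentially"
      using complete by (auto simp: norm.mcomplete_def)
    then have "l \<in> carrier A" "(\<lambda>n. norm_dist A (\<tau> n) l) \<longlonglongrightarrow> 0"
      by (auto simp: norm.limitin_metric_dist_null)
    then show "\<exists>x. limitin img.mtopology \<sigma> x sequentially"
      using \<tau> by (auto simp: img.limitin_metric_dist_null dist intro!: exI[of _ "i l"])
  qed
  then show ?thesis
    using ring_image M
    by (intro unital_cstar_algebra.intro unital_cstar_algebra_axioms.intro)
      (auto simp: inj_eq one_not_zero one_closed zero_closed m_closed a_closed
        smult_mult_left smult_mult_right adj_adj adj_add adj_smult adj_mult cnorm_nonneg
        cnorm_eq_zero cnorm_triangle cnorm_smult cnorm_mult cstar_identity)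
qed

lemma unital_star_mono_image:
  assumes "S \<subseteq> carrier A"
  shows "unital_star_mono (A\<lparr>carrier := S\<rparr>) E i"
  using assms inj unfolding unital_star_mono_def ring_hom_def
  by (auto simp: subset_iff intro: inj_on_subset)

text \<open>With the unit as pivot both defects are zero, and every state annihilates zero.\<close>

lemma level_states_image: "level_states E (i \<one>) = states E"
proof -
  interpret E: unital_cstar_algebra E
    by (rule unital_cstar_algebra_image)
  have "\<one> \<ominus> \<one> = \<zero>"
    using minus_eq_zero_iff[OF one_closed one_closed] by simp
  then have "\<one>\<^bsub>E\<^esub> \<ominus>\<^bsub>E\<^esub> adj E (i \<one>) \<otimes>\<^bsub>E\<^esub> i \<one> = i \<zero>" "\<one>\<^bsub>E\<^esub> \<ominus>\<^bsub>E\<^esub> i \<one> \<otimes>\<^bsub>E\<^esub> adj E (i \<one>) = i \<zero>"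
    by (simp_all add: one_closed l_one minus_image)
  moreover have "\<phi> (i \<zero>) = 0" if "\<phi> \<in> states E" for \<phi>
    using E.state_smult[OF that, of "i \<zero>" 0] by (simp add: zero_closed)
  ultimately show ?thesis
    by (auto simp: level_states_def)
qed

lemma compose_state:
  assumes B: "unital_cstar_algebra (A\<lparr>carrier := S\<rparr>)" and S: "S \<subseteq> carrier A" and \<phi>: "\<phi> \<in> states E"
  shows "compose S \<phi> i \<in> states (A\<lparr>carrier := S\<rparr>)"
proof -
  interpret B: unital_cstar_algebra "A\<lparr>carrier := S\<rparr>" by (rule B)
  interpret E: unital_cstar_algebra E
    by (rule unital_cstar_algebra_image)
  have cS: "x \<in> carrier A" if "x \<in> S" for x
    using S that by blast
  have "\<phi> (i (adj A x \<otimes> x)) \<in> \<real>\<^sub>\<ge>\<^sub>0" if "x \<in> S" for x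
    using E.state_positive[OF \<phi>, of "i x"] cS[OF that] by simp
  moreover have "\<phi> (i (x \<oplus> y)) = \<phi> (i x) + \<phi> (i y)" if "x \<in> S" "y \<in> S" for x y
    using E.state_add[OF \<phi>, of "i x" "i y"] cS that by simp
  moreover have "\<phi> (i (c \<odot> x)) = c * \<phi> (i x)" if "x \<in> S" for x c
    using E.state_smult[OF \<phi>, of "i x" c] cS that by simp
  moreover have "\<phi> (i \<one>) = 1"
    using E.state_one[OF \<phi>] by simp
  moreover have "x \<oplus> y \<in> S" "x \<otimes> y \<in> S" if "x \<in> S" "y \<in> S" for x y
    using B.a_closed[of x y] B.m_closed[of x y] that by simp_all
  moreover have "c \<odot> x \<in> S" "adj A x \<in> S" if "x \<in> S" for x c
    using B.smult_in[of x c] B.adj_closed[of x] that by simp_all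
  moreover have "\<one> \<in> S"
    using B.one_closed by simp
  ultimately show ?thesis
    by (simp add: states_def compose_def)
qed

text \<open>Restriction of states is surjective by \<open>state_extension\<close>; this is what
  makes the height of the inclusion bridge vanish.\<close>

lemma state_lifts_to_image:
  assumes B: "unital_cstar_algebra (A\<lparr>carrier := S\<rparr>)" and S: "S \<subseteq> carrier A"
    and \<psi>: "\<psi> \<in> states (A\<lparr>carrier := S\<rparr>)"
  obtains \<phi> where "\<phi> \<in> states E" "compose S \<phi> i = \<psi>"
proof -
  obtain \<psi>' where ext: "\<psi>' \<in> states A" "\<And>x. x \<in> S \<Longrightarrow> \<psi>' x = \<psi> x"
    using state_extension[OF unital_cstar_algebra_axioms B S \<psi>] by metis
  define \<phi> where "\<phi> = (\<lambda>y\<in>i ` carrier A. \<psi>' (inv_into (carrier A) i y))"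
  have \<phi>: "\<phi> (i x) = \<psi>' x" if "x \<in> carrier A" for x
    using that by (simp add: \<phi>_def inj)
  have "\<phi> \<in> extensional (i ` carrier A)"
    by (simp add: \<phi>_def)
  then have "\<phi> \<in> states E"
    using ext(1) by (auto simp: states_def \<phi> a_closed m_closed one_closed)
  moreover have "compose S \<phi> i = \<psi>"
  proof (rule extensionalityI)
    show "compose S \<phi> i \<in> extensional S"
      by (simp add: compose_def)
    show "\<psi> \<in> extensional S"
      using \<psi> by (simp add: states_def)
    show "compose S \<phi> i x = \<psi> x" if "x \<in> S" for x
      using that S by (auto simp: compose_def \<phi> ext(2) subset_iff)
  qed
  ultimately show thesis
    using that by blast
qed

end

lemma hausdorff_self_eq_0:
  assumes "\<And>x. x \<in> X \<Longrightarrow> d x x = 0"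
  shows "hausdorff d X X = 0"
proof -
  have "(INF y\<in>X. d x y) = 0" "(INF y\<in>X. d y x) = 0" if "x \<in> X" for x
    using INF_lower[of x X "d x"] INF_lower[of x X "\<lambda>y. d y x"] assms[OF that] that by simp_all
  then show ?thesis
    by (cases "X = {}") (simp_all add: hausdorff_def bot_ennreal)
qed

lemma mk_dist_self: "mk_dist A L \<phi> \<phi> = 0"
  unfolding mk_dist_def by (simp add: SUP_eq_const bot_ennreal image_constant_conv)

text \<open>The bridge given by the inclusion of a subalgebra, with pivot the unit, has height 0
  because states extend.\<close>

lemma propinquity_subalgebra_le:
  fixes i :: "'a \<Rightarrow> univ"
  assumes A: "unital_cstar_algebra A" and inj: "inj_on i (carrier A)"
    and B: "unital_cstar_algebra (A\<lparr>carrier := S\<rparr>)" and S: "S \<subseteq> carrier A"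
    and MN: "\<And>a. a \<in> self_adjoint (A\<lparr>carrier := S\<rparr>) \<Longrightarrow> M a \<le> 1 \<Longrightarrow> N a \<le> 1"
    and e: "0 \<le> e"
    and near: "\<And>b. b \<in> self_adjoint A \<Longrightarrow> N b \<le> 1 \<Longrightarrow>
      \<exists>a\<in>self_adjoint (A\<lparr>carrier := S\<rparr>). M a \<le> 1 \<and> cnorm A (a \<ominus>\<^bsub>A\<^esub> b) \<le> e"
  shows "propinquity C D (A\<lparr>carrier := S\<rparr>, M) (A, N) \<le> ennreal e"
proof -
  interpret image_algebra A i
    using A inj by (simp add: image_algebra_def image_algebra_axioms_def)
  let ?B = "A\<lparr>carrier := S\<rparr>"
  define \<gamma> :: "('a, 'a) bridge" where
    "\<gamma> = \<lparr>bridge_alg = E, left_emb = i, right_emb = i, pivot = i \<one>\<^bsub>A\<^esub>\<rparr>"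
  interpret E: unital_cstar_algebra E
    by (rule unital_cstar_algebra_image)
  have AA: "A\<lparr>carrier := carrier A\<rparr> = A"
    by simp
  have bridge: "is_bridge ?B A \<gamma>"
    using unital_star_mono_image[OF S] unital_star_mono_image[of "carrier A"] unital_cstar_algebra_image
      E.states_nonempty
    by (simp add: is_bridge_def \<gamma>_def level_states_image one_closed AA)
  \<comment> \<open>General \<open>T\<close>, because the height involves restrictions to the
    subalgebra and to \<open>A\<close> itself. In both cases a state space is compared with
    itself.\<close>
  have img: "(\<lambda>\<phi>. compose T \<phi> i) ` states E = states (A\<lparr>carrier := T\<rparr>)"
    if T: "unital_cstar_algebra (A\<lparr>carrier := T\<rparr>)" "T \<subseteq> carrier A" for T
  proof
    show "(\<lambda>\<phi>. compose T \<phi> i) ` states E \<subseteq> states (A\<lparr>carrier := T\<rparr>)"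
      using compose_state[OF T] by blast
    show "states (A\<lparr>carrier := T\<rparr>) \<subseteq> (\<lambda>\<phi>. compose T \<phi> i) ` states E"
    proof
      fix \<psi> assume "\<psi> \<in> states (A\<lparr>carrier := T\<rparr>)"
      then obtain \<phi> where "\<phi> \<in> states E" "compose T \<phi> i = \<psi>"
        by (rule state_lifts_to_image[OF T])
      then show "\<psi> \<in> (\<lambda>\<phi>. compose T \<phi> i) ` states E"
        by blast
    qed
  qed
  have imgA: "(\<lambda>\<phi>. compose (carrier A) \<phi> i) ` states E = states A"
    using img[of "carrier A"] A by (simp add: AA)
  have height: "bridge_height (?B, M) (A, N) \<gamma> = 0"
    by (simp add: bridge_height_def \<gamma>_def level_states_image img[OF B S] imgA hausdorff_self_eq_0 mk_dist_self)
  have saS: "a \<in> self_adjoint A" "a \<in> carrier A" if "a \<in> self_adjoint ?B" for a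
    using that S by (auto simp: self_adjoint_def)
  \<comment> \<open>With the unit as pivot, distances across the bridge are norm distances in
    \<open>A\<close>. By \<open>MN\<close> elements of the smaller ball are matched with themselves;
    the other direction costs \<open>e\<close>.\<close>
  have reach: "bridge_reach (?B, M) (A, N) \<gamma> \<le> ennreal e"
    unfolding bridge_reach_def prod.case Let_def hausdorff_def
  proof (intro max.boundedI SUP_least)
    fix a assume a: "a \<in> {a \<in> self_adjoint ?B. M a \<le> 1}"
    then have "a \<in> {b \<in> self_adjoint A. N b \<le> 1}"
      using MN saS by auto
    moreover have "cnorm A (a \<ominus>\<^bsub>A\<^esub> a) = 0"
      using a saS minus_eq_zero_iff[of a a] by simp
    ultimately show "(INF b\<in>{b \<in> self_adjoint A. N b \<le> 1}. ennreal (cnorm (bridge_alg \<gamma>)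
        (left_emb \<gamma> a \<otimes>\<^bsub>bridge_alg \<gamma>\<^esub> pivot \<gamma> \<ominus>\<^bsub>bridge_alg \<gamma>\<^esub> pivot \<gamma> \<otimes>\<^bsub>bridge_alg \<gamma>\<^esub> right_emb \<gamma> b))) \<le> ennreal e"
      using a saS e by (intro INF_lower2[of a])
        (simp_all add: \<gamma>_def one_closed r_one l_one minus_image minus_closed)
  next
    fix b assume b: "b \<in> {b \<in> self_adjoint A. N b \<le> 1}"
    then obtain a where "a \<in> self_adjoint ?B" "M a \<le> 1" "cnorm A (a \<ominus>\<^bsub>A\<^esub> b) \<le> e"
      using near by blast
    then show "(INF a\<in>{a \<in> self_adjoint ?B. M a \<le> 1}. ennreal (cnorm (bridge_alg \<gamma>)
        (left_emb \<gamma> a \<otimes>\<^bsub>bridge_alg \<gamma>\<^esub> pivot \<gamma> \<ominus>\<^bsub>bridge_alg \<gamma>\<^esub> pivot \<gamma> \<otimes>\<^bsub>bridge_alg \<gamma>\<^esub> right_emb \<gamma> b))) \<le> ennreal e"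
      using b saS selfadjoint_carrier
      by (intro INF_lower2[of a]) (simp_all add: \<gamma>_def one_closed r_one l_one minus_image minus_closed ennreal_leI)
  qed
  have "propinquity C D (?B, M) (A, N) \<le> bridge_length (?B, M) (A, N) \<gamma>"
    unfolding propinquity_def using bridge by (intro Inf_lower) auto
  also have "\<dots> \<le> ennreal e"
    unfolding bridge_length_def height using reach by simp
  finally show ?thesis .
qed

section \<open>Separability\<close>

context unital_cstar_algebra
begin

lemma cnorm_finsum_diff:
  assumes "finite B" "B \<subseteq> carrier A"
  shows "cnorm A ((\<Oplus>\<^bsub>A\<^esub>b\<in>B. c b \<odot> b) \<ominus> (\<Oplus>\<^bsub>A\<^esub>b\<in>B. c' b \<odot> b)) \<le> (\<Sum>b\<in>B. cmod (c b - c' b) * cnorm A b)"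
  using assms
proof (induction B)
  case empty
  then show ?case
    using minus_eq_zero_iff[of \<zero> \<zero>]
    by (simp add: abelian_monoid.finsum_empty[OF abelian_group.axioms(1)[OF abelian_group_A]] zero_closed)
next
  case (insert b B)
  note fs = abelian_monoid.finsum_insert[OF abelian_group.axioms(1)[OF abelian_group_A]]
    abelian_monoid.finsum_closed[OF abelian_group.axioms(1)[OF abelian_group_A]]
  have in_A: "(\<lambda>b. d b \<odot> b) \<in> B \<rightarrow> carrier A" for d
    using insert.prems by auto
  have b: "b \<in> carrier A"
    using insert.prems by simp
  let ?s = "\<lambda>d. \<Oplus>\<^bsub>A\<^esub>b\<in>B. d b \<odot> b"
  have s: "?s d \<in> carrier A" for d
    by (rule fs(2)[OF in_A])
  have eq: "(\<Oplus>\<^bsub>A\<^esub>b\<in>insert b B. d b \<odot> b) = d b \<odot> b \<oplus> ?s d" for d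
    using insert.hyps b by (intro fs(1) in_A) auto
  have "c b \<odot> b \<ominus> c' b \<odot> b = (c b - c' b) \<odot> b"
    using b smult_add_left[of b "c b" "- c' b"] by (simp add: minus_eq_smult smult_smult)
  then have "(\<Oplus>\<^bsub>A\<^esub>b\<in>insert b B. c b \<odot> b) \<ominus> (\<Oplus>\<^bsub>A\<^esub>b\<in>insert b B. c' b \<odot> b)
      = (c b - c' b) \<odot> b \<oplus> (?s c \<ominus> ?s c')"
    unfolding eq using s b by (simp add: minus_add_minus)
  then have "cnorm A ((\<Oplus>\<^bsub>A\<^esub>b\<in>insert b B. c b \<odot> b) \<ominus> (\<Oplus>\<^bsub>A\<^esub>b\<in>insert b B. c' b \<odot> b))
      \<le> cmod (c b - c' b) * cnorm A b + cnorm A (?s c \<ominus> ?s c')"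
    using cnorm_triangle[of "(c b - c' b) \<odot> b" "?s c \<ominus> ?s c'"] s b by (simp add: cnorm_smult minus_closed)
  then show ?case
    using insert by simp
qed

text \<open>Linear combinations of a finite spanning set with coefficients from a countable dense
  set of complex numbers.\<close>

lemma finite_dimensional_separable:
  assumes S: "finite_dimensional S A" "S \<subseteq> carrier A"
  obtains Q where "countable Q" "Q \<subseteq> carrier A" "\<And>x e. x \<in> S \<Longrightarrow> 0 < e \<Longrightarrow> \<exists>q\<in>Q. cnorm A (x \<ominus> q) < e"
proof -
  obtain B where B: "finite B" "B \<subseteq> S" "S = {\<Oplus>\<^bsub>A\<^esub>b\<in>B. c b \<odot> b | c :: 'a \<Rightarrow> complex. True}"
    using S(1) by (auto simp: finite_dimensional_def)
  obtain Z :: "complex set" where Z: "countable Z" "\<And>X. open X \<Longrightarrow> X \<noteq> {} \<Longrightarrow> \<exists>d\<in>Z. d \<in> X"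
    using countable_dense_exists by metis
  have BA: "B \<subseteq> carrier A"
    using B(2) S(2) by blast
  define Q where "Q = (\<lambda>c. \<Oplus>\<^bsub>A\<^esub>b\<in>B. c b \<odot> b) ` (\<Pi>\<^sub>E b\<in>B. Z)"
  have "countable Q"
    unfolding Q_def by (intro countable_image countable_PiE B Z(1))
  moreover have "Q \<subseteq> carrier A"
    unfolding Q_def using BA
    by (auto intro!: abelian_monoid.finsum_closed[OF abelian_group.axioms(1)[OF abelian_group_A]])
  moreover have "\<exists>q\<in>Q. cnorm A (x \<ominus> q) < e" if x: "x \<in> S" and e: "0 < e" for x e
  proof -
    obtain c where c: "x = (\<Oplus>\<^bsub>A\<^esub>b\<in>B. c b \<odot> b)"
      using x B(3) by auto
    \<comment> \<open>The summand 1 makes \<open>K\<close> positive and the total error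
      \<open>e / K * (K - 1)\<close> strictly smaller than \<open>e\<close>.\<close>
    define K where "K = (\<Sum>b\<in>B. cnorm A b) + 1"
    have K: "0 < K"
      using BA cnorm_nonneg by (auto simp: K_def intro!: add_nonneg_pos sum_nonneg)
    have "\<exists>z\<in>Z. cmod (c b - z) < e / K" for b
      using Z(2)[of "ball (c b) (e / K)"] divide_pos_pos[OF e K] by (auto simp: dist_norm)
    then obtain z where z: "\<And>b. z b \<in> Z" "\<And>b. cmod (c b - z b) < e / K"
      by metis
    define z' where "z' = restrict z B"
    have "cnorm A (x \<ominus> (\<Oplus>\<^bsub>A\<^esub>b\<in>B. z' b \<odot> b)) \<le> (\<Sum>b\<in>B. cmod (c b - z' b) * cnorm A b)"
      unfolding c by (rule cnorm_finsum_diff[OF B(1) BA])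
    also have "\<dots> \<le> (\<Sum>b\<in>B. e / K * cnorm A b)"
      using z(2) BA cnorm_nonneg by (intro sum_mono mult_right_mono) (auto simp: z'_def less_imp_le)
    also have "\<dots> = e / K * (K - 1)"
      by (simp add: K_def sum_distrib_left)
    also have "\<dots> < e"
      using K e by (simp add: field_simps)
    finally have "cnorm A (x \<ominus> (\<Oplus>\<^bsub>A\<^esub>b\<in>B. z' b \<odot> b)) < e" .
    moreover have "z' \<in> (\<Pi>\<^sub>E b\<in>B. Z)"
      using z(1) by (auto simp: z'_def)
    ultimately show ?thesis
      unfolding Q_def by blast
  qed
  ultimately show thesis
    using that by blast
qed

text \<open>An element is determined by its distances to a countable dense set.\<close>

lemma separable_injection:
  fixes F :: "nat \<Rightarrow> 'a set"
  assumes F: "\<And>n. finite_dimensional (F n) A" "\<And>n. F n \<subseteq> carrier A"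
    and dense: "\<And>x e. x \<in> carrier A \<Longrightarrow> 0 < e \<Longrightarrow> \<exists>n. \<exists>y\<in>F n. cnorm A (x \<ominus> y) < e"
  obtains i :: "'a \<Rightarrow> nat \<Rightarrow> real" where "inj_on i (carrier A)"
proof -
  have "\<exists>Q. countable Q \<and> Q \<subseteq> carrier A \<and> (\<forall>x\<in>F n. \<forall>e>0. \<exists>q\<in>Q. cnorm A (x \<ominus> q) < e)" for n
    using finite_dimensional_separable[OF F(1)[of n] F(2)[of n]] by metis
  then obtain Q where Q: "\<And>n. countable (Q n)" "\<And>n. Q n \<subseteq> carrier A"
    "\<And>n x e. x \<in> F n \<Longrightarrow> 0 < e \<Longrightarrow> \<exists>q\<in>Q n. cnorm A (x \<ominus> q) < e"
    by metis
  define R where "R = (\<Union>n. Q n)"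
  have R: "countable R" "R \<subseteq> carrier A"
    using Q(1,2) by (auto simp: R_def)
  have Rd: "\<exists>q\<in>R. cnorm A (x \<ominus> q) < e" if x: "x \<in> carrier A" and e: "0 < e" for x e
  proof -
    obtain n y where y: "y \<in> F n" "cnorm A (x \<ominus> y) < e / 2"
      using dense[OF x, of "e / 2"] e by auto
    obtain q where q: "q \<in> Q n" "cnorm A (y \<ominus> q) < e / 2"
      using Q(3)[OF y(1), of "e / 2"] e by auto
    have "y \<in> carrier A" "q \<in> carrier A"
      using y(1) q(1) F(2) Q(2) by blast+
    then have "cnorm A (x \<ominus> q) < e"
      using cnorm_triangle_minus[OF x, of y q] y(2) q(2) by simp
    then show ?thesis
      using q(1) by (auto simp: R_def)
  qed
  have "R \<noteq> {}"
    using Rd[OF one_closed, of 1] by auto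
  define i where "i x n = cnorm A (x \<ominus> from_nat_into R n)" for x n
  have "inj_on i (carrier A)"
  proof (rule inj_onI)
    fix x y assume x: "x \<in> carrier A" and y: "y \<in> carrier A" and eq: "i x = i y"
    have "cnorm A (x \<ominus> y) \<le> 0"
    proof (rule field_le_epsilon)
      fix e :: real assume "0 < e"
      then obtain q where q: "q \<in> R" "cnorm A (x \<ominus> q) < e / 2"
        using Rd[OF x, of "e / 2"] by auto
      obtain n where "from_nat_into R n = q"
        using from_nat_into_surj[OF R(1) q(1)] by blast
      then have "cnorm A (y \<ominus> q) = cnorm A (x \<ominus> q)"
        using fun_cong[OF eq, of n] by (simp add: i_def)
      then show "cnorm A (x \<ominus> y) \<le> 0 + e"
        using cnorm_triangle_minus[of x q y] cnorm_minus_commute[of q y] x y q R(2) by auto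
    qed
    then have "cnorm A (x \<ominus> y) = 0"
      using cnorm_nonneg[of "x \<ominus> y"] x y by (simp add: minus_closed)
    then show "x = y"
      using x y by (simp add: cnorm_eq_zero minus_closed minus_eq_zero_iff)
  qed
  then show thesis
    using that by blast
qed

text \<open>Since real parts do not increase norms, this lets approximants of self-adjoint elements
  be replaced by their real parts.\<close>

lemma re_part_minus:
  assumes "x \<in> carrier A" "y \<in> carrier A"
  shows "re_part (x \<ominus> y) = re_part x \<ominus> re_part y"
  using assms
  by (simp add: re_part_def adj_minus smult_minus[symmetric] minus_add_minus[symmetric])

end

section \<open>The approximation theorem\<close>

theorem proposition4p5:
  fixes C D :: real
    and A :: "'a cstar"
    and L Lf Lbar :: "'a \<Rightarrow> ennreal"
    and An :: "nat \<Rightarrow> 'a set"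
    and saU Lf_ball :: "'a set"
  assumes "C \<ge> 1" and "D \<ge> 0"
    and "unital_AF_algebra A"
    and "quasi_Leibniz_qcms C D (A, L)"
    and "mono An"
    and "\<And>n. cstar_subalgebra (An n) A"
    and "\<And>n. \<one>\<^bsub>A\<^esub> \<in> An n"
    and "\<And>n. finite_dimensional (An n) A"
    and "carrier A = norm_topology A closure_of (\<Union>n. An n)"
    and saU_def: "saU = {a \<in> (\<Union>n. An n). adj A a = a}"
    and "saU \<subseteq> fin_dom A L"
    and Lf_def: "Lf = (\<lambda>a. if a \<in> saU then L a else \<infinity>)"
    and Lf_ball_def: "Lf_ball = norm_topology A closure_of {a \<in> self_adjoint A. Lf a \<le> 1}"
    and Lbar_def: "Lbar = minkowski A Lf_ball"
  shows "(\<forall>a\<in>saU. Lbar a = Lf a \<and> Lf a = L a \<and> L a < \<infinity>) \<and>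
    {a \<in> self_adjoint A. Lbar a \<le> 1} = norm_topology A closure_of {a \<in> saU. Lbar a \<le> 1} \<and>
    norm_topology A closure_of {a \<in> saU. Lbar a \<le> 1}
      = norm_topology A closure_of {a \<in> saU. L a \<le> 1} \<and>
    quasi_Leibniz_qcms C D (A, Lbar) \<and>
    (\<forall>n. (\<forall>a\<in>self_adjoint (A\<lparr>carrier := An n\<rparr>). Lbar a = L a) \<and>
      quasi_Leibniz_qcms C D (A\<lparr>carrier := An n\<rparr>, Lbar) \<and>
      quasi_Leibniz_qcms C D (A\<lparr>carrier := An n\<rparr>, L)) \<and>
    (\<lambda>n. propinquity C D (A\<lparr>carrier := An n\<rparr>, Lbar) (A, Lbar)) \<longlonglongrightarrow> 0"
proof -
  note qL = assms(4)[unfolded quasi_Leibniz_qcms_def prod.case]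
  interpret unital_cstar_algebra A
    using qL by simp
  have B: "unital_cstar_algebra (A\<lparr>carrier := An n\<rparr>)" for n
    by (rule subalgebra_unital_cstar_algebra[OF assms(6,7)])
  have sub: "An n \<subseteq> carrier A" for n
    using assms(6)[of n] submodule.axioms(1) subgroup.subset by (fastforce simp: cstar_subalgebra_def)
  have mono: "An m \<subseteq> An n" if "m \<le> n" for m n
    using assms(5) that by (simp add: mono_def)
  have saU: "self_adjoint (A\<lparr>carrier := An n\<rparr>) \<subseteq> saU" for n
    by (auto simp: self_adjoint_def saU_def)
  \<comment> \<open>The union is directed, so an operation on two core elements takes place in a
    single subalgebra.\<close>
  have two: "\<exists>n. a \<in> self_adjoint (A\<lparr>carrier := An n\<rparr>) \<and> b \<in> self_adjoint (A\<lparr>carrier := An n\<rparr>)"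
    if ab: "a \<in> saU" "b \<in> saU" for a b
  proof -
    obtain m n where "a \<in> An m" "b \<in> An n" "adj A a = a" "adj A b = b"
      using ab by (auto simp: saU_def)
    then have "a \<in> An (max m n)" "b \<in> An (max m n)"
      using mono[of m "max m n"] mono[of n "max m n"] by auto
    with \<open>adj A a = a\<close> \<open>adj A b = b\<close> show ?thesis
      by (auto simp: self_adjoint_def)
  qed
  have approx: "\<exists>y\<in>\<Union>n. An n. cnorm A (x \<ominus>\<^bsub>A\<^esub> y) < e" if "x \<in> carrier A" "0 < e" for x e
  proof -
    have "(\<Union>n. An n) \<subseteq> carrier A"
      using sub by blast
    from norm_closure_iff[OF this, of x] show ?thesis
      using assms(9) that by blast
  qed
  interpret core: lip_core A L C D saU
  proof
    show "mk_metrizes_weak_star A L" "1 \<le> C" "0 \<le> D" "seminorm_sa A L" "saU \<subseteq> fin_dom A L"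
      "{a \<in> self_adjoint A. L a = 0} = {complex_of_real r \<odot>\<^bsub>A\<^esub> \<one>\<^bsub>A\<^esub> | r. True}"
      using qL assms by simp_all
    show "max (L (jordan_prod A a b)) (L (lie_prod A a b))
        \<le> ennreal C * (ennreal (cnorm A a) * L b + ennreal (cnorm A b) * L a) + ennreal D * L a * L b"
      if "a \<in> fin_dom A L" "b \<in> fin_dom A L" for a b
      using qL that by blast
    show "closedin (subtopology (norm_topology A) (self_adjoint A)) {a \<in> self_adjoint A. L a \<le> r}" for r
      using qL by blast
    show "\<one>\<^bsub>A\<^esub> \<in> saU"
      using assms(7) by (auto simp: saU_def)
  next
    fix a b assume "a \<in> saU" "b \<in> saU"
    then obtain n where ab: "a \<in> self_adjoint (A\<lparr>carrier := An n\<rparr>)" "b \<in> self_adjoint (A\<lparr>carrier := An n\<rparr>)"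
      using two by blast
    interpret An: unital_cstar_algebra "A\<lparr>carrier := An n\<rparr>"
      by (rule B)
    show "a \<oplus>\<^bsub>A\<^esub> b \<in> saU"
      using An.self_adjoint_add[OF ab] saU by auto
    show "jordan_prod A a b \<in> saU"
      using An.jordan_prod_sa[OF ab] saU by (auto simp: jordan_prod_def)
    have "a \<otimes>\<^bsub>A\<^esub> b \<in> An n" "b \<otimes>\<^bsub>A\<^esub> a \<in> An n"
      using An.m_closed[of a b] An.m_closed[of b a] ab by (auto simp: self_adjoint_def)
    moreover have "c \<odot>\<^bsub>A\<^esub> x \<in> An n" if "x \<in> An n" for c x
      using An.smult_in[of x c] that by simp
    ultimately have "lie_prod (A\<lparr>carrier := An n\<rparr>) a b = lie_prod A a b"
      using subalgebra_minus[OF An.ring_A sub] by (simp add: lie_prod_def)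
    then show "lie_prod A a b \<in> saU"
      using An.lie_prod_sa[OF ab] saU by auto
  next
    fix r :: real and a assume "a \<in> saU"
    then obtain n where a: "a \<in> self_adjoint (A\<lparr>carrier := An n\<rparr>)"
      using two by blast
    show "complex_of_real r \<odot>\<^bsub>A\<^esub> a \<in> saU"
      using unital_cstar_algebra.self_adjoint_smult[OF B a] saU by auto
  next
    fix a and e :: real assume a: "a \<in> self_adjoint A" and e: "0 < e"
    then have ca: "a \<in> carrier A"
      by (simp add: self_adjoint_def)
    then obtain n y where y: "y \<in> An n" "cnorm A (a \<ominus>\<^bsub>A\<^esub> y) < e"
      using approx[OF ca e] by blast
    interpret An: unital_cstar_algebra "A\<lparr>carrier := An n\<rparr>"
      by (rule B)
    have cy: "y \<in> carrier A"
      using y(1) sub by blast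
    \<comment> \<open>An approximant from the union need not be self-adjoint. Its real part stays in
      the same subalgebra and is no farther from \<open>a\<close>, which is its own real
      part.\<close>
    have "An.re_part y = re_part y"
      by (simp add: re_part_def An.re_part_def)
    then have "re_part y \<in> saU"
      using An.re_part_sa[of y] y(1) saU by auto
    moreover have "re_part a = a"
      using re_part_decomp[OF a self_adjoint_zero] ca by (simp add: r_zero)
    then have "cnorm A (a \<ominus>\<^bsub>A\<^esub> re_part y) < e"
      using re_part_minus[OF ca cy] cnorm_re_part[of "a \<ominus>\<^bsub>A\<^esub> y"] ca cy y(2) by (simp add: minus_closed)
    ultimately show "\<exists>b\<in>saU. cnorm A (a \<ominus>\<^bsub>A\<^esub> b) < e"
      by blast
  qed
  \<comment> \<open>\<open>Lf\<close> is infinite off the core, so its unit ball is the core part of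
    the ball of \<open>L\<close>.\<close>
  have "{a \<in> self_adjoint A. Lf a \<le> 1} = {b \<in> saU. L b \<le> 1}"
    using core.V_sa by (auto simp: Lf_def top_unique split: if_splits)
  then have Lbar: "Lbar = core.Lbar"
    by (simp add: Lbar_def Lf_ball_def core.Lbar_def)
  have LbarL: "Lbar a = L a" if "a \<in> saU" for a
    using core.Lbar_core[OF that] by (simp add: Lbar)
  have balls: "{a \<in> saU. Lbar a \<le> 1} = {a \<in> saU. L a \<le> 1}"
    using LbarL by auto
  have fin: "self_adjoint (A\<lparr>carrier := An n\<rparr>) \<subseteq> fin_dom A L" for n
    using saU assms(11) by blast
  have "quasi_Leibniz_qcms C D (A\<lparr>carrier := An n\<rparr>, Lbar)" "quasi_Leibniz_qcms C D (A\<lparr>carrier := An n\<rparr>, L)" for n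
    using saU LbarL by (intro core.subalgebra_quasi_Leibniz assms(6,7) fin; blast)+
  moreover have "(\<lambda>n. propinquity C D (A\<lparr>carrier := An n\<rparr>, Lbar) (A, Lbar)) \<longlonglongrightarrow> 0"
  proof -
    obtain i :: "'a \<Rightarrow> univ" where i: "inj_on i (carrier A)"
    proof (rule separable_injection[OF assms(8) sub])
      show "\<exists>n. \<exists>y\<in>An n. cnorm A (x \<ominus>\<^bsub>A\<^esub> y) < e" if "x \<in> carrier A" "0 < e" for x e
        using approx[OF that] by blast
    qed
    have ev: "\<forall>\<^sub>F n in sequentially. propinquity C D (A\<lparr>carrier := An n\<rparr>, Lbar) (A, Lbar) \<le> ennreal e"
      if e: "0 < e" for e
    proof -
      have "{b \<in> saU. L b \<le> 1} \<subseteq> {a \<in> self_adjoint A. L a \<le> 1}"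
        using core.V_sa by auto
      from core.finite_net[OF this half_gt_zero[OF e]]
      obtain F where F: "finite F" "F \<subseteq> {b \<in> saU. L b \<le> 1}"
        "\<And>a. a \<in> {b \<in> saU. L b \<le> 1} \<Longrightarrow>
          \<exists>f\<in>F. \<exists>r. cnorm A (a \<ominus>\<^bsub>A\<^esub> (f \<oplus>\<^bsub>A\<^esub> complex_of_real r \<odot>\<^bsub>A\<^esub> \<one>\<^bsub>A\<^esub>)) \<le> e / 2"
        by blast
      have "\<exists>N. F \<subseteq> An N"
        using F(1,2)
      proof (induction F)
        case (insert f F)
        then obtain N where "F \<subseteq> An N" by auto
        moreover obtain m where "f \<in> An m"
          using insert.prems by (auto simp: saU_def)
        ultimately show ?case
          using mono[of N "max N m"] mono[of m "max N m"] by (intro exI[of _ "max N m"]) auto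
      qed simp
      then obtain N where N: "F \<subseteq> An N" by blast
      have "propinquity C D (A\<lparr>carrier := An n\<rparr>, Lbar) (A, Lbar) \<le> ennreal e" if n: "N \<le> n" for n
      proof (rule propinquity_subalgebra_le[OF unital_cstar_algebra_axioms i B sub])
        fix b assume b: "b \<in> self_adjoint A" "Lbar b \<le> 1"
        interpret An: unital_cstar_algebra "A\<lparr>carrier := An n\<rparr>"
          by (rule B)
        have cb: "b \<in> carrier A"
          using b by (simp add: self_adjoint_def)
        \<comment> \<open>The error \<open>e\<close> splits in two: one half from \<open>b\<close>
          to a core element of the unit ball, the other from there to a scalar translate of a net
          element.\<close>
        have "core.near b 1"
          using core.Lbar_le_iff[OF b(1), of 1] b(2) Lbar by simp
        then obtain a where a: "a \<in> saU" "L a \<le> 1" "cnorm A (b \<ominus>\<^bsub>A\<^esub> a) < e / 2"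
          using e unfolding core.near_def by (metis ennreal_1 half_gt_zero)
        then obtain f r where f: "f \<in> F" "cnorm A (a \<ominus>\<^bsub>A\<^esub> (f \<oplus>\<^bsub>A\<^esub> complex_of_real r \<odot>\<^bsub>A\<^esub> \<one>\<^bsub>A\<^esub>)) \<le> e / 2"
          using F(3) by blast
        let ?g = "f \<oplus>\<^bsub>A\<^esub> complex_of_real r \<odot>\<^bsub>A\<^esub> \<one>\<^bsub>A\<^esub>"
        have fU: "f \<in> saU" "L f \<le> 1"
          using f(1) F(2) by auto
        have "f \<in> self_adjoint (A\<lparr>carrier := An n\<rparr>)"
          using f(1) N mono[OF n] fU(1) by (auto simp: self_adjoint_def saU_def)
        then have g: "?g \<in> self_adjoint (A\<lparr>carrier := An n\<rparr>)"
          using An.self_adjoint_add[OF _ An.self_adjoint_smult[OF An.self_adjoint_one, of r], of f] by simp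
        \<comment> \<open>Scalars lie in the kernel, so the translate \<open>?g\<close> remains in
          the unit ball; it remains in \<open>An n\<close> because that contains the unit.\<close>
        have "L \<one>\<^bsub>A\<^esub> = 0"
        proof -
          have "complex_of_real 1 \<odot>\<^bsub>A\<^esub> \<one>\<^bsub>A\<^esub> \<in> {a \<in> self_adjoint A. L a = 0}"
            unfolding core.kernel by blast
          then show ?thesis
            by (simp add: one_closed)
        qed
        then have "L ?g \<le> L f + 0"
          using core.L_add[OF core.V_sa[OF fU(1)] self_adjoint_smult[OF self_adjoint_one, of r]]
            core.L_smult[OF self_adjoint_one, of r] by simp
        then have "Lbar ?g \<le> 1"
          using order_trans[of "L ?g" "L f" 1] fU(2) LbarL[OF subsetD[OF saU g]] by simp
        moreover have "cnorm A (?g \<ominus>\<^bsub>A\<^esub> b) \<le> e"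
        proof -
          have c: "a \<in> carrier A" "?g \<in> carrier A"
            using core.V_carrier[OF a(1)] g sub by (auto simp: self_adjoint_def)
          then show ?thesis
            using cnorm_triangle_minus[OF cb c] a(3) f(2) cnorm_minus_commute[OF cb c(2)] by simp
        qed
        ultimately show "\<exists>a\<in>self_adjoint (A\<lparr>carrier := An n\<rparr>). Lbar a \<le> 1 \<and> cnorm A (a \<ominus>\<^bsub>A\<^esub> b) \<le> e"
          using g by blast
      qed (use e in auto)
      then show ?thesis
        by (auto simp: eventually_sequentially)
    qed
    show ?thesis
    \<comment> \<open>Only upper bounds matter for a limit 0 in \<open>ennreal\<close>; an
      intermediate value below \<open>x\<close> supplies the real \<open>e\<close>.\<close>
    proof (rule order_tendstoI)
      fix x :: ennreal assume "0 < x"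
      then obtain y where y: "0 < y" "y < x"
        using dense[OF \<open>0 < x\<close>] by blast
      then obtain e where "0 < e" "y = ennreal e"
        by (cases y) (auto simp: ennreal_less_zero_iff top.extremum_strict)
      then show "\<forall>\<^sub>F n in sequentially. propinquity C D (A\<lparr>carrier := An n\<rparr>, Lbar) (A, Lbar) < x"
        using ev[of e] y(2) by (auto elim!: eventually_mono intro: order_le_less_trans)
    qed simp
  qed
  moreover have "\<forall>n. \<forall>a\<in>self_adjoint (A\<lparr>carrier := An n\<rparr>). Lbar a = L a"
    using LbarL saU by blast
  ultimately show ?thesis
    using core.Lbar_unit_ball core.Lbar_quasi_Leibniz LbarL saU assms(11)
    unfolding balls by (auto simp: Lbar[symmetric] Lf_def fin_dom_def)
qed

end
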